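(* Let $\mu>0$ and let $\lambda_\mu>0$ be a spectral gap constant for $L_\mu$, i.e. $-\langle L_\mu g,g\rangle_H\ge\lambda_\mu\|(I-\Pi)g\|_H^2$ for all $g\in H$, where $\Pi$ is the orthogonal projection of $H$ onto $\operatorname{Ker}(L_\mu)$. For every $0<\delta<\lambda_\mu$ there exists $\rho=\rho(\mu,\delta)>0$ such that if $$g_0\in(\operatorname{Ker}(L_\mu))^\perp\quad\text{and}\quad\|g_0\|_H\le\rho,$$ then the perturbation equation $$\partial_tg=L_\mu g+\Gamma_\mu(g,g)+Q_\mu(g,g,g)$$ admits a unique global solution $g\in C^1([0,\infty);H)$ with $g(0)=g_0$. Moreover, writing $g_t=g(t,\cdot)$, one has $g_t\in(\operatorname{Ker}(L_\mu))^\perp$ for all $t\ge0$ and $$\|g_t\|_H\le e^{-\delta t}\|g_0\|_H\quad\text{for all } t\ge0.$$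
   Context: $H=L^2((0,\infty);\sqrt\omega\,d\omega)$ (real-valued functions) with its natural inner product; $\perp$ is orthogonality in $H$. Let $n(\omega)=\frac1{\omega+\mu}$. For $\omega_0=\omega>0$ let $D(\omega)=\{\omega_1\ge0,\ \omega_2\ge0,\ \omega_1+\omega_2\ge\omega\}$, $\omega_3=\omega_1+\omega_2-\omega$, $\Omega=\min(\sqrt{\omega_0},\sqrt{\omega_1},\sqrt{\omega_2},\sqrt{\omega_3})/\sqrt{\omega_0}$, $n_i=n(\omega_i)$, $g_i=g(\omega_i)$ for $i=0,1,2,3$ (so $g_0$ inside the integrals below means $g(\omega)$). Define, as functions of $\omega$, $$L_\mu g=\iint_{D(\omega)}\Omega\,n_1n_2n_3\Big[-\frac{g_0}{n_0}-\frac{g_3}{n_3}+\frac{g_1}{n_1}+\frac{g_2}{n_2}\Big]d\omega_1d\omega_2,$$ $$\Gamma_\mu(g,g)=\iint_{D(\omega)}\Omega\,n_1n_2n_3\Big[-g_0g_3(n_2^{-1}+n_1^{-1})+g_0g_1(n_3^{-1}-n_2^{-1})+g_0g_2(n_3^{-1}-n_1^{-1})+g_3g_1(n_1^{-1}-n_3^{-1})+g_3g_2(n_2^{-1}-n_3^{-1})+g_1g_2(n_2^{-1}+n_1^{-1})\Big]d\omega_1d\omega_2,$$ $$Q_\mu(g,g,g)=\iint_{D(\omega)}\Omega\,n_1n_2n_3\Big[n_3^{-1}g_0g_1g_2+n_0^{-1}g_1g_2g_3-n_1^{-1}g_0g_2g_3-n_2^{-1}g_0g_1g_3\Big]d\omega_1d\omega_2,$$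 for $g\in C_c^\infty(0,\infty)$, and extended by density and continuity to a bounded linear, bounded quadratic and bounded cubic map $H\to H$, respectively. (The equation is the one satisfied by $g$ when $f=n(1+g)$ solves the isotropic cubic NLS wave kinetic equation $\partial_tf=-\iint_{D(\omega)}\Omega\,(ff_2f_3+ff_1f_3-f_1f_2f-f_1f_2f_3)\,d\omega_1d\omega_2$.) *)

theory Defs
  imports "HOL-Analysis.Analysis"
begin

text \<open>The real Hilbert space \<open>L\<^sup>2((0,\<infinity>); \<surd>\<omega> d\<omega>)\<close>: the measure lives on the whole
  line and gives no mass to the nonpositive half-line, so values there do not matter.\<close>

definition weight_measure :: "real measure" where
  "weight_measure = density lborel (\<lambda>\<omega>. indicator {0<..} \<omega> * ennreal (sqrt \<omega>))"

definition square_integrable :: "(real \<Rightarrow> real) \<Rightarrow> bool" where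
  "square_integrable f \<longleftrightarrow>
     f \<in> borel_measurable weight_measure \<and> integrable weight_measure (\<lambda>\<omega>. (f \<omega>)\<^sup>2)"

lemma square_integrable_measurable [measurable_dest]:
  "square_integrable f \<Longrightarrow> f \<in> borel_measurable weight_measure"
  by (simp add: square_integrable_def)

lemma square_integrable_mult:
  assumes "square_integrable f" "square_integrable g"
  shows "integrable weight_measure (\<lambda>\<omega>. f \<omega> * g \<omega>)"
proof (rule Bochner_Integration.integrable_bound)
  show "integrable weight_measure (\<lambda>\<omega>. (f \<omega>)\<^sup>2 + (g \<omega>)\<^sup>2)"
    using assms by (auto simp: square_integrable_def)
  show "(\<lambda>\<omega>. f \<omega> * g \<omega>) \<in> borel_measurable weight_measure"
    using assms by (auto simp: square_integrable_def)
  have "\<bar>a * b\<bar> \<le> a\<^sup>2 + b\<^sup>2" for a b :: real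
  proof -
    have "2 * \<bar>a * b\<bar> \<le> a\<^sup>2 + b\<^sup>2"
      using sum_squares_bound[of "\<bar>a\<bar>" "\<bar>b\<bar>"] by (simp add: abs_mult mult.assoc)
    then show ?thesis by linarith
  qed
  then show "AE \<omega> in weight_measure. norm (f \<omega> * g \<omega>) \<le> norm ((f \<omega>)\<^sup>2 + (g \<omega>)\<^sup>2)"
    by (auto intro!: AE_I2)
qed

lemma square_integrable_0: "square_integrable (\<lambda>\<omega>. 0)"
  by (simp add: square_integrable_def)

lemma square_integrable_add:
  assumes "square_integrable f" "square_integrable g"
  shows "square_integrable (\<lambda>\<omega>. f \<omega> + g \<omega>)"
proof -
  have "integrable weight_measure (\<lambda>\<omega>. (f \<omega>)\<^sup>2 + (g \<omega>)\<^sup>2 + 2 * (f \<omega> * g \<omega>))"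
    using assms square_integrable_mult[OF assms] by (auto simp: square_integrable_def)
  then show ?thesis
    using assms by (auto simp: square_integrable_def power2_sum mult.assoc)
qed

lemma square_integrable_scale:
  "square_integrable f \<Longrightarrow> square_integrable (\<lambda>\<omega>. c * f \<omega>)"
  by (auto simp: square_integrable_def power_mult_distrib)

quotient_type L2 = "real \<Rightarrow> real" /
  partial: "\<lambda>f g. square_integrable f \<and> square_integrable g \<and>
                  (AE \<omega> in weight_measure. f \<omega> = g \<omega>)"
proof (rule part_equivpI)
  show "\<exists>f. square_integrable f \<and> square_integrable f \<and> (AE \<omega> in weight_measure. f \<omega> = f \<omega>)"
    using square_integrable_0 by auto
  show "symp (\<lambda>f g. square_integrable f \<and> square_integrable g \<and>
                  (AE \<omega> in weight_measure. f \<omega> = g \<omega>))"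
    by (rule sympI) (auto elim: AE_mp)
  show "transp (\<lambda>f g. square_integrable f \<and> square_integrable g \<and>
                  (AE \<omega> in weight_measure. f \<omega> = g \<omega>))"
    by (rule transpI) auto
qed

instantiation L2 :: real_vector
begin

lift_definition zero_L2 :: L2 is "\<lambda>\<omega>. 0"
  by (simp add: square_integrable_0)

lift_definition plus_L2 :: "L2 \<Rightarrow> L2 \<Rightarrow> L2" is "\<lambda>f g \<omega>. f \<omega> + g \<omega>"
  by (auto intro: square_integrable_add)

lift_definition scaleR_L2 :: "real \<Rightarrow> L2 \<Rightarrow> L2" is "\<lambda>c f \<omega>. c * f \<omega>"
  by (auto intro: square_integrable_scale)

definition uminus_L2 :: "L2 \<Rightarrow> L2" where "uminus_L2 f = (-1) *\<^sub>R f"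

definition minus_L2 :: "L2 \<Rightarrow> L2 \<Rightarrow> L2" where "minus_L2 f g = f + (-1) *\<^sub>R g"

instance
proof
  fix f g h :: L2 and a b :: real
  show "f + g + h = f + (g + h)"
    by transfer (auto intro!: square_integrable_add simp: add.assoc)
  show "f + g = g + f"
    by transfer (auto intro!: square_integrable_add simp: add.commute)
  show "0 + f = f"
    by transfer auto
  show "- f + f = 0"
    unfolding uminus_L2_def by transfer (auto intro: square_integrable_0)
  show "f - g = f + - g"
    by (simp add: minus_L2_def uminus_L2_def)
  show "a *\<^sub>R (f + g) = a *\<^sub>R f + a *\<^sub>R g"
    by transfer
      (auto intro!: square_integrable_add square_integrable_scale AE_I2 simp: distrib_left)
  show "(a + b) *\<^sub>R f = a *\<^sub>R f + b *\<^sub>R f"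
    by transfer
      (auto intro!: square_integrable_add square_integrable_scale AE_I2 simp: distrib_right)
  show "a *\<^sub>R b *\<^sub>R f = (a * b) *\<^sub>R f"
    by transfer (auto intro!: square_integrable_scale AE_I2 simp: mult.assoc)
  show "1 *\<^sub>R f = f"
    by transfer auto
qed

end

instantiation L2 :: real_inner
begin

lift_definition inner_L2 :: "L2 \<Rightarrow> L2 \<Rightarrow> real" is
  "\<lambda>f g. LINT \<omega>|weight_measure. f \<omega> * g \<omega>"
proof -
  fix f f' g g'
  assume a: "square_integrable f \<and> square_integrable f' \<and> (AE \<omega> in weight_measure. f \<omega> = f' \<omega>)"
    and b: "square_integrable g \<and> square_integrable g' \<and> (AE \<omega> in weight_measure. g \<omega> = g' \<omega>)"
  then have [measurable]: "f \<in> borel_measurable weight_measure" "f' \<in> borel_measurable weight_measure"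
    "g \<in> borel_measurable weight_measure" "g' \<in> borel_measurable weight_measure"
    by (auto simp: square_integrable_def)
  have "AE \<omega> in weight_measure. f \<omega> * g \<omega> = f' \<omega> * g' \<omega>"
    using a b by auto
  then show "(LINT \<omega>|weight_measure. f \<omega> * g \<omega>) = (LINT \<omega>|weight_measure. f' \<omega> * g' \<omega>)"
    by (intro integral_cong_AE) auto
qed

definition norm_L2 :: "L2 \<Rightarrow> real" where "norm_L2 f = sqrt (f \<bullet> f)"

definition dist_L2 :: "L2 \<Rightarrow> L2 \<Rightarrow> real" where "dist_L2 f g = norm (f - g)"

definition sgn_L2 :: "L2 \<Rightarrow> L2" where "sgn_L2 f = f /\<^sub>R norm f"

definition uniformity_L2 :: "(L2 \<times> L2) filter" where
  "uniformity_L2 = (INF e\<in>{0<..}. principal {(f, g). dist f g < e})"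

definition open_L2 :: "L2 set \<Rightarrow> bool" where
  "open_L2 U \<longleftrightarrow> (\<forall>f\<in>U. \<forall>\<^sub>F (f', g) in uniformity. f' = f \<longrightarrow> g \<in> U)"

instance
proof
  fix f g h :: L2 and a :: real and U :: "L2 set"
  show "dist f g = norm (f - g)"
    by (simp add: dist_L2_def)
  show "sgn f = f /\<^sub>R norm f"
    by (simp add: sgn_L2_def)
  show "uniformity = (INF e\<in>{0<..}. principal {(f, g::L2). dist f g < e})"
    by (simp add: uniformity_L2_def)
  show "open U = (\<forall>f\<in>U. \<forall>\<^sub>F (f', g) in uniformity. f' = f \<longrightarrow> g \<in> U)"
    by (simp add: open_L2_def)
  show "f \<bullet> g = g \<bullet> f"
    by transfer (simp add: mult.commute)
  show "(f + g) \<bullet> h = f \<bullet> h + g \<bullet> h"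
    by transfer (simp add: distrib_right square_integrable_mult)
  show "a *\<^sub>R f \<bullet> g = a * (f \<bullet> g)"
    by transfer (simp add: mult.assoc)
  show "0 \<le> f \<bullet> f"
    by transfer (auto intro: integral_nonneg_AE)
  show "f \<bullet> f = 0 \<longleftrightarrow> f = 0"
  proof transfer
    fix f :: "real \<Rightarrow> real"
    assume "square_integrable f \<and> square_integrable f \<and> (AE \<omega> in weight_measure. f \<omega> = f \<omega>)"
    then have f: "square_integrable f" by simp
    have "(LINT \<omega>|weight_measure. f \<omega> * f \<omega>) = 0 \<longleftrightarrow> (AE \<omega> in weight_measure. f \<omega> * f \<omega> = 0)"
      using square_integrable_mult[OF f f] by (intro integral_nonneg_eq_0_iff_AE) auto
    then show "(LINT \<omega>|weight_measure. f \<omega> * f \<omega>) = 0 \<longleftrightarrow>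
        square_integrable f \<and> square_integrable (\<lambda>\<omega>. 0) \<and> (AE \<omega> in weight_measure. f \<omega> = 0)"
      using f square_integrable_0 by simp
  qed
  show "norm f = sqrt (f \<bullet> f)"
    by (simp add: norm_L2_def)
qed

end

definition orth_proj :: "'a::real_inner set \<Rightarrow> 'a \<Rightarrow> 'a" where
  "orth_proj S x = (THE y. y \<in> S \<and> x - y \<in> S\<^sup>\<bottom>)"

text \<open>Elements of \<open>C\<^sub>c\<^sup>\<infinity>(0,\<infinity>)\<close> are represented by their extension by zero to the real line.\<close>

definition test_function :: "(real \<Rightarrow> real) \<Rightarrow> bool" where
  "test_function g \<longleftrightarrow>
     (\<forall>k. (deriv ^^ k) g differentiable_on UNIV) \<and>
     (\<exists>K. compact K \<and> K \<subseteq> {0<..} \<and> (\<forall>\<omega>. \<omega> \<notin> K \<longrightarrow> g \<omega> = 0))"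

definition equil :: "real \<Rightarrow> real \<Rightarrow> real" where
  "equil \<mu> \<omega> = 1 / (\<omega> + \<mu>)"

definition coll_dom :: "real \<Rightarrow> (real \<times> real) set" where
  "coll_dom \<omega> = {(\<omega>1, \<omega>2). 0 \<le> \<omega>1 \<and> 0 \<le> \<omega>2 \<and> \<omega> \<le> \<omega>1 + \<omega>2}"

text \<open>\<open>coll_integral \<mu> \<omega> F\<close> is the integral of \<open>\<Omega> n\<^sub>1 n\<^sub>2 n\<^sub>3 F(\<omega>\<^sub>1, \<omega>\<^sub>2, \<omega>\<^sub>3)\<close> over
  \<open>D(\<omega>)\<close>, where \<open>\<omega>\<^sub>3 = \<omega>\<^sub>1 + \<omega>\<^sub>2 - \<omega>\<close>. In the bracket of \<open>\<Gamma>\<close>, single terms such as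
  \<open>g\<^sub>0 g\<^sub>1 n\<^sub>3\<^sup>-\<^sup>1\<close> are not integrable against \<open>\<Omega> n\<^sub>1 n\<^sub>2 n\<^sub>3\<close>; only the
  differences are, so the bracket has to stay under a single integral.\<close>

definition coll_integral ::
    "real \<Rightarrow> real \<Rightarrow> (real \<Rightarrow> real \<Rightarrow> real \<Rightarrow> real) \<Rightarrow> real" where
  "coll_integral \<mu> \<omega> F =
     set_lebesgue_integral lborel (coll_dom \<omega>) (\<lambda>(\<omega>1, \<omega>2).
       let \<omega>3 = \<omega>1 + \<omega>2 - \<omega>;
           \<Omega> = Min {sqrt \<omega>, sqrt \<omega>1, sqrt \<omega>2, sqrt \<omega>3} / sqrt \<omega>
       in \<Omega> * equil \<mu> \<omega>1 * equil \<mu> \<omega>2 * equil \<mu> \<omega>3 * F \<omega>1 \<omega>2 \<omega>3)"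

definition L_test :: "real \<Rightarrow> (real \<Rightarrow> real) \<Rightarrow> real \<Rightarrow> real" where
  "L_test \<mu> g \<omega>0 = coll_integral \<mu> \<omega>0 (\<lambda>\<omega>1 \<omega>2 \<omega>3.
     - g \<omega>0 / equil \<mu> \<omega>0 - g \<omega>3 / equil \<mu> \<omega>3 + g \<omega>1 / equil \<mu> \<omega>1 + g \<omega>2 / equil \<mu> \<omega>2)"

definition Gamma_test :: "real \<Rightarrow> (real \<Rightarrow> real) \<Rightarrow> real \<Rightarrow> real" where
  "Gamma_test \<mu> g \<omega>0 = coll_integral \<mu> \<omega>0 (\<lambda>\<omega>1 \<omega>2 \<omega>3.
     let m1 = inverse (equil \<mu> \<omega>1); m2 = inverse (equil \<mu> \<omega>2); m3 = inverse (equil \<mu> \<omega>3)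
     in - g \<omega>0 * g \<omega>3 * (m2 + m1) + g \<omega>0 * g \<omega>1 * (m3 - m2) + g \<omega>0 * g \<omega>2 * (m3 - m1)
        + g \<omega>3 * g \<omega>1 * (m1 - m3) + g \<omega>3 * g \<omega>2 * (m2 - m3) + g \<omega>1 * g \<omega>2 * (m2 + m1))"

definition Q_test :: "real \<Rightarrow> (real \<Rightarrow> real) \<Rightarrow> real \<Rightarrow> real" where
  "Q_test \<mu> g \<omega>0 = coll_integral \<mu> \<omega>0 (\<lambda>\<omega>1 \<omega>2 \<omega>3.
     let m0 = inverse (equil \<mu> \<omega>0); m1 = inverse (equil \<mu> \<omega>1);
         m2 = inverse (equil \<mu> \<omega>2); m3 = inverse (equil \<mu> \<omega>3)
     in m3 * g \<omega>0 * g \<omega>1 * g \<omega>2 + m0 * g \<omega>1 * g \<omega>2 * g \<omega>3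
        - m1 * g \<omega>0 * g \<omega>2 * g \<omega>3 - m2 * g \<omega>0 * g \<omega>1 * g \<omega>3)"

text \<open>Extension by density and continuity: \<open>dense_extension F\<close> is the continuous map on
  \<open>L2\<close> that agrees with \<open>F\<close> on test functions. It is unique because the classes of test
  functions are dense; a bounded linear (quadratic, cubic) extension is in particular
  continuous, hence is this map.\<close>

definition dense_extension :: "((real \<Rightarrow> real) \<Rightarrow> real \<Rightarrow> real) \<Rightarrow> L2 \<Rightarrow> L2" where
  "dense_extension F = (THE T. continuous_on UNIV T \<and>
     (\<forall>g. test_function g \<longrightarrow> square_integrable (F g) \<and> T (abs_L2 g) = abs_L2 (F g)))"

definition L_op :: "real \<Rightarrow> L2 \<Rightarrow> L2" where
  "L_op \<mu> = dense_extension (L_test \<mu>)"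

definition Gamma_op :: "real \<Rightarrow> L2 \<Rightarrow> L2" where
  "Gamma_op \<mu> = dense_extension (Gamma_test \<mu>)"

definition Q_op :: "real \<Rightarrow> L2 \<Rightarrow> L2" where
  "Q_op \<mu> = dense_extension (Q_test \<mu>)"

definition Ker_L :: "real \<Rightarrow> L2 set" where
  "Ker_L \<mu> = {g. L_op \<mu> g = 0}"

definition spectral_gap :: "real \<Rightarrow> real \<Rightarrow> bool" where
  "spectral_gap \<mu> lam \<longleftrightarrow> lam > 0 \<and>
     (\<forall>g. - (L_op \<mu> g \<bullet> g) \<ge> lam * (norm (g - orth_proj (Ker_L \<mu>) g))\<^sup>2)"

text \<open>The derivative at \<open>0\<close> is one-sided; values at negative times are irrelevant.\<close>

definition global_solution :: "real \<Rightarrow> L2 \<Rightarrow> (real \<Rightarrow> L2) \<Rightarrow> bool" where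
  "global_solution \<mu> g0 g \<longleftrightarrow> g 0 = g0 \<and>
     (\<exists>g'. continuous_on {0..} g' \<and>
        (\<forall>t\<ge>0. (g has_vector_derivative g' t) (at t within {0..}) \<and>
               g' t = L_op \<mu> (g t) + Gamma_op \<mu> (g t) + Q_op \<mu> (g t)))"

end

theory Submission
  imports Defs
begin

text \<open>
  In the Hilbert space \<open>L\<^sup>2((0,\<infinity>); \<surd>\<omega> d\<omega>)\<close> the perturbation equation is an ordinary differential
  equation \<open>g' = F g\<close> with \<open>F = L + \<Gamma> + Q\<close>. Three properties of \<open>F\<close> give the theorem.

  \<open>F\<close> is locally Lipschitz, because the three operators are bounded (linear, quadratic, cubic).
  Write \<open>\<sigma>\<close> for the measure \<open>\<surd>(min \<omega>\<^sub>i) d\<omega>\<^sub>0 d\<omega>\<^sub>1 d\<omega>\<^sub>2\<close> on the quadruples of positive frequencies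
  with \<open>\<omega>\<^sub>0 + \<omega>\<^sub>3 = \<omega>\<^sub>1 + \<omega>\<^sub>2\<close> (\<open>coll_measure\<close>). Since \<open>\<surd>\<omega>\<^sub>0 \<Omega> = \<surd>(min \<omega>\<^sub>i)\<close>, pairing an operator
  with \<open>h\<close> means integrating its integrand times \<open>h(\<omega>\<^sub>0)\<close> against \<open>\<sigma>\<close>. After the cancellations
  \<open>1/n\<^sub>3 - 1/n\<^sub>2 = \<omega>\<^sub>3 - \<omega>\<^sub>2 = \<omega>\<^sub>1 - \<omega>\<^sub>0\<close> every term of the integrand is absolutely integrable: two
  of the functions are paired by Cauchy-Schwarz, directly if both are evaluated at \<open>\<omega>\<^sub>0\<close> and by a
  Schur test otherwise (\<open>coll_bounded_diagonal\<close>, \<open>coll_bounded_Schur\<close>), and the remaining factors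
  contribute a collision frequency that is bounded uniformly in \<open>\<omega>\<^sub>0\<close>. All these frequency bounds
  come from one scale-invariant integral (\<open>nn_integral_scaling_kernel_le\<close>). Together with the
  density of test functions this identifies \<open>L_op\<close>, \<open>Gamma_op\<close> and \<open>Q_op\<close> with explicit operators
  (\<open>L_op_eq\<close>, \<open>Gamma_op_eq\<close>, \<open>Q_op_eq\<close>).

  \<open>F\<close> takes values in the orthogonal complement of \<open>Ker L\<close>. The measure \<open>\<sigma>\<close> is invariant under the
  symmetries of a collision and the three integrands are symmetric or antisymmetric, so \<open>4 \<langle>F g, h\<rangle>\<close>
  is an integral whose integrand has the factor \<open>\<psi>\<^sub>0 + \<psi>\<^sub>3 - \<psi>\<^sub>1 - \<psi>\<^sub>2\<close>, where \<open>\<psi> = h/n\<close>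
  (\<open>symmetrised_form\<close>). For \<open>L\<close> and \<open>g = h\<close> the integrand is a negative multiple of the square of
  this factor. Hence it vanishes almost everywhere if \<open>L h = 0\<close>, and then \<open>\<langle>F g, h\<rangle> = 0\<close> for all
  \<open>g\<close>.

  \<open>F\<close> is dissipative on a small ball of that complement, where the spectral gap gives
  \<open>\<langle>F x, x\<rangle> \<le> (- \<lambda> + O(\<parallel>x\<parallel>)) \<parallel>x\<parallel>\<^sup>2\<close>. An abstract argument (\<open>dissipative_ode\<close>) then yields a global
  solution with exponential decay, and \<open>ode_unique\<close> its uniqueness.
\<close>

section \<open>Completeness of the weighted space\<close>

lemma rep_L2_square_integrable: "square_integrable (rep_L2 f)"
  using Quotient_rep_reflp[OF Quotient_L2, of f] by (simp add: cr_L2_def) 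

lemma abs_L2_eq_iff:
  assumes "square_integrable f" "square_integrable g"
  shows "abs_L2 f = abs_L2 g \<longleftrightarrow> (AE \<omega> in weight_measure. f \<omega> = g \<omega>)"
  using Quotient_rel[OF Quotient_L2, of f g] assms by auto

lemma abs_rep_L2: "abs_L2 (rep_L2 f) = f"
  by (rule Quotient_abs_rep[OF Quotient_L2])

lemma abs_L2_add:
  assumes "square_integrable f" "square_integrable g"
  shows "abs_L2 f + abs_L2 g = abs_L2 (\<lambda>\<omega>. f \<omega> + g \<omega>)"
  using plus_L2.abs_eq assms by simp

lemma abs_L2_scale:
  assumes "square_integrable f"
  shows "c *\<^sub>R abs_L2 f = abs_L2 (\<lambda>\<omega>. c * f \<omega>)"
  using scaleR_L2.abs_eq assms by simp

lemma square_integrable_diff: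
  assumes "square_integrable f" "square_integrable g"
  shows "square_integrable (\<lambda>\<omega>. f \<omega> - g \<omega>)"
  using square_integrable_add[OF assms(1) square_integrable_scale[OF assms(2), of "-1"]] by simp

lemma abs_L2_diff:
  assumes "square_integrable f" "square_integrable g"
  shows "abs_L2 f - abs_L2 g = abs_L2 (\<lambda>\<omega>. f \<omega> - g \<omega>)"
  unfolding minus_L2_def abs_L2_scale[OF assms(2)]
    abs_L2_add[OF assms(1) square_integrable_scale[OF assms(2)]] by simp

lemma inner_abs_L2:
  assumes "square_integrable f" "square_integrable g"
  shows "abs_L2 f \<bullet> abs_L2 g = (LINT \<omega>|weight_measure. f \<omega> * g \<omega>)"
  using inner_L2.abs_eq assms by simp

lemma norm_abs_L2:
  assumes "square_integrable f"
  shows "(norm (abs_L2 f))\<^sup>2 = (LINT \<omega>|weight_measure. (f \<omega>)\<^sup>2)"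
  using assms by (simp only: power2_norm_eq_inner inner_abs_L2) (simp add: power2_eq_square)

lemma sets_weight_measure [simp, measurable_cong]: "sets weight_measure = sets borel"
  by (simp add: weight_measure_def)

lemma space_weight_measure [simp]: "space weight_measure = UNIV"
  by (simp add: weight_measure_def)

lemma L2_cases:
  obtains f where "square_integrable f" "x = abs_L2 f"
  using rep_L2_square_integrable abs_rep_L2 by metis

text \<open>The squared norm as an extended nonnegative number, available before square integrability is known.\<close>

definition l2_square :: "(real \<Rightarrow> real) \<Rightarrow> ennreal" where
  "l2_square f = (\<integral>\<^sup>+\<omega>. ennreal ((f \<omega>)\<^sup>2) \<partial>weight_measure)"

lemma l2_square_eq: "square_integrable f \<Longrightarrow> l2_square f = ennreal ((norm (abs_L2 f))\<^sup>2)"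
  by (simp add: l2_square_def norm_abs_L2 square_integrable_def nn_integral_eq_integral)

lemma square_integrable_iff_l2_square:
  "square_integrable f \<longleftrightarrow> f \<in> borel_measurable borel \<and> l2_square f < \<infinity>"
proof -
  have m: "borel_measurable weight_measure = (borel_measurable borel :: (real \<Rightarrow> real) set)"
    by (rule measurable_cong_sets) simp_all
  show ?thesis
    unfolding square_integrable_def m
    by (auto simp: l2_square_def integrable_iff_bounded m)
qed

lemma norm_abs_L2_le:
  assumes "f \<in> borel_measurable borel" "l2_square f \<le> ennreal (c\<^sup>2)" "c \<ge> 0"
  shows "square_integrable f \<and> norm (abs_L2 f) \<le> c"
proof -
  have s: "square_integrable f"
    using assms by (auto simp: square_integrable_iff_l2_square intro: order_le_less_trans)
  then show ?thesis
    using assms l2_square_eq[OF s] power2_le_imp_le[of "norm (abs_L2 f)" c] by auto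
qed

text \<open>The increments \<open>d\<^sub>n\<close> satisfy \<open>\<integral> \<Sum> 2\<^sup>n d\<^sub>n\<^sup>2 < \<infinity>\<close>, and \<open>2 \<bar>x\<bar> \<le> 2\<^sup>n x\<^sup>2 + 2\<^sup>-\<^sup>n\<close>; so they are
  summable almost everywhere and the functions converge pointwise. Fatou's lemma turns the Cauchy
  estimate into convergence in norm.\<close>

lemma fast_Cauchy_converges:
  fixes f :: "nat \<Rightarrow> real \<Rightarrow> real"
  assumes sq: "\<And>n. square_integrable (f n)"
    and fast: "\<And>n. norm (abs_L2 (f (Suc n)) - abs_L2 (f n)) \<le> (1/2) ^ n"
  shows "\<exists>g. square_integrable g \<and> (\<lambda>n. abs_L2 (f n)) \<longlonglongrightarrow> abs_L2 g"
proof -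
  have m [measurable]: "f n \<in> borel_measurable borel" for n
    using sq by (simp add: square_integrable_iff_l2_square)
  define d where "d n \<omega> = f (Suc n) \<omega> - f n \<omega>" for n \<omega>
  have sd: "square_integrable (d n)" for n
    unfolding d_def by (intro square_integrable_diff sq)
  have [measurable]: "d n \<in> borel_measurable borel" for n
    unfolding d_def by measurable
  have ld: "l2_square (d n) \<le> ennreal ((1/4) ^ n)" for n
  proof -
    have "abs_L2 (d n) = abs_L2 (f (Suc n)) - abs_L2 (f n)"
      by (simp add: abs_L2_diff[OF sq sq] d_def[abs_def])
    then have "norm (abs_L2 (d n)) ^ 2 \<le> ((1/2) ^ n) ^ 2"
      using fast[of n] by (intro power_mono) auto
    then show ?thesis
      by (simp add: l2_square_eq[OF sd] power2_eq_square power_mult_distrib[symmetric])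
  qed
  define S where "S \<omega> = (\<Sum>n. ennreal (2 ^ n * (d n \<omega>)\<^sup>2))" for \<omega>
  have "(\<integral>\<^sup>+\<omega>. S \<omega> \<partial>weight_measure) = (\<Sum>n. \<integral>\<^sup>+\<omega>. ennreal (2 ^ n * (d n \<omega>)\<^sup>2) \<partial>weight_measure)"
    unfolding S_def by (intro nn_integral_suminf) measurable
  also have "\<dots> = (\<Sum>n. ennreal (2 ^ n) * l2_square (d n))"
    by (simp add: l2_square_def ennreal_mult nn_integral_cmult)
  also have "\<dots> \<le> (\<Sum>n. ennreal ((1/2) ^ n))"
  proof (intro suminf_le)
    fix n
    have "ennreal (2 ^ n) * l2_square (d n) \<le> ennreal (2 ^ n) * ennreal ((1/4) ^ n)"
      using ld by (intro mult_left_mono) auto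
    also have "\<dots> = ennreal ((1/2) ^ n)"
      by (simp add: ennreal_mult[symmetric] power_mult_distrib[symmetric])
    finally show "ennreal (2 ^ n) * l2_square (d n) \<le> ennreal ((1/2) ^ n)" .
  qed auto
  also have "\<dots> < \<infinity>"
    by (subst suminf_ennreal2) (auto intro!: summable_geometric)
  finally have "(\<integral>\<^sup>+\<omega>. S \<omega> \<partial>weight_measure) \<noteq> \<infinity>" by simp
  then have "AE \<omega> in weight_measure. S \<omega> \<noteq> \<infinity>"
    by (intro nn_integral_noteq_infinite) (auto simp: S_def)
  moreover have "convergent (\<lambda>n. f n \<omega>)" if "S \<omega> \<noteq> \<infinity>" for \<omega>
  proof -
    have "summable (\<lambda>n. 2 ^ n * (d n \<omega>)\<^sup>2)"
      using that unfolding S_def by (intro summable_suminf_not_top) auto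
    then have "summable (\<lambda>n. (2 ^ n * (d n \<omega>)\<^sup>2 + (1/2) ^ n))"
      by (intro summable_add summable_geometric) auto
    then have "summable (\<lambda>n. d n \<omega>)"
    proof (rule summable_comparison_test'[where N=0])
      fix n
      have "2 * (2 ^ n * \<bar>d n \<omega>\<bar>) * 1 \<le> (2 ^ n * \<bar>d n \<omega>\<bar>)\<^sup>2 + 1\<^sup>2"
        by (rule sum_squares_bound)
      then have "2 * (2 ^ n * \<bar>d n \<omega>\<bar>) \<le> 2 ^ n * (2 ^ n * (d n \<omega>)\<^sup>2 + (1/2) ^ n)"
        by (simp add: power2_eq_square algebra_simps flip: power_mult_distrib)
      then have "2 ^ n * (2 * \<bar>d n \<omega>\<bar>) \<le> 2 ^ n * (2 ^ n * (d n \<omega>)\<^sup>2 + (1/2) ^ n)"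
        by (simp add: ac_simps)
      then have "2 * \<bar>d n \<omega>\<bar> \<le> 2 ^ n * (d n \<omega>)\<^sup>2 + (1/2) ^ n"
        by (subst (asm) mult_le_cancel_left_pos) auto
      then show "norm (d n \<omega>) \<le> 2 ^ n * (d n \<omega>)\<^sup>2 + (1/2) ^ n"
        by simp
    qed
    then have "convergent (\<lambda>n. \<Sum>k<n. d k \<omega>)" by (simp add: summable_iff_convergent)
    then have "convergent (\<lambda>n. (\<Sum>k<n. d k \<omega>) + f 0 \<omega>)"
      by (intro convergent_add convergent_const)
    then have "convergent (\<lambda>n. (f n \<omega> - f 0 \<omega>) + f 0 \<omega>)"
      by (simp only: d_def sum_lessThan_telescope[of "\<lambda>n. f n \<omega>"])
    then show ?thesis by simp
  qed
  ultimately have conv: "AE \<omega> in weight_measure. convergent (\<lambda>n. f n \<omega>)" by (auto elim: eventually_mono)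
  define g where "g \<omega> = lim (\<lambda>n. f n \<omega>)" for \<omega>
  have [measurable]: "g \<in> borel_measurable borel" unfolding g_def by measurable
  have lim: "AE \<omega> in weight_measure. (\<lambda>n. f n \<omega>) \<longlonglongrightarrow> g \<omega>"
    using conv unfolding g_def convergent_LIMSEQ_iff .
  have tail: "norm (abs_L2 (f (n + k)) - abs_L2 (f n)) \<le> 2 * (1/2) ^ n" for n k
  proof -
    have "norm (abs_L2 (f (n + k)) - abs_L2 (f n)) \<le> 2 * (1/2) ^ n - 2 * (1/2) ^ (n + k)"
    proof (induction k)
      case (Suc k)
      have "norm (abs_L2 (f (n + Suc k)) - abs_L2 (f n)) \<le>
          norm (abs_L2 (f (Suc (n + k))) - abs_L2 (f (n + k))) + norm (abs_L2 (f (n + k)) - abs_L2 (f n))"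
        using norm_triangle_ineq[of "abs_L2 (f (Suc (n + k))) - abs_L2 (f (n + k))" "abs_L2 (f (n
            + k)) - abs_L2 (f n)"]
        by simp
      then show ?case using Suc fast[of "n + k"] by simp
    qed simp
    also have "\<dots> \<le> 2 * (1/2) ^ n" by simp
    finally show ?thesis .
  qed
  have diff: "l2_square (\<lambda>\<omega>. g \<omega> - f n \<omega>) \<le> ennreal ((2 * (1/2) ^ n)\<^sup>2)" for n
  proof -
    have "l2_square (\<lambda>\<omega>. g \<omega> - f n \<omega>)
        = (\<integral>\<^sup>+\<omega>. liminf (\<lambda>k. ennreal ((f (n + k) \<omega> - f n \<omega>)\<^sup>2)) \<partial>weight_measure)"
      unfolding l2_square_def
    proof (rule nn_integral_cong_AE, use lim in eventually_elim)
      fix \<omega> assume "(\<lambda>k. f k \<omega>) \<longlonglongrightarrow> g \<omega>"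
      then have "(\<lambda>k. f (n + k) \<omega>) \<longlonglongrightarrow> g \<omega>"
        using LIMSEQ_ignore_initial_segment[of "\<lambda>k. f k \<omega>" "g \<omega>" n] by (simp add: add.commute)
      then have "(\<lambda>k. ennreal ((f (n + k) \<omega> - f n \<omega>)\<^sup>2)) \<longlonglongrightarrow> ennreal ((g \<omega> - f n \<omega>)\<^sup>2)"
        by (intro tendsto_intros)
      then show "ennreal ((g \<omega> - f n \<omega>)\<^sup>2) = liminf (\<lambda>k. ennreal ((f (n + k) \<omega> - f n \<omega>)\<^sup>2))"
        using lim_imp_Liminf[OF sequentially_bot] by metis
    qed
    also have "\<dots> \<le> liminf (\<lambda>k. \<integral>\<^sup>+\<omega>. ennreal ((f (n + k) \<omega> - f n \<omega>)\<^sup>2) \<partial>weight_measure)"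
      by (rule nn_integral_liminf) measurable
    also have "\<dots> = liminf (\<lambda>k. ennreal ((norm (abs_L2 (f (n + k)) - abs_L2 (f n)))\<^sup>2))"
      using l2_square_eq[OF square_integrable_diff[OF sq sq]]
      by (simp add: l2_square_def abs_L2_diff[OF sq sq])
    also have "\<dots> \<le> liminf (\<lambda>k::nat. ennreal ((2 * (1/2) ^ n)\<^sup>2))"
      using tail by (intro Liminf_mono always_eventually allI ennreal_leI power_mono) auto
    finally show ?thesis by (simp add: Liminf_const)
  qed
  have sdiff: "square_integrable (\<lambda>\<omega>. g \<omega> - f n \<omega>)"
    "norm (abs_L2 (\<lambda>\<omega>. g \<omega> - f n \<omega>)) \<le> 2 * (1/2) ^ n" for n
    using norm_abs_L2_le[OF _ diff] by auto
  have sg: "square_integrable g"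
    using square_integrable_add[OF sdiff(1)[of 0] sq[of 0]] by simp
  have "(\<lambda>n. abs_L2 (f n)) \<longlonglongrightarrow> abs_L2 g"
  proof (rule LIM_zero_cancel, rule Lim_null_comparison)
    show "\<forall>\<^sub>F n in sequentially. norm (abs_L2 (f n) - abs_L2 g) \<le> 2 * (1/2) ^ n"
      using sdiff by (simp add: abs_L2_diff[OF sg sq] norm_minus_commute[of "abs_L2 (f _)"])
    show "(\<lambda>n. 2 * (1/2) ^ n) \<longlonglongrightarrow> (0::real)"
      by (auto intro!: tendsto_eq_intros LIMSEQ_realpow_zero)
  qed
  then show ?thesis using sg by (intro exI[of _ g] conjI)
qed

instance L2 :: complete_space
proof
  fix X :: "nat \<Rightarrow> L2" assume X: "Cauchy X"
  have "\<exists>r. strict_mono r \<and> (\<forall>n. norm (X (r (Suc n)) - X (r n)) \<le> (1/2) ^ n)"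
  proof -
    have "\<forall>n. \<exists>N. \<forall>i\<ge>N. \<forall>j\<ge>N. dist (X i) (X j) < (1/2) ^ n"
      using X by (auto simp: Cauchy_def)
    then obtain N where N: "\<And>n i j. i \<ge> N n \<Longrightarrow> j \<ge> N n \<Longrightarrow> dist (X i) (X j) < (1/2) ^ n"
      by metis
    define r where "r n = n + (\<Sum>k\<le>n. N k)" for n
    have "N n \<le> (\<Sum>k\<le>n. N k)" for n
      by (rule member_le_sum) auto
    then have "r (Suc n) \<ge> N n" "r n \<ge> N n" for n
      by (simp_all add: r_def trans_le_add1 trans_le_add2 le_SucI)
    then have le: "norm (X (r (Suc n)) - X (r n)) \<le> (1/2) ^ n" for n
      using N[of n "r (Suc n)" "r n"] by (simp add: dist_norm)
    have "strict_mono r" by (auto simp: strict_mono_Suc_iff r_def)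
    with le show ?thesis by (intro exI[of _ r] conjI allI)
  qed
  then obtain r where r: "strict_mono r" "\<And>n. norm (X (r (Suc n)) - X (r n)) \<le> (1/2) ^ n"
    by blast
  have "\<exists>g. square_integrable g \<and> (\<lambda>n. abs_L2 (rep_L2 (X (r n)))) \<longlonglongrightarrow> abs_L2 g"
    using r(2) by (intro fast_Cauchy_converges) (auto simp: rep_L2_square_integrable abs_rep_L2)
  then obtain g where "(\<lambda>n. abs_L2 (rep_L2 (X (r n)))) \<longlonglongrightarrow> abs_L2 g"
    by (elim exE conjE)
  then have "(X \<circ> r) \<longlonglongrightarrow> abs_L2 g"
    by (simp only: abs_rep_L2 o_def)
  from Cauchy_converges_subseq[OF X r(1) this] show "convergent X"
    by (rule convergentI)
qed

instance L2 :: banach ..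

section \<open>Density of test functions\<close>

text \<open>Smoothness is approached through finite orders of differentiability, since closure under products is
  an induction on the order.\<close>

definition smooth_upto :: "nat \<Rightarrow> (real \<Rightarrow> real) \<Rightarrow> bool" where
  "smooth_upto k f \<longleftrightarrow> (\<forall>j<k. (deriv ^^ j) f differentiable_on UNIV)"

lemma smooth_upto_0 [simp]: "smooth_upto 0 f"
  by (simp add: smooth_upto_def)

lemma smooth_upto_Suc_iff:
  "smooth_upto (Suc k) f \<longleftrightarrow> (\<forall>x. (f has_real_derivative deriv f x) (at x)) \<and> smooth_upto k (deriv f)"
proof -
  have "f differentiable_on UNIV \<longleftrightarrow> (\<forall>x. (f has_real_derivative deriv f x) (at x))"
    by (auto simp: differentiable_on_def real_differentiable_def DERIV_deriv_iff_real_differentiable)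
  moreover have "smooth_upto (Suc k) f \<longleftrightarrow> f differentiable_on UNIV \<and> smooth_upto k (deriv f)"
    unfolding smooth_upto_def All_less_Suc2 by (simp add: funpow_Suc_right del: funpow.simps(2))
  ultimately show ?thesis by simp
qed

lemma smooth_upto_SucI:
  assumes "\<And>x. (f has_real_derivative f' x) (at x)" "smooth_upto k f'"
  shows "smooth_upto (Suc k) f"
proof -
  have "deriv f = f'" using assms(1) DERIV_imp_deriv by blast
  then show ?thesis using assms by (simp add: smooth_upto_Suc_iff)
qed

lemma smooth_upto_lower: "smooth_upto (Suc k) f \<Longrightarrow> smooth_upto k f"
  by (simp add: smooth_upto_def)

lemma smooth_upto_const: "smooth_upto k (\<lambda>x. c)"
proof (induction k arbitrary: c)
  case (Suc k)
  show ?case by (rule smooth_upto_SucI[OF _ Suc[of 0]]) auto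
qed simp

lemma smooth_upto_add: "smooth_upto k f \<Longrightarrow> smooth_upto k g \<Longrightarrow> smooth_upto k (\<lambda>x. f x + g x)"
proof (induction k arbitrary: f g)
  case (Suc k)
  then show ?case
    by (intro smooth_upto_SucI[of _ "\<lambda>x. deriv f x + deriv g x"])
       (auto simp: smooth_upto_Suc_iff intro!: derivative_intros)
qed simp

lemma smooth_upto_mult: "smooth_upto k f \<Longrightarrow> smooth_upto k g \<Longrightarrow> smooth_upto k (\<lambda>x. f x * g x)"
proof (induction k arbitrary: f g)
  case (Suc k)
  then have "smooth_upto k (\<lambda>x. deriv f x * g x + f x * deriv g x)"
    using smooth_upto_lower[of k] by (intro smooth_upto_add Suc.IH) (auto simp: smooth_upto_Suc_iff)
  then show ?case
    using Suc.prems
    by (intro smooth_upto_SucI[of _ "\<lambda>x. deriv f x * g x + f x * deriv g x"])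
       (auto simp: smooth_upto_Suc_iff intro!: derivative_eq_intros)
qed simp

lemma smooth_upto_power: "smooth_upto k f \<Longrightarrow> smooth_upto k (\<lambda>x. f x ^ n)"
  by (induction n) (auto intro: smooth_upto_const smooth_upto_mult)

lemma smooth_upto_affine: "smooth_upto k f \<Longrightarrow> smooth_upto k (\<lambda>x. f (a * x + b))"
proof (induction k arbitrary: f)
  case (Suc k)
  then have "smooth_upto k (\<lambda>x. a * deriv f (a * x + b))"
    by (intro smooth_upto_mult smooth_upto_const Suc.IH) (auto simp: smooth_upto_Suc_iff)
  moreover have "((\<lambda>x. f (a * x + b)) has_real_derivative a * deriv f (a * x + b)) (at x)" for x
  proof -
    have "((\<lambda>x. a * x + b) has_real_derivative a) (at x)"
      by (auto intro!: derivative_eq_intros)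
    then show ?thesis
      using Suc.prems DERIV_chain2[of f "deriv f (a * x + b)" "\<lambda>x. a * x + b" x a UNIV]
      by (simp add: smooth_upto_Suc_iff mult.commute[of a "deriv f _"])
  qed
  ultimately show ?case by (rule smooth_upto_SucI[rotated])
qed simp

text \<open>The functions \<open>x\<^sup>-\<^sup>k exp (- 1/x)\<close>, continued by zero. The derivative of each of them is a linear
  combination of two others, which makes the whole family smooth; \<open>k = 0\<close> is the usual building
  block of bump functions.\<close>

definition flat_exp :: "nat \<Rightarrow> real \<Rightarrow> real" where
  "flat_exp k x = (if x > 0 then (1 / x) ^ k / exp (1 / x) else 0)"

lemma flat_exp_derivative:
  "(flat_exp k has_real_derivative (flat_exp (k + 2) x + (- real k) * flat_exp (k + 1) x)) (at x)"
proof -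
  consider "x > 0" | "x < 0" | "x = 0" by linarith
  then show ?thesis
  proof cases
    case 1
    have "((\<lambda>x. (1 / x) ^ k / exp (1 / x)) has_real_derivative
        (flat_exp (k + 2) x + (- real k) * flat_exp (k + 1) x)) (at x)"
    proof -
      define u where "u = 1 / x"
      have u: "((\<lambda>x. 1 / x) has_real_derivative - (u\<^sup>2)) (at x)"
        using 1 by (auto intro!: derivative_eq_intros simp: u_def power2_eq_square)
      have e: "((\<lambda>v. exp (- v)) has_real_derivative - exp (- u)) (at u)"
        by (auto intro!: derivative_eq_intros)
      have "((\<lambda>v. v ^ k * exp (- v)) has_real_derivative (real k * u ^ (k - 1)) * exp (- u)
          + (- exp (- u)) * u ^ k) (at u)"
        using DERIV_mult[OF DERIV_pow[of k u] e] by simp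
      then have A: "((\<lambda>x. (1 / x) ^ k * exp (- (1 / x))) has_real_derivative
          ((real k * u ^ (k - 1)) * exp (- u) + (- exp (- u)) * u ^ k) * - (u\<^sup>2)) (at x)"
        using DERIV_chain2[OF _ u] unfolding u_def by fast
      have B: "real k * u ^ (k - 1) * u\<^sup>2 = real k * u ^ (k + 1)"
        by (cases k) (simp_all add: power2_eq_square)
      have C: "flat_exp j x = u ^ j * exp (- u)" for j
        using 1 by (simp add: flat_exp_def u_def exp_minus divide_inverse)
      have "((real k * u ^ (k - 1)) * exp (- u) + (- exp (- u)) * u ^ k) * - (u\<^sup>2)
          = u ^ (k + 2) * exp (- u) - (real k * u ^ (k - 1) * u\<^sup>2) * exp (- u)"
        by (simp add: power_add algebra_simps power2_eq_square)
      also have "\<dots> = flat_exp (k + 2) x + (- real k) * flat_exp (k + 1) x"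
        unfolding B C by simp
      finally have D: "((real k * u ^ (k - 1)) * exp (- u) + (- exp (- u)) * u ^ k) * - (u\<^sup>2)
          = flat_exp (k + 2) x + (- real k) * flat_exp (k + 1) x" .
      have "(\<lambda>x. (1 / x) ^ k * exp (- (1 / x))) = (\<lambda>x::real. (1 / x) ^ k / exp (1 / x))"
        unfolding exp_minus divide_inverse[of _ "exp _"] ..
      with A show ?thesis unfolding D by (simp only:)
    qed
    then show ?thesis
      by (rule has_field_derivative_transform_within_open[where S = "{0<..}"])
         (use 1 in \<open>auto simp: flat_exp_def\<close>)
  next
    case 2
    have "((\<lambda>x. 0) has_real_derivative (flat_exp (k + 2) x + (- real k) * flat_exp (k + 1) x)) (at x)"
      using 2 by (auto simp: flat_exp_def)
    then show ?thesis
      by (rule has_field_derivative_transform_within_open[where S = "{..<0}"])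
         (use 2 in \<open>auto simp: flat_exp_def\<close>)
  next
    case 3
    have "((\<lambda>h. flat_exp k h / h) \<longlongrightarrow> 0) (at_right 0)"
    proof (rule Lim_transform_eventually)
      show "((\<lambda>h::real. (inverse h) ^ (k + 1) / exp (inverse h)) \<longlongrightarrow> 0) (at_right 0)"
        by (rule filterlim_compose[OF tendsto_power_div_exp_0 filterlim_inverse_at_top_right])
      show "\<forall>\<^sub>F h in at_right 0. (inverse h) ^ (k + 1) / exp (inverse h) = flat_exp k h / h"
        using eventually_at_right_less[of 0]
        by eventually_elim (auto simp: flat_exp_def field_simps)
    qed
    moreover have "((\<lambda>h. flat_exp k h / h) \<longlongrightarrow> 0) (at_left 0)"
    proof (rule Lim_transform_eventually)
      show "((\<lambda>h::real. 0::real) \<longlongrightarrow> 0) (at_left 0)" by simp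
      show "\<forall>\<^sub>F h in at_left 0. 0 = flat_exp k h / h"
        by (auto simp: flat_exp_def eventually_at_filter)
    qed
    ultimately have "((\<lambda>h. flat_exp k h / h) \<longlongrightarrow> 0) (at 0)"
      by (simp add: filterlim_split_at)
    with 3 show ?thesis by (simp add: DERIV_def flat_exp_def)
  qed
qed

lemma smooth_upto_flat_exp: "smooth_upto j (flat_exp k)"
proof (induction j arbitrary: k)
  case (Suc j)
  show ?case
    by (rule smooth_upto_SucI[OF flat_exp_derivative])
       (intro smooth_upto_add smooth_upto_mult smooth_upto_const Suc)
qed simp

text \<open>A polynomial in a bump with values in \<open>(0,1]\<close> on \<open>(a,b)\<close> and zero elsewhere; for large \<open>n\<close> it
  approaches the indicator of \<open>(a,b)\<close>.\<close>

definition interval_bump :: "real \<Rightarrow> real \<Rightarrow> nat \<Rightarrow> real \<Rightarrow> real" where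
  "interval_bump a b n x = 1 - (1 - flat_exp 0 (x - a) * flat_exp 0 (b - x)) ^ n"

lemma flat_exp_0_bounds: "0 \<le> flat_exp 0 x" "flat_exp 0 x \<le> 1" "x > 0 \<Longrightarrow> flat_exp 0 x > 0" "x \<le> 0
    \<Longrightarrow> flat_exp 0 x = 0"
  by (auto simp: flat_exp_def)

lemma interval_bump_limit: "(\<lambda>n. interval_bump a b n x) \<longlonglongrightarrow> indicator {a<..<b} x"
proof (cases "x \<in> {a<..<b}")
  case True
  define c where "c = flat_exp 0 (x - a) * flat_exp 0 (b - x)"
  have "0 < c" "c \<le> 1"
    using True flat_exp_0_bounds by (auto simp: c_def mult_le_one)
  then have "(\<lambda>n. 1 - (1 - c) ^ n) \<longlonglongrightarrow> 1 - 0"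
    by (intro tendsto_intros LIMSEQ_realpow_zero) auto
  then show ?thesis using True by (simp add: interval_bump_def c_def)
next
  case False
  then have "flat_exp 0 (x - a) * flat_exp 0 (b - x) = 0"
    using flat_exp_0_bounds(4)[of "x - a"] flat_exp_0_bounds(4)[of "b - x"] by auto
  with False show ?thesis unfolding interval_bump_def by (simp only:) simp
qed

lemma interval_bump_le_indicator: "\<bar>interval_bump a b n x\<bar> \<le> indicator {a..b} x"
proof (cases "x \<in> {a..b}")
  case True
  define c where "c = flat_exp 0 (x - a) * flat_exp 0 (b - x)"
  have "0 \<le> c" "c \<le> 1"
    using flat_exp_0_bounds by (auto simp: c_def mult_le_one)
  then have "0 \<le> (1 - c) ^ n" "(1 - c) ^ n \<le> 1"
    by (auto intro: power_le_one)
  then show ?thesis using True by (simp add: interval_bump_def c_def)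
next
  case False
  then have "flat_exp 0 (x - a) * flat_exp 0 (b - x) = 0"
    using flat_exp_0_bounds(4)[of "x - a"] flat_exp_0_bounds(4)[of "b - x"] by auto
  with False show ?thesis unfolding interval_bump_def by (simp only:) simp
qed

lemma test_function_iff_smooth:
  "test_function g \<longleftrightarrow> (\<forall>k. smooth_upto k g) \<and> (\<exists>K. compact K \<and> K \<subseteq> {0<..} \<and> (\<forall>\<omega>. \<omega> \<notin> K \<longrightarrow> g \<omega> = 0))"
  unfolding test_function_def smooth_upto_def by (metis lessI)

lemma test_function_interval_bump:
  assumes "a > 0"
  shows "test_function (interval_bump a b n)"
proof -
  have "smooth_upto k (\<lambda>x. flat_exp 0 (1 * x + (- a)))" "smooth_upto k (\<lambda>x. flat_exp 0 ((-1) * x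
      + b))" for k
    by (intro smooth_upto_affine smooth_upto_flat_exp)+
  then have "smooth_upto k (\<lambda>x. 1 + (-1) * (1 + (-1) * (flat_exp 0 (1 * x + (- a))
      * flat_exp 0 ((-1) * x + b))) ^ n)" for k
    by (intro smooth_upto_add smooth_upto_mult smooth_upto_power smooth_upto_const)
  then have "smooth_upto k (interval_bump a b n)" for k
    by (simp add: interval_bump_def[abs_def])
  moreover have "interval_bump a b n \<omega> = 0" if "\<omega> \<notin> {a..b}" for \<omega>
    using interval_bump_le_indicator[of a b n \<omega>] that by simp
  moreover have "compact {a..b}" "{a..b} \<subseteq> {0<..}" using assms by auto
  ultimately show ?thesis
    unfolding test_function_iff_smooth by blast
qed

lemma test_function_add:
  assumes "test_function f" "test_function g"
  shows "test_function (\<lambda>x. f x + g x)"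
proof -
  obtain K K' where "compact K" "K \<subseteq> {0<..}" "\<forall>\<omega>. \<omega> \<notin> K \<longrightarrow> f \<omega> = 0"
      "compact K'" "K' \<subseteq> {0<..}" "\<forall>\<omega>. \<omega> \<notin> K' \<longrightarrow> g \<omega> = 0"
    using assms by (auto simp: test_function_iff_smooth)
  then have "\<exists>K. compact K \<and> K \<subseteq> {0<..} \<and> (\<forall>\<omega>. \<omega> \<notin> K \<longrightarrow> f \<omega> + g \<omega> = 0)"
    by (intro exI[of _ "K \<union> K'"]) auto
  then show ?thesis
    using assms by (simp add: test_function_iff_smooth smooth_upto_add)
qed

lemma test_function_scale: "test_function f \<Longrightarrow> test_function (\<lambda>x. c * f x)"
  unfolding test_function_iff_smooth
  by (auto intro: smooth_upto_mult smooth_upto_const)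

lemma nn_integral_weight_measure:
  assumes [measurable]: "f \<in> borel_measurable borel"
  shows "(\<integral>\<^sup>+\<omega>. f \<omega> \<partial>weight_measure) = (\<integral>\<^sup>+\<omega>. indicator {0<..} \<omega> * ennreal (sqrt \<omega>) * f \<omega> \<partial>lborel)"
  unfolding weight_measure_def by (subst nn_integral_density) auto

lemma emeasure_weight_measure_Icc: "emeasure weight_measure {a..b} < \<infinity>"
proof -
  have "emeasure weight_measure {a..b} = (\<integral>\<^sup>+\<omega>. indicator {0<..} \<omega> * ennreal (sqrt \<omega>)
      * indicator {a..b} \<omega> \<partial>lborel)"
    by (subst nn_integral_weight_measure[symmetric]) simp_all
  also have "\<dots> \<le> (\<integral>\<^sup>+\<omega>. ennreal (sqrt \<bar>b\<bar>) * indicator {a..b} \<omega> \<partial>lborel)"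
    by (intro nn_integral_mono) (auto simp: indicator_def intro!: ennreal_leI)
  also have "\<dots> = ennreal (sqrt \<bar>b\<bar>) * emeasure lborel {a..b}"
    by (simp add: nn_integral_cmult)
  also have "\<dots> < \<infinity>"
    by (simp add: ennreal_mult_less_top emeasure_lborel_Icc_eq)
  finally show ?thesis .
qed

lemma square_integrable_mono:
  assumes [measurable]: "f \<in> borel_measurable borel" and "square_integrable g"
    and "AE \<omega> in weight_measure. \<bar>f \<omega>\<bar> \<le> \<bar>g \<omega>\<bar>"
  shows "square_integrable f"
proof -
  have "l2_square f \<le> l2_square g"
    unfolding l2_square_def
    by (rule nn_integral_mono_AE, use assms(3) in eventually_elim) (auto intro!: ennreal_leI
        abs_le_square_iff[THEN iffD1])
  then show ?thesis
    using assms by (auto simp: square_integrable_iff_l2_square)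
qed

lemma square_integrable_indicator:
  assumes "A \<in> sets borel" "A \<subseteq> {a..b}"
  shows "square_integrable (indicator A)"
proof -
  have "square_integrable (indicator {a..b})"
    using emeasure_weight_measure_Icc[of a b]
    by (auto simp: square_integrable_iff_l2_square l2_square_def power2_eq_square ennreal_indicator
        simp flip: indicator_inter_arith)
  then show ?thesis
    by (rule square_integrable_mono[rotated])
       (use assms in \<open>auto intro!: AE_I2 simp: indicator_def\<close>)
qed

lemma square_integrable_test_function:
  assumes "test_function g"
  shows "square_integrable g"
proof -
  have cont: "continuous_on UNIV g"
    using assms unfolding test_function_def
    by (metis differentiable_imp_continuous_on funpow_0)
  then have [measurable]: "g \<in> borel_measurable borel"
    by (simp add: borel_measurable_continuous_onI)
  obtain K where K: "compact K" "\<forall>\<omega>. \<omega> \<notin> K \<longrightarrow> g \<omega> = 0"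
    using assms by (auto simp: test_function_def)
  obtain B where B: "\<And>\<omega>. \<omega> \<in> K \<Longrightarrow> \<bar>g \<omega>\<bar> \<le> B"
    using compact_continuous_image[OF continuous_on_subset[OF cont] K(1)] compact_imp_bounded
    by (fastforce simp: bounded_iff)
  obtain r where r: "K \<subseteq> {-r..r}"
    using compact_imp_bounded[OF K(1)] unfolding bounded_iff by (force simp: abs_le_iff)
  show ?thesis
  proof (rule square_integrable_mono)
    show "square_integrable (\<lambda>\<omega>. B * indicator {-r..r} \<omega>)"
      by (intro square_integrable_scale square_integrable_indicator[of _ "-r" r]) auto
    show "AE \<omega> in weight_measure. \<bar>g \<omega>\<bar> \<le> \<bar>B * indicator {-r..r} \<omega>\<bar>"
    proof (rule AE_I2)
      fix \<omega> show "\<bar>g \<omega>\<bar> \<le> \<bar>B * indicator {-r..r} \<omega>\<bar>"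
        using B[of \<omega>] K(2) r by (cases "\<omega> \<in> K") (auto simp: indicator_def)
    qed
  qed simp
qed

text \<open>Membership in the closure of the classes of test functions, phrased for functions so that pointwise
  limits can be used.\<close>

definition test_approximable :: "(real \<Rightarrow> real) \<Rightarrow> bool" where
  "test_approximable f \<longleftrightarrow> square_integrable f \<and> abs_L2 f \<in> closure (abs_L2 ` Collect test_function)"

lemma test_approximable_test_function: "test_function f \<Longrightarrow> test_approximable f"
  by (auto simp: test_approximable_def square_integrable_test_function intro: closure_subset[THEN subsetD])

lemma test_approximable_seq:
  "test_approximable f \<longleftrightarrow> square_integrable f \<and> (\<exists>g. (\<forall>n. test_function (g n))
      \<and> (\<lambda>n. abs_L2 (g n)) \<longlonglongrightarrow> abs_L2 f)"
proof -
  have "abs_L2 f \<in> closure (abs_L2 ` Collect test_function) \<longleftrightarrow>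
     (\<exists>g. (\<forall>n. test_function (g n)) \<and> (\<lambda>n. abs_L2 (g n)) \<longlonglongrightarrow> abs_L2 f)"
    unfolding closure_sequential
  proof (intro iffI; elim exE conjE)
    fix x assume x: "\<forall>n. x n \<in> abs_L2 ` Collect test_function" "x \<longlonglongrightarrow> abs_L2 f"
    have "\<forall>n. \<exists>g. test_function g \<and> x n = abs_L2 g"
      using x(1) by (simp add: image_iff Bex_def)
    from choice[OF this] obtain g where g: "\<forall>n. test_function (g n) \<and> x n = abs_L2 (g n)"
      by (elim exE)
    then have "x = (\<lambda>n. abs_L2 (g n))" by (intro ext) simp
    with x(2) g show "\<exists>g. (\<forall>n. test_function (g n)) \<and> (\<lambda>n. abs_L2 (g n)) \<longlonglongrightarrow> abs_L2 f"
      by (intro exI[of _ g] conjI) simp_all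
  next
    fix g assume g: "\<forall>n. test_function (g n)" "(\<lambda>n. abs_L2 (g n)) \<longlonglongrightarrow> abs_L2 f"
    then have "\<forall>n. abs_L2 (g n) \<in> abs_L2 ` Collect test_function" by simp
    with g(2) show "\<exists>x. (\<forall>n. x n \<in> abs_L2 ` Collect test_function) \<and> x \<longlonglongrightarrow> abs_L2 f"
      by (intro exI[of _ "\<lambda>n. abs_L2 (g n)"] conjI)
  qed
  then show ?thesis by (simp add: test_approximable_def)
qed

lemma test_approximable_add:
  assumes "test_approximable f" "test_approximable g"
  shows "test_approximable (\<lambda>x. f x + g x)"
proof -
  obtain u v where uv: "\<And>n. test_function (u n)" "(\<lambda>n. abs_L2 (u n)) \<longlonglongrightarrow> abs_L2 f"
      "\<And>n. test_function (v n)" "(\<lambda>n. abs_L2 (v n)) \<longlonglongrightarrow> abs_L2 g"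
    and sq: "square_integrable f" "square_integrable g"
    using assms unfolding test_approximable_seq by metis
  have "(\<lambda>n. abs_L2 (u n) + abs_L2 (v n)) \<longlonglongrightarrow> abs_L2 f + abs_L2 g"
    by (intro tendsto_add uv(2,4))
  then have "(\<lambda>n. abs_L2 (\<lambda>x. u n x + v n x)) \<longlonglongrightarrow> abs_L2 (\<lambda>x. f x + g x)"
    by (simp only: abs_L2_add sq square_integrable_test_function uv)
  moreover have "\<forall>n. test_function (\<lambda>x. u n x + v n x)"
    using uv by (simp add: test_function_add)
  ultimately show ?thesis
    unfolding test_approximable_seq using square_integrable_add[OF sq]
    by (intro conjI exI[of _ "\<lambda>n x. u n x + v n x"])
qed

lemma test_approximable_scale:
  assumes "test_approximable f"
  shows "test_approximable (\<lambda>x. c * f x)"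
proof -
  obtain u where uv: "\<And>n. test_function (u n)" "(\<lambda>n. abs_L2 (u n)) \<longlonglongrightarrow> abs_L2 f"
    and sq: "square_integrable f"
    using assms unfolding test_approximable_seq by metis
  have "(\<lambda>n. c *\<^sub>R abs_L2 (u n)) \<longlonglongrightarrow> c *\<^sub>R abs_L2 f"
    by (intro tendsto_scaleR tendsto_const uv(2))
  then have "(\<lambda>n. abs_L2 (\<lambda>x. c * u n x)) \<longlonglongrightarrow> abs_L2 (\<lambda>x. c * f x)"
    by (simp only: abs_L2_scale sq square_integrable_test_function uv)
  moreover have "\<forall>n. test_function (\<lambda>x. c * u n x)"
    using uv by (simp add: test_function_scale)
  ultimately show ?thesis
    unfolding test_approximable_seq using square_integrable_scale[OF sq]
    by (intro conjI exI[of _ "\<lambda>n x. c * u n x"])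
qed

lemma test_approximable_sum:
  "finite I \<Longrightarrow> (\<And>i. i \<in> I \<Longrightarrow> test_approximable (f i)) \<Longrightarrow> test_approximable (\<lambda>x. \<Sum>i\<in>I. f i x)"
proof (induction I rule: finite_induct)
  case empty
  have "test_function (\<lambda>x. 0)"
    using smooth_upto_const by (auto simp: test_function_iff_smooth)
  then show ?case by (simp add: test_approximable_test_function)
next
  case (insert i I)
  have "test_approximable (\<lambda>x. f i x + (\<Sum>j\<in>I. f j x))"
    using insert by (intro test_approximable_add) auto
  with insert.hyps show ?case by simp
qed

text \<open>Dominated convergence applies to the squared differences, which are bounded by \<open>4 G\<^sup>2\<close>.\<close>

lemma test_approximable_dominated:
  assumes f: "\<And>n. test_approximable (f n)" and [measurable]: "g \<in> borel_measurable borel"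
    and lim: "AE \<omega> in weight_measure. (\<lambda>n. f n \<omega>) \<longlonglongrightarrow> g \<omega>"
    and G: "square_integrable G" "\<And>n \<omega>. \<bar>f n \<omega>\<bar> \<le> G \<omega>"
  shows "test_approximable g"
proof -
  have sf: "square_integrable (f n)" for n using f by (simp add: test_approximable_def)
  then have [measurable]: "f n \<in> borel_measurable borel" for n
    by (simp add: square_integrable_iff_l2_square)
  have gG: "AE \<omega> in weight_measure. \<bar>g \<omega>\<bar> \<le> G \<omega>"
    using lim
  proof eventually_elim
    fix \<omega> assume "(\<lambda>n. f n \<omega>) \<longlonglongrightarrow> g \<omega>"
    then have "(\<lambda>n. \<bar>f n \<omega>\<bar>) \<longlonglongrightarrow> \<bar>g \<omega>\<bar>" by (rule tendsto_rabs)
    then show "\<bar>g \<omega>\<bar> \<le> G \<omega>" by (rule LIMSEQ_le_const2) (use G in auto)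
  qed
  have sg: "square_integrable g"
    by (rule square_integrable_mono[OF _ G(1)]) (use gG in \<open>auto elim!: eventually_mono\<close>)
  have "(\<lambda>n. LINT \<omega>|weight_measure. (f n \<omega> - g \<omega>)\<^sup>2) \<longlonglongrightarrow> (LINT \<omega>|weight_measure. 0)"
  proof (rule integral_dominated_convergence)
    show "integrable weight_measure (\<lambda>\<omega>. 4 * (G \<omega>)\<^sup>2)"
      using G(1) by (simp add: square_integrable_def)
    show "AE \<omega> in weight_measure. (\<lambda>n. (f n \<omega> - g \<omega>)\<^sup>2) \<longlonglongrightarrow> 0"
      using lim by eventually_elim (auto intro!: tendsto_eq_intros)
    show "AE \<omega> in weight_measure. norm ((f n \<omega> - g \<omega>)\<^sup>2) \<le> 4 * (G \<omega>)\<^sup>2" for n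
      using gG
    proof eventually_elim
      fix \<omega> assume "\<bar>g \<omega>\<bar> \<le> G \<omega>"
      then have "\<bar>f n \<omega> - g \<omega>\<bar> \<le> 2 * G \<omega>" using G(2)[of n \<omega>] by linarith
      then have "\<bar>f n \<omega> - g \<omega>\<bar>\<^sup>2 \<le> (2 * G \<omega>)\<^sup>2" by (intro power_mono) auto
      then show "norm ((f n \<omega> - g \<omega>)\<^sup>2) \<le> 4 * (G \<omega>)\<^sup>2" by (simp add: power_mult_distrib)
    qed
  qed measurable
  then have "(\<lambda>n. (norm (abs_L2 (f n) - abs_L2 g))\<^sup>2) \<longlonglongrightarrow> 0"
    by (simp add: abs_L2_diff[OF sf sg] norm_abs_L2[OF square_integrable_diff[OF sf sg]])
  then have "(\<lambda>n. norm (abs_L2 (f n) - abs_L2 g)) \<longlonglongrightarrow> 0"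
    using tendsto_real_sqrt[of _ 0] by fastforce
  then have "(\<lambda>n. abs_L2 (f n)) \<longlonglongrightarrow> abs_L2 g"
    by (simp add: tendsto_norm_zero_iff LIM_zero_iff)
  then have "abs_L2 g \<in> closure (abs_L2 ` Collect test_function)"
    by (rule closed_sequentially[OF closed_closure, rotated]) (use f in \<open>auto simp: test_approximable_def\<close>)
  with sg show ?thesis by (simp add: test_approximable_def)
qed

lemma test_approximable_indicator_interval:
  assumes "a > 0"
  shows "test_approximable (indicator {a<..<b})"
proof (rule test_approximable_dominated[where f = "interval_bump a b"])
  show "test_approximable (interval_bump a b n)" for n
    by (intro test_approximable_test_function test_function_interval_bump assms)
  show "square_integrable (indicator {a..b})"
    by (rule square_integrable_indicator[of _ a b]) auto
qed (use interval_bump_limit interval_bump_le_indicator in auto)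

text \<open>The Borel sets with this property contain the closed intervals, whose endpoints form a null set, and
  are stable under complements and countable disjoint unions.\<close>

lemma test_approximable_indicator:
  assumes "a > 0" and A: "A \<in> sets borel"
  shows "test_approximable (indicator (A \<inter> {a<..<b}))"
proof -
  show ?thesis
    using A
  proof (induction rule: borel_set_induct)
    case empty
    have "test_approximable (\<lambda>x. \<Sum>i\<in>({}::nat set). 0)"
      by (rule test_approximable_sum) auto
    then show ?case by (simp add: indicator_def)
  next
    case (interval c d)
    have "AE x in weight_measure. x \<noteq> c \<and> x \<noteq> d"
      unfolding weight_measure_def using AE_lborel_singleton[of c] AE_lborel_singleton[of d]
      by (subst AE_density) (auto elim!: eventually_elim2)
    then have lim: "AE x in weight_measure. (\<lambda>n. interval_bump (max a c) (min b d) n x)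
        \<longlonglongrightarrow> indicator ({c..d} \<inter> {a<..<b}) x"
    proof eventually_elim
      fix x assume x: "x \<noteq> c \<and> x \<noteq> d"
      have "indicator ({c..d} \<inter> {a<..<b}) x = (indicator {max a c<..<min b d} x :: real)"
        using x by (auto simp: indicator_def)
      then show "(\<lambda>n. interval_bump (max a c) (min b d) n x) \<longlonglongrightarrow> indicator ({c..d} \<inter> {a<..<b}) x"
        using interval_bump_limit by metis
    qed
    show ?case
    proof (rule test_approximable_dominated[OF _ _ lim])
      show "test_approximable (interval_bump (max a c) (min b d) n)" for n
        using assms by (intro test_approximable_test_function test_function_interval_bump) auto
      show "square_integrable (indicator {max a c..min b d})"
        by (rule square_integrable_indicator[of _ "max a c" "min b d"]) auto
    qed (use interval_bump_le_indicator in auto)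
  next
    case (compl S)
    have "indicator ((- S) \<inter> {a<..<b}) = (\<lambda>x. indicator {a<..<b} x + (-1)
        * (indicator (S \<inter> {a<..<b}) x :: real))"
      by (auto simp: indicator_def fun_eq_iff)
    then show ?case
      using test_approximable_add[OF test_approximable_indicator_interval[OF assms(1), of b]
          test_approximable_scale[OF compl.IH, of "-1"]] by simp
  next
    case (union S)
    note disj = \<open>disjoint_family S\<close> and IH = union.IH
    have [measurable]: "S i \<in> sets borel" for i
      by (rule union.hyps)
    show "test_approximable (indicator (\<Union> (range S) \<inter> {a<..<b}))"
    proof (rule test_approximable_dominated[where f = "\<lambda>n x. \<Sum>i<n. indicator (S i \<inter> {a<..<b}) x"])
      show "test_approximable (\<lambda>x. \<Sum>i<n. indicator (S i \<inter> {a<..<b}) x)" for n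
        by (rule test_approximable_sum) (auto intro: IH)
      show "square_integrable (indicator {a..b})"
        by (rule square_integrable_indicator[of _ a b]) auto
      have eq: "(\<Sum>i<n. indicator (S i \<inter> {a<..<b}) x) = (indicator (\<Union> (S ` {..<n}) \<inter> {a<..<b}) x ::
          real)" for n x
      proof -
        have "disjoint_family_on (\<lambda>i. S i \<inter> {a<..<b}) {..<n}"
          using disj by (auto simp: disjoint_family_on_def)
        then have "indicator (\<Union>i\<in>{..<n}. S i \<inter> {a<..<b}) x = (\<Sum>i<n. (indicator (S i \<inter> {a<..<b}) x :: real))"
          by (intro indicator_UN_disjoint) auto
        moreover have "(\<Union>i\<in>{..<n}. S i \<inter> {a<..<b}) = \<Union> (S ` {..<n}) \<inter> {a<..<b}" by auto
        ultimately show ?thesis by simp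
      qed
      show "\<bar>\<Sum>i<n. indicator (S i \<inter> {a<..<b}) x\<bar> \<le> (indicator {a..b} x :: real)" for n x
        unfolding eq by (auto simp: indicator_def)
      show "AE x in weight_measure. (\<lambda>n. \<Sum>i<n. indicator (S i \<inter> {a<..<b}) x)
          \<longlonglongrightarrow> (indicator (\<Union> (range S) \<inter> {a<..<b}) x :: real)"
      proof (rule AE_I2)
        fix x
        have "(\<lambda>n. indicator (\<Union>i<n. S i \<inter> {a<..<b}) x :: real) \<longlonglongrightarrow> indicator (\<Union>i. S i \<inter> {a<..<b}) x"
          by (rule LIMSEQ_indicator_UN)
        moreover have "(\<Union>i<n. S i \<inter> {a<..<b}) = \<Union> (S ` {..<n}) \<inter> {a<..<b}" for n by auto
        moreover have "(\<Union>i. S i \<inter> {a<..<b}) = \<Union> (range S) \<inter> {a<..<b}" by auto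
        ultimately show "(\<lambda>n. \<Sum>i<n. indicator (S i \<inter> {a<..<b}) x)
          \<longlonglongrightarrow> (indicator (\<Union> (range S) \<inter> {a<..<b}) x :: real)"
          unfolding eq by simp
      qed
    qed measurable
  qed
qed

text \<open>Simple functions with \<open>\<bar>s\<^sub>i\<bar> \<le> 2 \<bar>f\<bar>\<close>, cut off to intervals that exhaust \<open>(0,\<infinity>)\<close>.\<close>

lemma test_approximable_square_integrable:
  assumes "square_integrable f"
  shows "test_approximable f"
proof -
  have [measurable]: "f \<in> borel_measurable borel"
    using assms by (simp add: square_integrable_iff_l2_square)
  obtain s where s: "\<And>i. simple_function borel (s i)" "\<And>x. (\<lambda>i. s i x) \<longlonglongrightarrow> f x"
    "\<And>i x. norm (s i x) \<le> 2 * norm (f x)"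
    using borel_measurable_implies_sequence_metric[of f borel 0] by auto
  have ms [measurable]: "s i \<in> borel_measurable borel" for i
    using s(1) by (rule borel_measurable_simple_function)
  define I where "I i = {1 / real (Suc i)<..<real i}" for i
  show ?thesis
  proof (rule test_approximable_dominated[where f = "\<lambda>i x. s i x * indicator (I i) x"])
    fix i
    have "test_approximable (\<lambda>x. \<Sum>y\<in>range (s i). y * indicator (s i -` {y} \<inter> I i) x)"
    proof (intro test_approximable_sum test_approximable_scale)
      show "finite (range (s i))" using s(1)[of i] by (auto simp: simple_function_def)
      show "test_approximable (indicator (s i -` {y} \<inter> I i))" for y
        unfolding I_def by (rule test_approximable_indicator)
          (use measurable_sets[OF ms, of "{y}" i] in auto)
    qed
    moreover have "(\<Sum>y\<in>range (s i). y * indicator (s i -` {y} \<inter> I i) x) = s i x * indicator (I i) x" for x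
    proof -
      have "s i x = (\<Sum>y\<in>range (s i). indicator (s i -` {y}) x * y)"
        using simple_function_indicator_representation_banach[OF s(1), of x i]
        by (simp only: space_borel Int_UNIV_right real_scaleR_def UNIV_I)
      then have "s i x * indicator (I i) x
          = (\<Sum>y\<in>range (s i). indicator (s i -` {y}) x * y) * indicator (I i) x"
        by (rule arg_cong)
      also have "\<dots> = (\<Sum>y\<in>range (s i). y * indicator (s i -` {y} \<inter> I i) x)"
        unfolding indicator_inter_arith sum_distrib_right by (intro sum.cong refl) (simp only: ac_simps)
      finally show ?thesis by (rule sym)
    qed
    ultimately show "test_approximable (\<lambda>x. s i x * indicator (I i) x)"
      by (simp only:)
    show "square_integrable (\<lambda>x. 2 * \<bar>f x\<bar>)"
      by (intro square_integrable_scale square_integrable_mono[OF _ assms]) auto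
    show "\<bar>s i x * indicator (I i) x\<bar> \<le> 2 * \<bar>f x\<bar>" for x
      using s(3)[of i x] by (auto simp: indicator_def)
  next
    have "AE x in weight_measure. x > 0"
      unfolding weight_measure_def by (subst AE_density) (auto simp: indicator_def)
    then show "AE x in weight_measure. (\<lambda>i. s i x * indicator (I i) x) \<longlonglongrightarrow> f x"
    proof eventually_elim
      fix x :: real assume x: "x > 0"
      have "\<forall>\<^sub>F i in sequentially. s i x = s i x * indicator (I i) x"
      proof -
        have "\<forall>\<^sub>F i in sequentially. 1 / real (Suc i) < x"
          using LIMSEQ_inverse_real_of_nat x by (auto simp: order_tendsto_iff inverse_eq_divide)
        moreover have "\<forall>\<^sub>F i in sequentially. x < real i"
          using filterlim_real_sequentially by (simp add: filterlim_at_top_dense)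
        ultimately show ?thesis
          by eventually_elim (simp add: I_def)
      qed
      then show "(\<lambda>i. s i x * indicator (I i) x) \<longlonglongrightarrow> f x"
        by (rule Lim_transform_eventually[OF s(2)])
    qed
  qed measurable
qed

text \<open>Continuous maps that agree on a dense set coincide; so any explicit continuous map with the
  prescribed values on test functions is the extension.\<close>

lemma dense_extension_eqI:
  assumes "continuous_on UNIV T"
    and "\<And>g. test_function g \<Longrightarrow> square_integrable (F g) \<and> T (abs_L2 g) = abs_L2 (F g)"
  shows "dense_extension F = T"
  unfolding dense_extension_def
proof (rule the_equality)
  fix U assume U: "continuous_on UNIV U \<and>
     (\<forall>g. test_function g \<longrightarrow> square_integrable (F g) \<and> U (abs_L2 g) = abs_L2 (F g))"
  show "U = T"
  proof
    fix x
    obtain f where f: "square_integrable f" "x = abs_L2 f" by (rule L2_cases)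
    obtain g where g: "\<And>n. test_function (g n)" "(\<lambda>n. abs_L2 (g n)) \<longlonglongrightarrow> x"
      using test_approximable_square_integrable[OF f(1)] f(2) unfolding test_approximable_seq by metis
    have lim: "(\<lambda>n. V (abs_L2 (g n))) \<longlonglongrightarrow> V x" if "continuous_on UNIV V" for V :: "L2 \<Rightarrow> L2"
      by (rule continuous_on_tendsto_compose[OF that g(2)]) auto
    have "(\<lambda>n. U (abs_L2 (g n))) = (\<lambda>n. T (abs_L2 (g n)))"
      using U assms(2)[OF g(1)] g(1) by (intro ext) simp
    then have "(\<lambda>n. T (abs_L2 (g n))) \<longlonglongrightarrow> U x"
      using lim[of U] U by simp
    from LIMSEQ_unique[OF this lim[OF assms(1)]] show "U x = T x" .
  qed
qed (use assms in auto)

section \<open>The collision measure and its symmetries\<close>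

text \<open>A quadruple \<open>(a, b, c, d)\<close> stands for the frequencies \<open>(\<omega>\<^sub>0, \<omega>\<^sub>1, \<omega>\<^sub>2, \<omega>\<^sub>3)\<close> throughout.\<close>

abbreviation M4 :: "(real \<times> real \<times> real \<times> real) measure" where
  "M4 \<equiv> borel \<Otimes>\<^sub>M borel \<Otimes>\<^sub>M borel \<Otimes>\<^sub>M borel"

text \<open>This is \<open>\<surd>\<omega>\<^sub>0 \<Omega>\<close>: the weight of the space makes the collision kernel symmetric in all four
  frequencies.\<close>

definition coll_weight :: "real \<Rightarrow> real \<Rightarrow> real \<Rightarrow> real \<Rightarrow> ennreal" where
  "coll_weight a b c d =
     (if 0 < a \<and> 0 < b \<and> 0 < c \<and> 0 < d then ennreal (sqrt (min (min a b) (min c d))) else 0)"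

lemma measurable_coll_weight [measurable (raw)]:
  assumes [measurable]: "f \<in> borel_measurable M" "g \<in> borel_measurable M" "h
      \<in> borel_measurable M" "k \<in> borel_measurable M"
  shows "(\<lambda>x. coll_weight (f x) (g x) (h x) (k x)) \<in> borel_measurable M"
  unfolding coll_weight_def by measurable

text \<open>The surface measure of the collisions \<open>\<omega>\<^sub>0 + \<omega>\<^sub>3 = \<omega>\<^sub>1 + \<omega>\<^sub>2\<close>, realised as a push-forward so that
  its symmetries are permutations of coordinates.\<close>

definition coll_measure :: "(real \<times> real \<times> real \<times> real) measure" where
  "coll_measure = distr
     (density (lborel \<Otimes>\<^sub>M lborel \<Otimes>\<^sub>M lborel) (\<lambda>(a, b, c). coll_weight a b c (b + c - a)))
     M4 (\<lambda>(a, b, c). (a, b, c, b + c - a))"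

lemma sets_coll_measure [simp, measurable_cong]: "sets coll_measure = sets M4"
  by (simp add: coll_measure_def)

lemma space_coll_measure [simp]: "space coll_measure = UNIV"
  by (simp add: coll_measure_def space_pair_measure)

lemma nn_integral_coll_measure:
  assumes [measurable]: "F \<in> borel_measurable M4"
  shows "(\<integral>\<^sup>+p. F p \<partial>coll_measure) =
    (\<integral>\<^sup>+a. \<integral>\<^sup>+b. \<integral>\<^sup>+c. coll_weight a b c (b + c - a) * F (a, b, c, b + c - a) \<partial>lborel \<partial>lborel \<partial>lborel)"
proof -
  have "(\<integral>\<^sup>+p. F p \<partial>coll_measure) =
    (\<integral>\<^sup>+(a, b, c). coll_weight a b c (b + c - a) * F (a, b, c, b + c - a) \<partial>(lborel \<Otimes>\<^sub>M lborel \<Otimes>\<^sub>M lborel))"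
    unfolding coll_measure_def
    by (simp add: nn_integral_distr nn_integral_density case_prod_beta')
  also have "\<dots> = (\<integral>\<^sup>+a. \<integral>\<^sup>+q. (case q of (b, c) \<Rightarrow> coll_weight a b c (b + c - a) * F (a, b, c, b
      + c - a)) \<partial>lborel \<partial>lborel)"
  proof -
    have "(\<lambda>(a, b, c). coll_weight a b c (b + c - a) * F (a, b, c, b + c - a))
        \<in> borel_measurable (borel \<Otimes>\<^sub>M borel \<Otimes>\<^sub>M borel)"
      by measurable
    then show ?thesis
      using lborel.nn_integral_fst[of "\<lambda>(a, b, c). coll_weight a b c (b + c - a) * F (a, b, c, b
          + c - a)" "lborel :: real measure"]
      by (simp add: lborel_prod borel_prod)
  qed
  also have "\<dots> = (\<integral>\<^sup>+a. \<integral>\<^sup>+b. \<integral>\<^sup>+c. coll_weight a b c (b + c - a) * F (a, b, c, b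
      + c - a) \<partial>lborel \<partial>lborel \<partial>lborel)"
  proof (rule nn_integral_cong)
    fix a :: real
    show "(\<integral>\<^sup>+q. (case q of (b, c) \<Rightarrow> coll_weight a b c (b + c - a) * F (a, b, c, b + c - a)) \<partial>lborel)
      = (\<integral>\<^sup>+b. \<integral>\<^sup>+c. coll_weight a b c (b + c - a) * F (a, b, c, b + c - a) \<partial>lborel \<partial>lborel)"
    proof -
      have "(\<lambda>(b, c). coll_weight a b c (b + c - a) * F (a, b, c, b + c - a))
          \<in> borel_measurable (borel \<Otimes>\<^sub>M borel)"
        by measurable
      then show ?thesis
      using lborel.nn_integral_fst[of "\<lambda>(b, c). coll_weight a b c (b + c - a) * F (a, b, c, b
          + c - a)" "lborel :: real measure"]
      by (simp add: lborel_prod borel_prod)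
    qed
  qed
  finally show ?thesis .
qed

lemma nn_integral_lborel_shift:
  fixes f :: "real \<Rightarrow> ennreal"
  assumes [measurable]: "f \<in> borel_measurable borel"
  shows "(\<integral>\<^sup>+x. f (t + x) \<partial>lborel) = (\<integral>\<^sup>+x. f x \<partial>lborel)"
  using nn_integral_real_affine[of f 1 t] by simp

lemma nn_integral_lborel_reflect:
  fixes f :: "real \<Rightarrow> ennreal"
  assumes [measurable]: "f \<in> borel_measurable borel"
  shows "(\<integral>\<^sup>+x. f (t - x) \<partial>lborel) = (\<integral>\<^sup>+x. f x \<partial>lborel)"
  using nn_integral_real_affine[of f "-1" t] by simp

lemma coll_weight_sym:
  "coll_weight a c b d = coll_weight a b c d" "coll_weight d b c a = coll_weight a b c d"
  "coll_weight b a d c = coll_weight a b c d"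
  by (auto simp: coll_weight_def min.commute min.left_commute min.assoc)

lemma nn_integral_coll_swap12:
  assumes [measurable]: "F \<in> borel_measurable M4"
  shows "(\<integral>\<^sup>+(a, b, c, d). F (a, c, b, d) \<partial>coll_measure) = (\<integral>\<^sup>+p. F p \<partial>coll_measure)"
proof -
  have "(\<integral>\<^sup>+(a, b, c, d). F (a, c, b, d) \<partial>coll_measure) =
    (\<integral>\<^sup>+a. \<integral>\<^sup>+b. \<integral>\<^sup>+c. coll_weight a b c (b + c - a) * F (a, c, b, b + c - a) \<partial>lborel \<partial>lborel \<partial>lborel)"
    by (subst nn_integral_coll_measure) (simp_all add: case_prod_beta')
  also have "\<dots> = (\<integral>\<^sup>+a. \<integral>\<^sup>+c. \<integral>\<^sup>+b. coll_weight a b c (b + c - a) * F (a, c, b, b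
      + c - a) \<partial>lborel \<partial>lborel \<partial>lborel)"
    by (intro nn_integral_cong lborel_pair.Fubini') simp
  also have "\<dots> = (\<integral>\<^sup>+p. F p \<partial>coll_measure)"
    by (subst nn_integral_coll_measure) (simp_all add: add.commute coll_weight_sym(1))
  finally show ?thesis .
qed

text \<open>For fixed \<open>\<omega>\<^sub>1\<close> and \<open>\<omega>\<^sub>2\<close> the exchange is the reflection of \<open>\<omega>\<^sub>0\<close> in \<open>(\<omega>\<^sub>1 + \<omega>\<^sub>2) / 2\<close>.\<close>

lemma nn_integral_coll_swap03:
  assumes [measurable]: "F \<in> borel_measurable M4"
  shows "(\<integral>\<^sup>+(a, b, c, d). F (d, b, c, a) \<partial>coll_measure) = (\<integral>\<^sup>+p. F p \<partial>coll_measure)"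
proof -
  have rot: "(\<integral>\<^sup>+a. \<integral>\<^sup>+b. \<integral>\<^sup>+c. G (a, b, c) \<partial>lborel \<partial>lborel \<partial>lborel)
      = (\<integral>\<^sup>+b. \<integral>\<^sup>+c. \<integral>\<^sup>+a. G (a, b, c) \<partial>lborel \<partial>lborel \<partial>lborel)"
    if [measurable]: "G \<in> borel_measurable (borel \<Otimes>\<^sub>M borel \<Otimes>\<^sub>M borel)"
    for G :: "real \<times> real \<times> real \<Rightarrow> ennreal"
  proof -
    have "(\<integral>\<^sup>+a. \<integral>\<^sup>+b. \<integral>\<^sup>+c. G (a, b, c) \<partial>lborel \<partial>lborel \<partial>lborel)
        = (\<integral>\<^sup>+b. \<integral>\<^sup>+a. \<integral>\<^sup>+c. G (a, b, c) \<partial>lborel \<partial>lborel \<partial>lborel)"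
      by (intro lborel_pair.Fubini') simp
    also have "\<dots> = (\<integral>\<^sup>+b. \<integral>\<^sup>+c. \<integral>\<^sup>+a. G (a, b, c) \<partial>lborel \<partial>lborel \<partial>lborel)"
      by (rule nn_integral_cong) (intro lborel_pair.Fubini', simp)
    finally show ?thesis .
  qed
  have "(\<integral>\<^sup>+(a, b, c, d). F (d, b, c, a) \<partial>coll_measure) =
    (\<integral>\<^sup>+b. \<integral>\<^sup>+c. \<integral>\<^sup>+a. coll_weight a b c (b + c - a) * F (b + c - a, b, c, a) \<partial>lborel \<partial>lborel \<partial>lborel)"
    using rot[of "\<lambda>(a, b, c). coll_weight a b c (b + c - a) * F (b + c - a, b, c, a)"]
    by (subst nn_integral_coll_measure) (simp_all add: case_prod_beta')
  also have "\<dots> = (\<integral>\<^sup>+b. \<integral>\<^sup>+c. \<integral>\<^sup>+a. coll_weight a b c (b + c - a) * F (a, b, c, b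
      + c - a) \<partial>lborel \<partial>lborel \<partial>lborel)"
  proof (rule nn_integral_cong, rule nn_integral_cong)
    fix b c :: real
    have "(\<integral>\<^sup>+a. coll_weight a b c (b + c - a) * F (b + c - a, b, c, a) \<partial>lborel) =
      (\<integral>\<^sup>+a. (\<lambda>x. coll_weight (b + c - x) b c x * F (x, b, c, b + c - x)) (b + c - a) \<partial>lborel)"
      by simp
    also have "\<dots> = (\<integral>\<^sup>+x. coll_weight (b + c - x) b c x * F (x, b, c, b + c - x) \<partial>lborel)"
      by (rule nn_integral_lborel_reflect) simp
    finally show "(\<integral>\<^sup>+a. coll_weight a b c (b + c - a) * F (b + c - a, b, c, a) \<partial>lborel) =
      (\<integral>\<^sup>+a. coll_weight a b c (b + c - a) * F (a, b, c, b + c - a) \<partial>lborel)"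
      by (simp only: coll_weight_sym(2))
  qed
  also have "\<dots> = (\<integral>\<^sup>+p. F p \<partial>coll_measure)"
    using rot[of "\<lambda>(a, b, c). coll_weight a b c (b + c - a) * F (a, b, c, b + c - a)"]
    by (subst nn_integral_coll_measure) (simp_all add: case_prod_beta')
  finally show ?thesis .
qed

text \<open>For fixed \<open>\<omega>\<^sub>0\<close> and \<open>\<omega>\<^sub>1\<close> the passage from \<open>\<omega>\<^sub>2\<close> to \<open>\<omega>\<^sub>3\<close> is a translation.\<close>

lemma nn_integral_coll_swap_sides:
  assumes [measurable]: "F \<in> borel_measurable M4"
  shows "(\<integral>\<^sup>+(a, b, c, d). F (b, a, d, c) \<partial>coll_measure) = (\<integral>\<^sup>+p. F p \<partial>coll_measure)"
proof -
  have "(\<integral>\<^sup>+(a, b, c, d). F (b, a, d, c) \<partial>coll_measure) =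
    (\<integral>\<^sup>+a. \<integral>\<^sup>+b. \<integral>\<^sup>+c. coll_weight a b c (b + c - a) * F (b, a, b + c - a, c) \<partial>lborel \<partial>lborel \<partial>lborel)"
    by (subst nn_integral_coll_measure) (simp_all add: case_prod_beta')
  also have "\<dots> = (\<integral>\<^sup>+b. \<integral>\<^sup>+a. \<integral>\<^sup>+c. coll_weight a b c (b + c - a) * F (b, a, b
      + c - a, c) \<partial>lborel \<partial>lborel \<partial>lborel)"
    by (intro lborel_pair.Fubini') simp
  also have "\<dots> = (\<integral>\<^sup>+b. \<integral>\<^sup>+a. \<integral>\<^sup>+c. coll_weight b a c (a + c - b) * F (b, a, c, a
      + c - b) \<partial>lborel \<partial>lborel \<partial>lborel)"
  proof (rule nn_integral_cong, rule nn_integral_cong)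
    fix b a :: real
    have "(\<integral>\<^sup>+c. coll_weight a b c (b + c - a) * F (b, a, b + c - a, c) \<partial>lborel) =
      (\<integral>\<^sup>+c. (\<lambda>x. coll_weight a b (a + x - b) x * F (b, a, x, a + x - b)) (b - a + c) \<partial>lborel)"
      by (intro nn_integral_cong) (simp add: algebra_simps)
    also have "\<dots> = (\<integral>\<^sup>+x. coll_weight a b (a + x - b) x * F (b, a, x, a + x - b) \<partial>lborel)"
      by (rule nn_integral_lborel_shift) simp
    finally show "(\<integral>\<^sup>+c. coll_weight a b c (b + c - a) * F (b, a, b + c - a, c) \<partial>lborel) =
      (\<integral>\<^sup>+c. coll_weight b a c (a + c - b) * F (b, a, c, a + c - b) \<partial>lborel)"
      by (simp only: coll_weight_sym(3))
  qed
  also have "\<dots> = (\<integral>\<^sup>+p. F p \<partial>coll_measure)"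
    by (subst nn_integral_coll_measure) simp_all
  finally show ?thesis .
qed

lemma AE_coll_measure:
  "AE p in coll_measure. case p of (a, b, c, d) \<Rightarrow> 0 < a \<and> 0 < b \<and> 0 < c \<and> 0 < d \<and> a + d = b + c"
proof -
  have [measurable]: "Measurable.pred M4 (\<lambda>(a, b, c, d). \<not> (0 < a \<and> 0 < b \<and> 0 < c \<and> 0 < d \<and> a + d
      = b + (c::real)))"
    by measurable
  define F where "F p = (indicator {(a, b, c, d). \<not> (0 < a \<and> 0 < b \<and> 0 < c \<and> 0 < d \<and> a + d = b
      + (c::real))} p :: ennreal)" for p
  have [measurable]: "F \<in> borel_measurable M4"
    unfolding F_def by measurable
  have "(\<integral>\<^sup>+p. F p \<partial>coll_measure) = 0"
  proof -
    have "coll_weight a b c (b + c - a) * F (a, b, c, b + c - a) = 0" for a b c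
      by (auto simp: F_def coll_weight_def indicator_def)
    then show ?thesis
      unfolding nn_integral_coll_measure[OF \<open>F \<in> borel_measurable M4\<close>] by (simp only:
          nn_integral_const mult_zero_left)
  qed
  then have "AE p in coll_measure. F p = 0"
    by (subst (asm) nn_integral_0_iff_AE) auto
  then show ?thesis
    by eventually_elim (auto simp: F_def indicator_def split: if_splits)
qed

section \<open>One-dimensional estimates\<close>

lemma ennreal_le_of_square_le:
  assumes "X\<^sup>2 \<le> ennreal (B\<^sup>2)" "B \<ge> 0"
  shows "X \<le> ennreal B"
proof (cases X)
  case (real r)
  then have "r\<^sup>2 \<le> B\<^sup>2" using assms by (simp add: ennreal_power)
  then have "r \<le> B" using assms(2) by (rule power2_le_imp_le)
  then show ?thesis using real by (simp add: ennreal_leI)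
next
  case top
  then show ?thesis using assms by (simp add: power2_eq_square top_unique)
qed

text \<open>The integrand behaves like \<open>s\<^sup>-\<^sup>7\<^sup>/\<^sup>8\<close> near zero and like \<open>s\<^sup>-\<^sup>9\<^sup>/\<^sup>8\<close> near infinity, and the power
  of \<open>c\<close> is forced by scaling. Every frequency bound below reduces to this integral.\<close>

lemma nn_integral_scaling_kernel_le:
  assumes c: "c > 0"
  shows "(\<integral>\<^sup>+s. indicator {0<..} s * ennreal (s powr (-7/8) * min 1 (c / s) powr (1/4)) \<partial>lborel)
    \<le> ennreal (16 * c powr (1/8))"
proof -
  have "((\<lambda>s. s powr (-7/8)) has_integral (c powr (-7/8 + 1) / (-7/8 + 1))) {0..c}"
    using c by (intro has_integral_powr_from_0) auto
  then have 1: "(\<integral>\<^sup>+s. ennreal (s powr (-7/8)) * indicator {0..c} s \<partial>lborel) = ennreal (8 * c powr (1/8))"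
    by (subst nn_integral_has_integral_lebesgue'[where I = "c powr (-7/8 + 1) / (-7/8 + 1)"]) auto
  have "((\<lambda>s. s powr (-9/8)) has_integral -(c powr (-9/8 + 1)) / (-9/8 + 1)) {c..}"
    using c by (intro has_integral_powr_to_inf) auto
  then have "((\<lambda>s. c powr (1/4) * s powr (-9/8)) has_integral c powr (1/4) * (-(c powr (-9/8
      + 1)) / (-9/8 + 1))) {c..}"
    by (rule has_integral_mult_right)
  moreover have eq: "c powr (1/4) * (-(c powr (-9/8 + 1)) / (-9/8 + 1)) = 8 * c powr (1/8)"
    by (simp flip: powr_add)
  ultimately have "((\<lambda>s. c powr (1/4) * s powr (-9/8)) has_integral 8 * c powr (1/8)) {c..}"
    by (simp only:)
  then have 2: "(\<integral>\<^sup>+s. ennreal (c powr (1/4) * s powr (-9/8)) * indicator {c..} s \<partial>lborel)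
      = ennreal (8 * c powr (1/8))"
    by (subst nn_integral_has_integral_lebesgue'[where I = "8 * c powr (1/8)"]) auto
  have "(\<integral>\<^sup>+s. indicator {0<..} s * ennreal (s powr (-7/8) * min 1 (c / s) powr (1/4)) \<partial>lborel)
     \<le> (\<integral>\<^sup>+s. ennreal (s powr (-7/8)) * indicator {0..c} s + ennreal (c powr (1/4) * s powr (-9/8))
         * indicator {c..} s \<partial>lborel)"
  proof (intro nn_integral_mono)
    fix s :: real
    consider "s \<le> 0" | "0 < s" "s \<le> c" | "c < s" by linarith
    then show "indicator {0<..} s * ennreal (s powr (-7/8) * min 1 (c / s) powr (1/4))
      \<le> ennreal (s powr (-7/8)) * indicator {0..c} s + ennreal (c powr (1/4) * s powr (-9/8))
          * indicator {c..} s"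
    proof cases
      case 2
      then have "min 1 (c / s) = 1" by (simp add: field_simps)
      with 2 show ?thesis by (simp add: indicator_def)
    next
      case 3
      then have "min 1 (c / s) = c / s" using c by (simp add: field_simps)
      then have "s powr (-7/8) * min 1 (c / s) powr (1/4) = c powr (1/4) * (s powr (-7/8) * s powr (-1/4))"
        using 3 c by (simp add: powr_divide powr_minus_divide)
      also have "s powr (-7/8) * s powr (-1/4) = s powr (-9/8)"
        by (simp flip: powr_add)
      finally show ?thesis using 3 c by (simp add: indicator_def)
    qed simp
  qed
  also have "\<dots> = ennreal (8 * c powr (1/8)) + ennreal (8 * c powr (1/8))"
    using 1 2 by (simp add: nn_integral_add)
  also have "\<dots> = ennreal (16 * c powr (1/8))"
    by (simp flip: ennreal_plus)
  finally show ?thesis .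
qed

text \<open>Both sides of the singularity are reduced to the unshifted kernel by \<open>u = t - a\<close> and \<open>u = a - t\<close>.\<close>

lemma nn_integral_shifted_kernel_le:
  assumes a: "a > 0"
  shows "(\<integral>\<^sup>+t. indicator {0<..} t * ennreal (\<bar>t - a\<bar> powr (-7/8) * min 1 (a / t) powr (1/4)) \<partial>lborel)
    \<le> ennreal (32 * a powr (1/8))"
proof -
  define k where "k u = indicator {0<..} u * ennreal (u powr (-7/8) * min 1 (a / u) powr (1/4))" for u
  have [measurable]: "k \<in> borel_measurable borel" unfolding k_def by measurable
  have "(\<integral>\<^sup>+t. indicator {0<..} t * ennreal (\<bar>t - a\<bar> powr (-7/8) * min 1 (a / t) powr (1/4)) \<partial>lborel)
    \<le> (\<integral>\<^sup>+t. k (- a + t) + k (a - t) \<partial>lborel)"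
  proof (intro nn_integral_mono)
    fix t :: real
    consider "t \<le> 0" | "0 < t" "t < a" | "t = a" | "a < t" by linarith
    then show "indicator {0<..} t * ennreal (\<bar>t - a\<bar> powr (-7/8) * min 1 (a / t) powr (1/4))
        \<le> k (- a + t) + k (a - t)"
    proof cases
      case 2
      then have "min 1 (a / t) = 1" "min 1 (a / (a - t)) = 1" by (simp_all add: field_simps)
      with 2 show ?thesis by (simp add: k_def)
    next
      case 4
      then have "min 1 (a / t) powr (1/4) \<le> min 1 (a / (t - a)) powr (1/4)"
        using a by (intro powr_mono2 min.mono divide_left_mono) auto
      with 4 a show ?thesis by (auto simp: k_def intro!: ennreal_leI mult_left_mono)
    qed simp_all
  qed
  also have "\<dots> = (\<integral>\<^sup>+t. k t \<partial>lborel) + (\<integral>\<^sup>+t. k t \<partial>lborel)"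
    using nn_integral_lborel_shift[of k "- a"] nn_integral_lborel_reflect[of k a]
    by (simp add: nn_integral_add)
  also have "\<dots> \<le> ennreal (16 * a powr (1/8)) + ennreal (16 * a powr (1/8))"
    unfolding k_def by (intro add_mono nn_integral_scaling_kernel_le a)
  finally show ?thesis by (simp flip: ennreal_plus)
qed

lemma equil_pos: "\<mu> > 0 \<Longrightarrow> s \<ge> 0 \<Longrightarrow> equil \<mu> s > 0"
  by (simp add: equil_def)

lemma equil_le_inverse: "\<mu> > 0 \<Longrightarrow> s > 0 \<Longrightarrow> equil \<mu> s \<le> 1 / s"
  by (simp add: equil_def field_simps)

lemma borel_measurable_equil [measurable]: "equil \<mu> \<in> borel_measurable borel"
  unfolding equil_def[abs_def] by measurable

definition ramp_const :: "real \<Rightarrow> real" where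
  "ramp_const \<mu> = 2 + 2 * \<mu> powr (-1/8)"

text \<open>The factor \<open>min 1 (s/a)\<close> comes from \<open>\<Omega>\<close>, with \<open>s\<close> one of the frequencies and \<open>a = \<omega>\<^sub>0\<close>. A small
  power of it makes \<open>n(s)\<close> comparable to a power that is integrable at zero, and gains decay in \<open>a\<close>:
  for \<open>a \<ge> 1\<close> by itself, for \<open>a \<le> 1\<close> because \<open>n(s)\<close> is bounded in terms of \<open>\<mu>\<close>.\<close>

lemma equil_ramp_le:
  assumes "\<mu> > 0" "a > 0" "s > 0"
  shows "equil \<mu> s * min 1 (s / a) powr (1/8) \<le> ramp_const \<mu> * (1 + a) powr (-1/8) * s powr (-7/8)"
proof (cases "a \<ge> 1")
  case True
  have "equil \<mu> s * min 1 (s / a) powr (1/8) \<le> (1 / s) * (s / a) powr (1/8)"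
    using assms by (intro mult_mono powr_mono2 equil_le_inverse) auto
  also have "\<dots> = (s powr (-1) * s powr (1/8)) * a powr (-1/8)"
    using assms by (simp add: powr_divide powr_minus_divide)
  also have "s powr (-1) * s powr (1/8) = s powr (-7/8)"
    by (rule trans[OF powr_add[symmetric]]) simp
  also have "s powr (-7/8) * a powr (-1/8) \<le> s powr (-7/8) * (2 * (1 + a) powr (-1/8))"
  proof (intro mult_left_mono)
    have "(1 + a) powr (1/8) \<le> (2 * a) powr (1/8)"
      using True by (intro powr_mono2) auto
    also have "\<dots> = 2 powr (1/8) * a powr (1/8)"
      using assms by (simp add: powr_mult)
    also have "\<dots> \<le> 2 powr 1 * a powr (1/8)"
      by (intro mult_right_mono powr_mono) auto
    finally show "a powr (-1/8) \<le> 2 * (1 + a) powr (-1/8)"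
      using assms by (simp add: powr_minus_divide field_simps)
  qed simp
  also have "s powr (-7/8) * (2 * (1 + a) powr (-1/8)) \<le> ramp_const \<mu> * (1 + a) powr (-1/8) * s powr (-7/8)"
    by (simp add: ramp_const_def algebra_simps)
  finally show ?thesis by simp
next
  case False
  have "s powr (7/8) * \<mu> powr (1/8) \<le> (s + \<mu>) powr (7/8) * (s + \<mu>) powr (1/8)"
    using assms by (intro mult_mono powr_mono2) auto
  also have "\<dots> = s + \<mu>"
    using assms by (simp flip: powr_add)
  finally have n: "equil \<mu> s \<le> s powr (-7/8) * \<mu> powr (-1/8)"
    using assms by (simp add: equil_def powr_minus_divide field_simps)
  have "equil \<mu> s * min 1 (s / a) powr (1/8) \<le> equil \<mu> s * 1 powr (1/8)"
    using assms equil_pos[of \<mu> s] by (intro mult_left_mono powr_mono2) auto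
  also have "\<dots> \<le> s powr (-7/8) * \<mu> powr (-1/8)" using n by simp
  also have "\<dots> \<le> s powr (-7/8) * \<mu> powr (-1/8) * (2 * (1 + a) powr (-1/8))"
  proof -
    have "(1 + a) powr (1/8) \<le> 2 powr 1"
      using False assms by (intro order_trans[OF powr_mono2 powr_mono]) auto
    then have "1 \<le> 2 * (1 + a) powr (-1/8)"
      using assms by (simp add: powr_minus_divide field_simps)
    then show ?thesis
      using mult_left_mono[of 1 _ "s powr (-7/8) * \<mu> powr (-1/8)"] by simp
  qed
  also have "\<dots> \<le> ramp_const \<mu> * (1 + a) powr (-1/8) * s powr (-7/8)"
    by (simp add: ramp_const_def algebra_simps)
  finally show ?thesis .
qed

text \<open>The form in which the scaling integral is used: \<open>c\<close> is the frequency beyond which the integrand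
  decays, and only the ratio of \<open>c\<close> to \<open>1 + a\<close> matters.\<close>

lemma nn_integral_equil_kernel_le:
  assumes \<mu>: "\<mu> > 0" and a: "a > 0" and c: "c > 0" and A: "A \<ge> 0"
    and g: "\<And>s. s > 0 \<Longrightarrow> g s \<le> ennreal (A * (equil \<mu> s * min 1 (s / a) powr (1/8)
        * min 1 (c / s) powr (1/4)))"
    and g0: "\<And>s. s \<le> 0 \<Longrightarrow> g s = 0"
  shows "(\<integral>\<^sup>+s. g s \<partial>lborel) \<le> ennreal (A * (16 * ramp_const \<mu>) * (c / (1 + a)) powr (1/8))"
proof -
  define B where "B = A * (ramp_const \<mu> * (1 + a) powr (-1/8))"
  have B: "B \<ge> 0" using A by (simp add: B_def ramp_const_def)
  have "(\<integral>\<^sup>+s. g s \<partial>lborel) \<le>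
    (\<integral>\<^sup>+s. ennreal B * (indicator {0<..} s * ennreal (s powr (-7/8) * min 1 (c / s) powr (1/4))) \<partial>lborel)"
  proof (intro nn_integral_mono)
    fix s :: real
    show "g s \<le> ennreal B * (indicator {0<..} s * ennreal (s powr (-7/8) * min 1 (c / s) powr (1/4)))"
    proof (cases "s > 0")
      case True
      have "A * (equil \<mu> s * min 1 (s / a) powr (1/8) * min 1 (c / s) powr (1/4))
        \<le> A * (ramp_const \<mu> * (1 + a) powr (-1/8) * s powr (-7/8) * min 1 (c / s) powr (1/4))"
        using A by (intro mult_left_mono mult_right_mono equil_ramp_le \<mu> a True) auto
      also have "\<dots> = B * (s powr (-7/8) * min 1 (c / s) powr (1/4))"
        by (simp add: B_def)
      finally show ?thesis
        using True B by (auto intro!: order_trans[OF g[OF True]] ennreal_leI simp flip: ennreal_mult)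
    qed (simp add: g0)
  qed
  also have "\<dots> = ennreal B * (\<integral>\<^sup>+s. indicator {0<..} s * ennreal (s powr (-7/8)
      * min 1 (c / s) powr (1/4)) \<partial>lborel)"
    by (rule nn_integral_cmult) measurable
  also have "\<dots> \<le> ennreal B * ennreal (16 * c powr (1/8))"
    by (intro mult_left_mono nn_integral_scaling_kernel_le c) auto
  also have "\<dots> = ennreal (A * (16 * ramp_const \<mu>) * (c / (1 + a)) powr (1/8))"
  proof -
    have "B * (16 * c powr (1/8)) = A * (16 * ramp_const \<mu>) * (c / (1 + a)) powr (1/8)"
      using a c by (simp add: B_def powr_divide powr_minus_divide)
    then show ?thesis using B by (simp only: ennreal_mult'[symmetric])
  qed
  finally show ?thesis .
qed

text \<open>Cauchy-Schwarz: \<open>n(w) (1+w)\<^sup>1\<^sup>/\<^sup>8\<close> is square integrable against \<open>w\<^sup>-\<^sup>1\<^sup>/\<^sup>2 dw\<close>. The power of \<open>1+w\<close>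
  is the room that absorbs the logarithmic growth of the inner integrals.\<close>

lemma nn_integral_equil_mult_le:
  assumes \<mu>: "\<mu> > 0" and [measurable]: "z \<in> borel_measurable borel"
    and z: "l2_square z \<le> ennreal (Z\<^sup>2)" "Z \<ge> 0"
  shows "(\<integral>\<^sup>+w. indicator {0<..} w * ennreal (equil \<mu> w * \<bar>z w\<bar> * (1 + w) powr (1/8)) \<partial>lborel)
    \<le> ennreal (4 * (1 + 1 / \<mu>) * Z)"
proof -
  define f where "f w = indicator {0<..} w * ennreal (w powr (1/4) * \<bar>z w\<bar>)" for w
  define h where "h w = indicator {0<..} w * ennreal (w powr (-1/4) * (equil \<mu> w * (1
      + w) powr (1/8)))" for w
  have [measurable]: "f \<in> borel_measurable lborel" "h \<in> borel_measurable lborel"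
    unfolding f_def h_def by measurable
  have eq: "(\<integral>\<^sup>+w. indicator {0<..} w * ennreal (equil \<mu> w * \<bar>z w\<bar> * (1 + w) powr (1/8)) \<partial>lborel)
      = (\<integral>\<^sup>+w. f w * h w \<partial>lborel)"
  proof (intro nn_integral_cong)
    fix w :: real
    have "w powr (1/4) * w powr (-1/4) = 1" if "w > 0"
      using that by (simp flip: powr_add)
    then have "equil \<mu> w * \<bar>z w\<bar> * (1 + w) powr (1/8)
      = (w powr (1/4) * \<bar>z w\<bar>) * (w powr (-1/4) * (equil \<mu> w * (1 + w) powr (1/8)))" if "w > 0"
      using that by (simp add: ac_simps) 
    then show "indicator {0<..} w * ennreal (equil \<mu> w * \<bar>z w\<bar> * (1 + w) powr (1/8)) = f w * h w"
      by (simp add: f_def h_def indicator_def less_imp_le[OF equil_pos[OF \<mu>]] flip: ennreal_mult)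
  qed
  have CS: "(\<integral>\<^sup>+w. f w * h w \<partial>lborel)\<^sup>2 \<le> (\<integral>\<^sup>+w. (f w)\<^sup>2 \<partial>lborel) * (\<integral>\<^sup>+w. (h w)\<^sup>2 \<partial>lborel)"
    by (rule Cauchy_Schwarz_nn_integral) measurable
  have F: "(\<integral>\<^sup>+w. (f w)\<^sup>2 \<partial>lborel) = l2_square z"
    unfolding l2_square_def
  proof (subst nn_integral_weight_measure, simp, intro nn_integral_cong)
    fix w :: real
    have "(w powr (1/4) * \<bar>z w\<bar>)\<^sup>2 = sqrt w * (z w)\<^sup>2" if "w > 0"
      using that by (simp add: power_mult_distrib powr_half_sqrt[symmetric] power2_eq_square[of "_
          powr _"] flip: powr_add)
    then show "(f w)\<^sup>2 = indicator {0<..} w * ennreal (sqrt w) * ennreal ((z w)\<^sup>2)"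
      by (simp add: f_def indicator_def ennreal_power flip: ennreal_mult)
  qed
  have H: "(\<integral>\<^sup>+w. (h w)\<^sup>2 \<partial>lborel) \<le> ennreal ((1 + 1 / \<mu>)\<^sup>2 * 16)"
  proof -
    have "(\<integral>\<^sup>+w. (h w)\<^sup>2 \<partial>lborel) \<le> (\<integral>\<^sup>+w. ennreal ((1 + 1 / \<mu>)\<^sup>2) *
        (indicator {0<..} w * ennreal (w powr (-7/8) * min 1 (1 / w) powr (1/4))) \<partial>lborel)"
    proof (intro nn_integral_mono)
      fix w :: real
      show "(h w)\<^sup>2 \<le> ennreal ((1 + 1 / \<mu>)\<^sup>2) *
        (indicator {0<..} w * ennreal (w powr (-7/8) * min 1 (1 / w) powr (1/4)))"
      proof (cases "w > 0")
        case w: True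
        have "equil \<mu> w * (1 + w) \<le> 1 + 1 / \<mu>"
          using w \<mu> by (simp add: equil_def field_simps)
        then have n: "equil \<mu> w \<le> (1 + 1 / \<mu>) * (1 + w) powr (-1)"
          using w by (simp add: powr_minus_divide field_simps)
        have "w powr (-1/4) * (equil \<mu> w * (1 + w) powr (1/8))
          \<le> w powr (-1/4) * ((1 + 1 / \<mu>) * (1 + w) powr (-1) * (1 + w) powr (1/8))"
          using n w by (intro mult_left_mono mult_right_mono) auto
        also have "\<dots> = (1 + 1 / \<mu>) * (w powr (-1/4) * (1 + w) powr (-7/8))"
          using powr_add[of "1 + w" "-1" "1/8"] by (simp only: mult.assoc) simp
        finally have "(w powr (-1/4) * (equil \<mu> w * (1 + w) powr (1/8)))\<^sup>2
          \<le> ((1 + 1 / \<mu>) * (w powr (-1/4) * (1 + w) powr (-7/8)))\<^sup>2"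
          using w equil_pos[OF \<mu>, of w] by (intro power_mono) auto
        also have "\<dots> = (1 + 1 / \<mu>)\<^sup>2 * (w powr (-1/2) * (1 + w) powr (-7/4))"
          by (simp add: power_mult_distrib power2_eq_square[of "_ powr _"] flip: powr_add)
        also have "\<dots> \<le> (1 + 1 / \<mu>)\<^sup>2 * (w powr (-7/8) * min 1 (1 / w) powr (1/4))"
        proof (intro mult_left_mono)
          show "w powr (-1/2) * (1 + w) powr (-7/4) \<le> w powr (-7/8) * min 1 (1 / w) powr (1/4)"
          proof (cases "w \<le> 1")
            case True
            have "w powr (-1/2) * (1 + w) powr (-7/4) \<le> w powr (-7/8) * 1"
              using w True by (intro mult_mono powr_mono') (auto intro: powr_le_one_le
                  order_trans[OF powr_mono2'[of _ 1]])
            then show ?thesis using w True by (simp add: min_absorb1)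
          next
            case False
            have "w powr (-1/2) * (1 + w) powr (-7/4) \<le> w powr (-1/2) * w powr (-7/4)"
              using w by (intro mult_left_mono powr_mono2') auto
            also have "\<dots> = w powr (-9/4)" by (simp flip: powr_add)
            also have "\<dots> \<le> w powr (-9/8)" using False by (intro powr_mono) auto
            also have "\<dots> = w powr (-7/8) * w powr (-1/4)" by (simp flip: powr_add)
            also have "w powr (-1/4) = min 1 (1 / w) powr (1/4)"
              using False w by (simp add: powr_divide powr_minus_divide min_def)
            finally show ?thesis .
          qed
        qed simp
        finally show ?thesis
          using w equil_pos[OF \<mu>, of w]
          by (simp add: h_def ennreal_power flip: ennreal_mult)
      qed (simp add: h_def)
    qed
    also have "\<dots> = ennreal ((1 + 1 / \<mu>)\<^sup>2) * (\<integral>\<^sup>+w. 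
        (indicator {0<..} w * ennreal (w powr (-7/8) * min 1 (1 / w) powr (1/4))) \<partial>lborel)"
      by (rule nn_integral_cmult) measurable
    also have "\<dots> \<le> ennreal ((1 + 1 / \<mu>)\<^sup>2) * ennreal (16 * 1 powr (1/8))"
      by (intro mult_left_mono nn_integral_scaling_kernel_le) auto
    also have "\<dots> = ennreal ((1 + 1 / \<mu>)\<^sup>2 * 16)"
      by (subst ennreal_mult[symmetric]) auto
    finally show ?thesis .
  qed
  have "(\<integral>\<^sup>+w. indicator {0<..} w * ennreal (equil \<mu> w * \<bar>z w\<bar> * (1 + w) powr (1/8)) \<partial>lborel)\<^sup>2
      \<le> ennreal (Z\<^sup>2) * ennreal ((1 + 1 / \<mu>)\<^sup>2 * 16)"
    unfolding eq by (rule order_trans[OF CS]) (unfold F, intro mult_mono z H, simp_all)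
  also have "\<dots> = ennreal ((4 * (1 + 1 / \<mu>) * Z)\<^sup>2)"
    by (subst ennreal_mult[symmetric]) (simp_all only: power_mult_distrib zero_le_power2, simp_all)
  finally show ?thesis
    by (rule ennreal_le_of_square_le) (use z(2) \<mu> in simp)
qed

text \<open>Here \<open>x\<close> is the smallest frequency; the exponent \<open>1/2\<close> is split as \<open>1/8 + 1/8 + 1/4\<close>.\<close>

lemma sqrt_ramp_le:
  assumes "x > 0" "x \<le> a" "x \<le> s" "x \<le> l"
  shows "sqrt x \<le> sqrt a * min 1 (s / a) powr (1/8) * min 1 (l / a) powr (1/8)"
proof -
  have "sqrt (x / a) = (x / a) powr (1/8 + 1/8 + 1/4)"
    using assms by (simp add: powr_half_sqrt)
  also have "\<dots> = (x / a) powr (1/8) * (x / a) powr (1/8) * (x / a) powr (1/4)"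
    by (simp only: powr_add)
  also have "\<dots> \<le> min 1 (s / a) powr (1/8) * min 1 (l / a) powr (1/8) * 1 powr (1/4)"
    using assms by (intro mult_mono powr_mono2) (auto simp: field_simps)
  finally have "sqrt a * sqrt (x / a) \<le> sqrt a * (min 1 (s / a) powr (1/8) * min 1 (l / a) powr (1/8))"
    using assms by (intro mult_left_mono) auto
  moreover have "sqrt a * sqrt (x / a) = sqrt x"
    using assms by (simp add: real_sqrt_divide)
  ultimately show ?thesis by simp
qed

text \<open>The factor \<open>(a/l)\<^sup>1\<^sup>/\<^sup>4\<close> is the weight of the Schur test. Half of \<open>\<surd>x\<close> compensates it and leaves
  decay in \<open>l\<close>, the other half gives smallness in \<open>s\<close>.\<close>

lemma sqrt_tilted_ramp_le:
  assumes "x > 0" "x \<le> a" "x \<le> s" "x \<le> l"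
  shows "sqrt x * (a / l) powr (1/4) \<le> sqrt a * min 1 (s / a) powr (1/8) * min 1 (a / l) powr (1/4)"
proof -
  have "sqrt (x / a) * (a / l) powr (1/4) = (x / a) powr (1/4 + 1/4) * (a / l) powr (1/4)"
    using assms by (simp add: powr_half_sqrt)
  also have "\<dots> = (x / a) powr (1/4) * ((x / a) powr (1/4) * (a / l) powr (1/4))"
    by (simp only: powr_add mult.assoc)
  also have "(x / a) powr (1/4) * (a / l) powr (1/4) = (x / l) powr (1/4)"
    using assms by (simp flip: powr_mult)
  also have "(x / a) powr (1/4) * (x / l) powr (1/4) \<le> (x / a) powr (1/8) * (x / l) powr (1/4)"
    using assms by (intro mult_right_mono powr_mono') auto
  also have "\<dots> \<le> min 1 (s / a) powr (1/8) * min 1 (a / l) powr (1/4)"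
    using assms by (intro mult_mono powr_mono2) (auto simp: field_simps)
  finally have "sqrt a * (sqrt (x / a) * (a / l) powr (1/4)) \<le> sqrt a * (min 1 (s / a) powr (1/8)
      * min 1 (a / l) powr (1/4))"
    using assms by (intro mult_left_mono) auto
  moreover have "sqrt a * sqrt (x / a) = sqrt x"
    using assms by (simp add: real_sqrt_divide)
  ultimately show ?thesis by (simp add: mult.assoc[symmetric])
qed

section \<open>Bounds for collision frequencies\<close>

text \<open>For fixed \<open>a\<close> a collision is determined by any two of \<open>b\<close>, \<open>c\<close>, \<open>d\<close>. This lemma and the four after
  it choose which two, and in which order they are integrated.\<close>

lemma fibre_integral_outer_bd:
  assumes [measurable]: "H \<in> borel_measurable (borel \<Otimes>\<^sub>M borel \<Otimes>\<^sub>M borel)"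
  shows "(\<integral>\<^sup>+b. \<integral>\<^sup>+c. H (b, c, b + c - a) \<partial>lborel \<partial>lborel) = (\<integral>\<^sup>+b. \<integral>\<^sup>+d. H (b, d
      + a - b, d) \<partial>lborel \<partial>(lborel :: real measure))"
proof (rule nn_integral_cong)
  fix b :: real
  have "(\<integral>\<^sup>+c. H (b, c, b + c - a) \<partial>lborel) = (\<integral>\<^sup>+c. (\<lambda>d. H (b, d + a - b, d)) ((b - a) + c) \<partial>lborel)"
    by (intro nn_integral_cong) (simp add: algebra_simps)
  also have "\<dots> = (\<integral>\<^sup>+d. H (b, d + a - b, d) \<partial>lborel)"
    by (rule nn_integral_lborel_shift) simp
  finally show "(\<integral>\<^sup>+c. H (b, c, b + c - a) \<partial>lborel) = (\<integral>\<^sup>+d. H (b, d + a - b, d) \<partial>lborel)" .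
qed

lemma fibre_integral_swap:
  assumes [measurable]: "H \<in> borel_measurable (borel \<Otimes>\<^sub>M borel \<Otimes>\<^sub>M borel)"
  shows "(\<integral>\<^sup>+b. \<integral>\<^sup>+c. H (b, c, b + c - a) \<partial>lborel \<partial>lborel) = (\<integral>\<^sup>+b. \<integral>\<^sup>+c. H (c, b, b
      + c - a) \<partial>lborel \<partial>(lborel :: real measure))"
  by (subst lborel_pair.Fubini') (simp_all add: add.commute)

lemma fibre_integral_outer_db:
  assumes [measurable]: "H \<in> borel_measurable (borel \<Otimes>\<^sub>M borel \<Otimes>\<^sub>M borel)"
  shows "(\<integral>\<^sup>+b. \<integral>\<^sup>+c. H (b, c, b + c - a) \<partial>lborel \<partial>lborel) = (\<integral>\<^sup>+d. \<integral>\<^sup>+b. H (b, d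
      + a - b, d) \<partial>lborel \<partial>(lborel :: real measure))"
  unfolding fibre_integral_outer_bd[OF assms] by (rule lborel_pair.Fubini') simp

lemma fibre_integral_outer_cd:
  assumes [measurable]: "H \<in> borel_measurable (borel \<Otimes>\<^sub>M borel \<Otimes>\<^sub>M borel)"
  shows "(\<integral>\<^sup>+b. \<integral>\<^sup>+c. H (b, c, b + c - a) \<partial>lborel \<partial>lborel) = (\<integral>\<^sup>+c. \<integral>\<^sup>+d. H (d
      + a - c, c, d) \<partial>lborel \<partial>(lborel :: real measure))"
  unfolding fibre_integral_swap[OF assms]
  using fibre_integral_outer_bd[of "\<lambda>(c, b, d). H (b, c, d)"] by simp

lemma fibre_integral_outer_dc:
  assumes [measurable]: "H \<in> borel_measurable (borel \<Otimes>\<^sub>M borel \<Otimes>\<^sub>M borel)"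
  shows "(\<integral>\<^sup>+b. \<integral>\<^sup>+c. H (b, c, b + c - a) \<partial>lborel \<partial>lborel) = (\<integral>\<^sup>+d. \<integral>\<^sup>+c. H (d
      + a - c, c, d) \<partial>lborel \<partial>(lborel :: real measure))"
  unfolding fibre_integral_outer_cd[OF assms] by (rule lborel_pair.Fubini') simp

text \<open>The collision frequency \<open>\<integral>\<integral> \<Omega> R d\<omega>\<^sub>1 d\<omega>\<^sub>2\<close> is at most \<open>A\<close>, uniformly in \<open>\<omega>\<^sub>0 = a\<close>; the factor \<open>\<surd>a\<close>
  converts \<open>\<Omega>\<close> to the symmetric weight.\<close>

definition frequency_bounded :: "real \<Rightarrow> (real \<Rightarrow> real \<Rightarrow> real \<Rightarrow> real \<Rightarrow> real) \<Rightarrow> bool" where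
  "frequency_bounded A R \<longleftrightarrow> (\<forall>a>0.
     (\<integral>\<^sup>+b. \<integral>\<^sup>+c. coll_weight a b c (b + c - a) * ennreal (R a b c (b + c - a)) \<partial>lborel \<partial>lborel)
       \<le> ennreal (A * sqrt a))"

lemma coll_weight_le_ramp:
  assumes "R \<ge> 0" "0 < a" and s: "s \<in> {b, c, d}" and l: "l \<in> {b, c, d}"
  shows "coll_weight a b c d * ennreal R \<le> ennreal (sqrt a * min 1 (s / a) powr (1/8)
      * min 1 (l / a) powr (1/8) * R)"
proof (cases "0 < b \<and> 0 < c \<and> 0 < d")
  case True
  then show ?thesis
    using assms unfolding coll_weight_def
    by (auto intro!: ennreal_leI mult_right_mono sqrt_ramp_le simp flip: ennreal_mult)
qed (auto simp: coll_weight_def)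

lemma coll_weight_le_tilted_ramp:
  assumes "R \<ge> 0" "0 < a" and s: "s \<in> {b, c, d}" and l: "l \<in> {b, c, d}"
  shows "coll_weight a b c d * ennreal (R * (a / l) powr (1/4))
    \<le> ennreal (sqrt a * min 1 (s / a) powr (1/8) * min 1 (a / l) powr (1/4) * R)"
proof (cases "0 < b \<and> 0 < c \<and> 0 < d")
  case True
  define x where "x = min (min a b) (min c d)"
  have x: "x > 0" "x \<le> a" "x \<le> s" "x \<le> l" using True assms by (auto simp: x_def)
  have "coll_weight a b c d * ennreal (R * (a / l) powr (1/4)) = ennreal (sqrt x * (a / l) powr (1/4) * R)"
    using True assms x by (simp add: coll_weight_def x_def ac_simps flip: ennreal_mult)
  then show ?thesis
    using sqrt_tilted_ramp_le[OF x] assms by (auto intro!: ennreal_leI mult_right_mono)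
qed (auto simp: coll_weight_def)

lemma coll_weight_eq_0: "b \<le> 0 \<or> c \<le> 0 \<or> d \<le> 0 \<Longrightarrow> coll_weight a b c d = 0"
  by (auto simp: coll_weight_def)

text \<open>A common majorant for the integrands that remain when \<open>a\<close> and a further frequency \<open>w\<close> are fixed; \<open>s\<close>
  is the integration variable and \<open>a + w\<close> the scale beyond which they decay.\<close>

definition slice_kernel :: "real \<Rightarrow> real \<Rightarrow> real \<Rightarrow> real \<Rightarrow> ennreal" where
  "slice_kernel \<mu> a w s = indicator {0<..} s *
     ennreal (sqrt a * (equil \<mu> s * min 1 (s / a) powr (1/8) * min 1 (2 * (a + w) / s) powr (1/4)))"

lemma measurable_slice_kernel [measurable]: "slice_kernel \<mu> a w \<in> borel_measurable borel"
  unfolding slice_kernel_def[abs_def] by measurable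

lemma nn_integral_slice_kernel_le:
  assumes "\<mu> > 0" "a > 0" "w > 0"
  shows "(\<integral>\<^sup>+s. slice_kernel \<mu> a w s \<partial>lborel) \<le> ennreal (32 * ramp_const \<mu> * sqrt a * (1 + w) powr (1/8))"
proof -
  have "(2 * (a + w) / (1 + a)) powr (1/8) \<le> (2 * (1 + w)) powr (1/8)"
    using assms by (intro powr_mono2) (auto simp: field_simps)
  also have "\<dots> = 2 powr (1/8) * (1 + w) powr (1/8)"
    by (rule powr_mult)
  also have "\<dots> \<le> 2 powr 1 * (1 + w) powr (1/8)"
    by (intro mult_right_mono powr_mono) auto
  finally have e: "(2 * (a + w) / (1 + a)) powr (1/8) \<le> 2 * (1 + w) powr (1/8)" by simp
  have "(\<integral>\<^sup>+s. slice_kernel \<mu> a w s \<partial>lborel) \<le> ennreal (sqrt a * (16 * ramp_const \<mu>) * (2 * (a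
      + w) / (1 + a)) powr (1/8))"
    using assms by (intro nn_integral_equil_kernel_le) (auto simp: slice_kernel_def)
  also have "\<dots> \<le> ennreal (sqrt a * (16 * ramp_const \<mu>) * (2 * (1 + w) powr (1/8)))"
    using assms by (intro ennreal_leI mult_left_mono e) (auto simp: ramp_const_def)
  also have "sqrt a * (16 * ramp_const \<mu>) * (2 * (1 + w) powr (1/8)) = 32 * ramp_const \<mu> * sqrt a
      * (1 + w) powr (1/8)"
    by simp
  finally show ?thesis .
qed

text \<open>Large \<open>s\<close> forces large \<open>l\<close> by the conservation of energy, which enters as \<open>s \<le> l + a + w\<close> whatever
  the roles of the frequencies, and the weight \<open>(a/l)\<^sup>1\<^sup>/\<^sup>4\<close> then provides the decay.\<close>

lemma tilted_slice_le:
  assumes "\<mu> > 0" "a > 0" "w > 0" and s: "s \<in> {b, c, d}" and l: "l \<in> {b, c, d}" and "s \<le> l + a + w"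
  shows "coll_weight a b c d * ennreal (equil \<mu> s * (a / l) powr (1/4)) \<le> slice_kernel \<mu> a w s"
proof (cases "0 < b \<and> 0 < c \<and> 0 < d")
  case True
  then have sl: "s > 0" "l > 0" using s l by auto
  have "min 1 (a / l) \<le> min 1 (2 * (a + w) / s)"
  proof (cases "s \<le> 2 * (a + w)")
    case True
    then show ?thesis using sl by (simp add: min_def field_simps)
  next
    case False
    then have "s \<le> 2 * l" using assms by simp
    then have "a * s \<le> 2 * (a + w) * l"
      using assms sl mult_left_mono[of s "2 * l" a] by (simp add: algebra_simps add_increasing2)
    then have "a / l \<le> 2 * (a + w) / s" using sl by (simp add: field_simps)
    then show ?thesis by (simp add: min.coboundedI2)
  qed
  then have m: "min 1 (a / l) powr (1/4) \<le> min 1 (2 * (a + w) / s) powr (1/4)"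
    using sl assms by (intro powr_mono2) auto
  have "coll_weight a b c d * ennreal (equil \<mu> s * (a / l) powr (1/4))
      \<le> ennreal (sqrt a * min 1 (s / a) powr (1/8) * min 1 (a / l) powr (1/4) * equil \<mu> s)"
    using assms sl equil_pos[of \<mu> s] by (intro coll_weight_le_tilted_ramp) auto
  also have "\<dots> \<le> ennreal (sqrt a * min 1 (s / a) powr (1/8) * min 1 (2 * (a + w) / s) powr (1/4)
      * equil \<mu> s)"
    using m assms sl equil_pos[of \<mu> s] by (intro ennreal_leI mult_left_mono mult_right_mono) auto
  also have "\<dots> = slice_kernel \<mu> a w s"
    using sl by (simp add: slice_kernel_def ac_simps)
  finally show ?thesis .
qed (auto simp: coll_weight_def)

lemma untilted_slice_le:
  assumes "\<mu> > 0" "a > 0" "w > 0" and s: "s \<in> {b, c, d}" and r: "0 \<le> r" "r \<le> equil \<mu> s * min 1 (2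
      * (a + w) / s)"
  shows "coll_weight a b c d * ennreal r \<le> slice_kernel \<mu> a w s"
proof (cases "0 < b \<and> 0 < c \<and> 0 < d")
  case True
  then have s0: "s > 0" using s by auto
  have "min 1 (2 * (a + w) / s) powr 1 \<le> min 1 (2 * (a + w) / s) powr (1/4)"
    using assms s0 by (intro powr_mono') auto
  then have r': "r \<le> equil \<mu> s * min 1 (2 * (a + w) / s) powr (1/4)"
    using assms s0 equil_pos[of \<mu> s] by (auto intro: order_trans[OF r(2)] mult_left_mono)
  define x where "x = min (min a b) (min c d)"
  have x: "x > 0" "x \<le> a" "x \<le> s" "x \<le> a" using True assms by (auto simp: x_def)
  have "coll_weight a b c d * ennreal r = ennreal (sqrt x * r)"
    using True assms x by (simp add: coll_weight_def x_def ac_simps flip: ennreal_mult)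
  also have "\<dots> \<le> ennreal (sqrt a * min 1 (s / a) powr (1/8) * (equil \<mu> s * min 1 (2 * (a
      + w) / s) powr (1/4)))"
    using sqrt_ramp_le[OF x] r r' assms by (intro ennreal_leI mult_mono) auto
  also have "\<dots> = slice_kernel \<mu> a w s"
    using s0 by (simp add: slice_kernel_def ac_simps)
  finally show ?thesis .
qed (auto simp: coll_weight_def)

text \<open>The inner integral may grow like \<open>(1+w)\<^sup>1\<^sup>/\<^sup>8\<close>; the outer integral against \<open>n(w) \<bar>z(w)\<bar>\<close> can afford
  that.\<close>

lemma nn_integral_iterated_slice_le:
  assumes "\<mu> > 0" "a > 0" and [measurable]: "z \<in> borel_measurable borel"
    and z: "l2_square z \<le> ennreal (Z\<^sup>2)" "Z \<ge> 0" and K: "K \<ge> 0"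
    and S: "\<And>w. w > 0 \<Longrightarrow> (\<integral>\<^sup>+s. S w s \<partial>lborel) \<le> ennreal (K * sqrt a * (1 + w) powr (1/8))"
    and S0: "\<And>w s. w \<le> 0 \<Longrightarrow> S w s = 0"
    and [measurable]: "(\<lambda>(w, s). S w s) \<in> borel_measurable (borel \<Otimes>\<^sub>M borel)"
  shows "(\<integral>\<^sup>+w. \<integral>\<^sup>+s. S w s * ennreal (equil \<mu> w * \<bar>z w\<bar>) \<partial>lborel \<partial>lborel) \<le> ennreal (K * (4 * (1
      + 1 / \<mu>)) * Z * sqrt a)"
proof -
  have "(\<integral>\<^sup>+w. \<integral>\<^sup>+s. S w s * ennreal (equil \<mu> w * \<bar>z w\<bar>) \<partial>lborel \<partial>lborel)
    \<le> (\<integral>\<^sup>+w. ennreal (K * sqrt a) * (indicator {0<..} w * ennreal (equil \<mu> w * \<bar>z w\<bar> * (1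
        + w) powr (1/8))) \<partial>lborel)"
  proof (intro nn_integral_mono)
    fix w :: real
    show "(\<integral>\<^sup>+s. S w s * ennreal (equil \<mu> w * \<bar>z w\<bar>) \<partial>lborel)
      \<le> ennreal (K * sqrt a) * (indicator {0<..} w * ennreal (equil \<mu> w * \<bar>z w\<bar> * (1 + w) powr (1/8)))"
    proof (cases "w > 0")
      case True
      have "(\<integral>\<^sup>+s. S w s * ennreal (equil \<mu> w * \<bar>z w\<bar>) \<partial>lborel)
        = (\<integral>\<^sup>+s. S w s \<partial>lborel) * ennreal (equil \<mu> w * \<bar>z w\<bar>)"
        by (rule nn_integral_multc) measurable
      also have "\<dots> \<le> ennreal (K * sqrt a * (1 + w) powr (1/8)) * ennreal (equil \<mu> w * \<bar>z w\<bar>)"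
        by (intro mult_right_mono S True) auto
      also have "\<dots> = ennreal (K * sqrt a * (1 + w) powr (1/8) * (equil \<mu> w * \<bar>z w\<bar>))"
        using K assms(2) by (intro ennreal_mult'[symmetric]) auto
      also have "K * sqrt a * (1 + w) powr (1/8) * (equil \<mu> w * \<bar>z w\<bar>) = (K * sqrt a) * (equil \<mu> w
          * \<bar>z w\<bar> * (1 + w) powr (1/8))"
        by (simp only: ac_simps)
      also have "ennreal \<dots> = ennreal (K * sqrt a) * ennreal (equil \<mu> w * \<bar>z w\<bar> * (1 + w) powr (1/8))"
        using K assms(2) by (intro ennreal_mult') auto
      finally show ?thesis using True by simp
    qed (simp add: S0)
  qed
  also have "\<dots> = ennreal (K * sqrt a) * (\<integral>\<^sup>+w. (indicator {0<..} w * ennreal (equil \<mu> w * \<bar>z w\<bar> * (1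
      + w) powr (1/8))) \<partial>lborel)"
    by (rule nn_integral_cmult) measurable
  also have "\<dots> \<le> ennreal (K * sqrt a) * ennreal (4 * (1 + 1 / \<mu>) * Z)"
    by (intro mult_left_mono nn_integral_equil_mult_le assms) auto
  also have "\<dots> = ennreal (K * sqrt a * (4 * (1 + 1 / \<mu>) * Z))"
    using K assms(2) by (intro ennreal_mult'[symmetric]) auto
  also have "K * sqrt a * (4 * (1 + 1 / \<mu>) * Z) = K * (4 * (1 + 1 / \<mu>)) * Z * sqrt a"
    by (simp only: ac_simps)
  finally show ?thesis .
qed

definition slice_const :: "real \<Rightarrow> real" where
  "slice_const \<mu> = 64 * ramp_const \<mu>"

lemma nn_integral_slice_le:
  assumes "\<mu> > 0" "a > 0" "w > 0" and "\<And>s. S s \<le> slice_kernel \<mu> a w s"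
  shows "(\<integral>\<^sup>+s. S s \<partial>lborel) \<le> ennreal (slice_const \<mu> * sqrt a * (1 + w) powr (1/8))"
proof -
  have "(\<integral>\<^sup>+s. S s \<partial>lborel) \<le> (\<integral>\<^sup>+s. slice_kernel \<mu> a w s \<partial>lborel)"
    by (intro nn_integral_mono assms)
  also have "\<dots> \<le> ennreal (32 * ramp_const \<mu> * sqrt a * (1 + w) powr (1/8))"
    by (intro nn_integral_slice_kernel_le assms)
  also have "\<dots> \<le> ennreal (slice_const \<mu> * sqrt a * (1 + w) powr (1/8))"
    using assms by (intro ennreal_leI mult_right_mono) (auto simp: slice_const_def ramp_const_def)
  finally show ?thesis .
qed

definition pair_const :: "real \<Rightarrow> real" where
  "pair_const \<mu> = slice_const \<mu> * (4 * (1 + 1 / \<mu>))"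

lemma slice_const_nonneg: "slice_const \<mu> \<ge> 0"
  by (simp add: slice_const_def ramp_const_def)

text \<open>The previous estimate in arbitrary coordinates \<open>(w, s)\<close> on the fibre.\<close>

lemma nn_integral_coll_slices_le:
  fixes b c d r :: "real \<Rightarrow> real \<Rightarrow> real"
  assumes "\<mu> > 0" "a > 0" and z_meas [measurable]: "z \<in> borel_measurable borel"
    and z: "l2_square z \<le> ennreal (Z\<^sup>2)" "Z \<ge> 0"
    and [measurable]: "(\<lambda>(w, s). b w s) \<in> borel_measurable (borel \<Otimes>\<^sub>M borel)"
      "(\<lambda>(w, s). c w s) \<in> borel_measurable (borel \<Otimes>\<^sub>M borel)"
      "(\<lambda>(w, s). d w s) \<in> borel_measurable (borel \<Otimes>\<^sub>M borel)"
      "(\<lambda>(w, s). r w s) \<in> borel_measurable (borel \<Otimes>\<^sub>M borel)"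
    and w: "\<And>w s. w \<in> {b w s, c w s, d w s}"
    and r: "\<And>w s. 0 < b w s \<Longrightarrow> 0 < c w s \<Longrightarrow> 0 < d w s \<Longrightarrow> 0 \<le> r w s"
    and S: "\<And>w. w > 0 \<Longrightarrow> (\<integral>\<^sup>+s. coll_weight a (b w s) (c w s) (d w s) * ennreal (r w s) \<partial>lborel)
        \<le> ennreal (slice_const \<mu> * sqrt a * (1 + w) powr (1/8))"
  shows "(\<integral>\<^sup>+w. \<integral>\<^sup>+s. coll_weight a (b w s) (c w s) (d w s) * ennreal (r w s * (equil \<mu> w
      * \<bar>z w\<bar>)) \<partial>lborel \<partial>lborel)
    \<le> ennreal (pair_const \<mu> * Z * sqrt a)"
proof -
  have "(\<integral>\<^sup>+w. \<integral>\<^sup>+s. coll_weight a (b w s) (c w s) (d w s) * ennreal (r w s * (equil \<mu> w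
      * \<bar>z w\<bar>)) \<partial>lborel \<partial>lborel)
     = (\<integral>\<^sup>+w. \<integral>\<^sup>+s. (coll_weight a (b w s) (c w s) (d w s) * ennreal (r w s)) * ennreal (equil \<mu> w
         * \<bar>z w\<bar>) \<partial>lborel \<partial>lborel)"
  proof (rule nn_integral_cong, rule nn_integral_cong)
    fix w s
    show "coll_weight a (b w s) (c w s) (d w s) * ennreal (r w s * (equil \<mu> w * \<bar>z w\<bar>))
      = (coll_weight a (b w s) (c w s) (d w s) * ennreal (r w s)) * ennreal (equil \<mu> w * \<bar>z w\<bar>)"
    proof (cases "0 < b w s \<and> 0 < c w s \<and> 0 < d w s")
      case True
      then have "w > 0" using w[of w s] by auto
      then show ?thesis
        using True r[of w s] equil_pos[OF \<open>\<mu> > 0\<close>, of w] by (simp add: ennreal_mult mult.assoc)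
    next
      case False
      then have "coll_weight a (b w s) (c w s) (d w s) = 0" by (intro coll_weight_eq_0) auto
      then show ?thesis by simp
    qed
  qed
  also have "\<dots> \<le> ennreal (slice_const \<mu> * (4 * (1 + 1 / \<mu>)) * Z * sqrt a)"
  proof (rule nn_integral_iterated_slice_le[OF assms(1,2) z_meas z slice_const_nonneg S])
    fix w s :: real assume "w \<le> 0"
    then have "coll_weight a (b w s) (c w s) (d w s) = 0"
      using w[of w s] by (intro coll_weight_eq_0) auto
    then show "coll_weight a (b w s) (c w s) (d w s) * ennreal (r w s) = 0" by simp
  qed simp_all
  finally show ?thesis
    by (simp only: pair_const_def)
qed

context
  fixes \<mu> :: real and z :: "real \<Rightarrow> real" and Z :: real
  assumes \<mu>: "\<mu> > 0" and z_measurable [measurable]: "z \<in> borel_measurable borel"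
    and z: "l2_square z \<le> ennreal (Z\<^sup>2)" "Z \<ge> 0"
begin

text \<open>Here the bound \<open>b \<le> a + d\<close> takes the place of decay in \<open>b\<close>.\<close>

lemma frequency_bounded_untilted:
  "frequency_bounded (pair_const \<mu> * Z) (\<lambda>a b c d. equil \<mu> b * (equil \<mu> d * \<bar>z d\<bar>))"
  unfolding frequency_bounded_def
proof (intro allI impI)
  fix a :: real assume a: "a > 0"
  have "(\<integral>\<^sup>+d. \<integral>\<^sup>+b. coll_weight a b (d + a - b) d * ennreal (equil \<mu> b * (equil \<mu> d
      * \<bar>z d\<bar>)) \<partial>lborel \<partial>lborel)
      \<le> ennreal (pair_const \<mu> * Z * sqrt a)"
  proof (rule nn_integral_coll_slices_le[OF \<mu> a z_measurable z])
    fix d :: real assume d: "d > 0"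
    show "(\<integral>\<^sup>+b. coll_weight a b (d + a - b) d * ennreal (equil \<mu> b) \<partial>lborel)
        \<le> ennreal (slice_const \<mu> * sqrt a * (1 + d) powr (1/8))"
    proof (rule nn_integral_slice_le[OF \<mu> a d])
      fix b :: real
      show "coll_weight a b (d + a - b) d * ennreal (equil \<mu> b) \<le> slice_kernel \<mu> a d b"
      proof (cases "0 < b \<and> b < a + d")
        case True
        then have "min 1 (2 * (a + d) / b) = 1" using a d by (simp add: field_simps)
        with True show ?thesis
          using equil_pos[OF \<mu>, of b] by (intro untilted_slice_le \<mu> a d) auto
      next
        case False
        then have "coll_weight a b (d + a - b) d = 0" by (intro coll_weight_eq_0) auto
        then show ?thesis by simp
      qed
    qed
  qed (auto simp: less_imp_le[OF equil_pos[OF \<mu>]])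
  then show "(\<integral>\<^sup>+b. \<integral>\<^sup>+c. coll_weight a b c (b + c - a) * ennreal (equil \<mu> b * (equil \<mu> (b + c - a)
      * \<bar>z (b + c - a)\<bar>)) \<partial>lborel \<partial>lborel)
    \<le> ennreal (pair_const \<mu> * Z * sqrt a)"
    using fibre_integral_outer_db[of "\<lambda>(b, c, d). coll_weight a b c d * ennreal (equil \<mu> b
        * (equil \<mu> d * \<bar>z d\<bar>))" a]
    by simp
qed

text \<open>Neither \<open>n(c)\<close> nor \<open>n(d)\<close> is integrable in \<open>c\<close>, but their difference is: with \<open>s\<close> the smaller and
  \<open>l\<close> the larger of \<open>c\<close> and \<open>d\<close> it equals \<open>n(s) (l - s) / (l + \<mu>)\<close>, and \<open>l - s = \<bar>a - b\<bar>\<close>.\<close>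

lemma frequency_bounded_difference:
  "frequency_bounded (pair_const \<mu> * Z) (\<lambda>a b c d. \<bar>equil \<mu> c - equil \<mu> d\<bar> * (equil \<mu> b * \<bar>z b\<bar>))"
  unfolding frequency_bounded_def
proof (intro allI impI)
  fix a :: real assume a: "a > 0"
  show "(\<integral>\<^sup>+b. \<integral>\<^sup>+c. coll_weight a b c (b + c - a) * ennreal (\<bar>equil \<mu> c - equil \<mu> (b + c - a)\<bar>
      * (equil \<mu> b * \<bar>z b\<bar>)) \<partial>lborel \<partial>lborel)
      \<le> ennreal (pair_const \<mu> * Z * sqrt a)"
  proof (rule nn_integral_coll_slices_le[OF \<mu> a z_measurable z])
    fix b :: real assume b: "b > 0"
    have diff: "\<bar>equil \<mu> s - equil \<mu> l\<bar> \<le> equil \<mu> s * min 1 (2 * (a + b) / s)"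
      if "0 < s" "s \<le> l" "l - s \<le> a + b" for s l
    proof -
      define q where "q = (l - s) / (l + \<mu>)"
      have "equil \<mu> s - equil \<mu> l = equil \<mu> s * q"
        using that \<mu> by (simp add: equil_def q_def field_simps)
      moreover have "q \<le> min 1 (2 * (a + b) / s)"
      proof (rule min.boundedI)
        have "(l - s) / (l + \<mu>) \<le> (a + b) / s"
          using that \<mu> a b by (intro frac_le) auto
        also have "\<dots> \<le> 2 * (a + b) / s"
          using that a b by (intro divide_right_mono) auto
        finally show "q \<le> 2 * (a + b) / s" by (simp add: q_def)
      qed (use that \<mu> in \<open>simp add: q_def\<close>)
      moreover have "q \<ge> 0" using that \<mu> by (simp add: q_def)
      ultimately show ?thesis
        using equil_pos[OF \<mu>, of s] that by (simp add: abs_mult mult_left_mono)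
    qed
    have "(\<integral>\<^sup>+c. coll_weight a b c (b + c - a) * ennreal \<bar>equil \<mu> c - equil \<mu> (b + c - a)\<bar> \<partial>lborel)
      \<le> (\<integral>\<^sup>+c. slice_kernel \<mu> a b c + slice_kernel \<mu> a b ((b - a) + c) \<partial>lborel)"
    proof (intro nn_integral_mono)
      fix c :: real
      define d where "d = b + c - a"
      have "coll_weight a b c d * ennreal \<bar>equil \<mu> c - equil \<mu> d\<bar> \<le> slice_kernel \<mu> a b c
          + slice_kernel \<mu> a b d"
      proof (cases "0 < c \<and> 0 < d")
        case True
        show ?thesis
        proof (cases "c \<le> d")
          case le: True
          then have "coll_weight a b c d * ennreal \<bar>equil \<mu> c - equil \<mu> d\<bar> \<le> slice_kernel \<mu> a b c"
            using True a b diff[of c d] by (intro untilted_slice_le \<mu>) (auto simp: d_def)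
          then show ?thesis by (simp add: add_increasing2)
        next
          case False
          then have "coll_weight a b c d * ennreal \<bar>equil \<mu> c - equil \<mu> d\<bar> \<le> slice_kernel \<mu> a b d"
            using True a b diff[of d c] by (intro untilted_slice_le \<mu>) (auto simp: d_def abs_minus_commute)
          then show ?thesis by (simp add: add_increasing)
        qed
      next
        case False
        then have "coll_weight a b c d = 0" by (intro coll_weight_eq_0) auto
        then show ?thesis by simp
      qed
      then show "coll_weight a b c (b + c - a) * ennreal \<bar>equil \<mu> c - equil \<mu> (b + c - a)\<bar>
          \<le> slice_kernel \<mu> a b c + slice_kernel \<mu> a b ((b - a) + c)"
        by (simp add: d_def algebra_simps)
    qed
    also have "\<dots> = (\<integral>\<^sup>+c. slice_kernel \<mu> a b c \<partial>lborel) + (\<integral>\<^sup>+c. slice_kernel \<mu> a b c \<partial>lborel)"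
      using nn_integral_lborel_shift[of "slice_kernel \<mu> a b" "b - a"] by (simp add: nn_integral_add)
    also have "\<dots> \<le> ennreal (32 * ramp_const \<mu> * sqrt a * (1 + b) powr (1/8)) + ennreal (32
        * ramp_const \<mu> * sqrt a * (1 + b) powr (1/8))"
      by (intro add_mono nn_integral_slice_kernel_le \<mu> a b)
    also have "\<dots> = ennreal (slice_const \<mu> * sqrt a * (1 + b) powr (1/8))"
      using a by (subst ennreal_plus[symmetric]) (auto simp: slice_const_def ramp_const_def)
    finally show "(\<integral>\<^sup>+c. coll_weight a b c (b + c - a) * ennreal \<bar>equil \<mu> c - equil \<mu> (b + c - a)\<bar> \<partial>lborel)
        \<le> ennreal (slice_const \<mu> * sqrt a * (1 + b) powr (1/8))" .
  qed auto
qed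

text \<open>This bound and its dual serve the Schur test that exchanges \<open>\<omega>\<^sub>0\<close> and \<open>\<omega>\<^sub>1\<close>: the exchange moves the
  function \<open>z\<close> from \<open>\<omega>\<^sub>3\<close> to \<open>\<omega>\<^sub>2\<close>.\<close>

lemma frequency_bounded_opposite:
  "frequency_bounded (pair_const \<mu> * Z) (\<lambda>a b c d. (equil \<mu> c * (a / b) powr (1/4)) * (equil \<mu> d * \<bar>z d\<bar>))"
  unfolding frequency_bounded_def
proof (intro allI impI)
  fix a :: real assume a: "a > 0"
  have "(\<integral>\<^sup>+d. \<integral>\<^sup>+c. coll_weight a (d + a - c) c d * ennreal ((equil \<mu> c * (a / (d
      + a - c)) powr (1/4)) * (equil \<mu> d * \<bar>z d\<bar>)) \<partial>lborel \<partial>lborel)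
      \<le> ennreal (pair_const \<mu> * Z * sqrt a)"
  proof (rule nn_integral_coll_slices_le[OF \<mu> a z_measurable z])
    fix d :: real assume d: "d > 0"
    show "(\<integral>\<^sup>+c. coll_weight a (d + a - c) c d * ennreal (equil \<mu> c * (a / (d + a - c)) powr (1/4)) \<partial>lborel)
        \<le> ennreal (slice_const \<mu> * sqrt a * (1 + d) powr (1/8))"
    proof (rule nn_integral_slice_le[OF \<mu> a d])
      fix c :: real
      show "coll_weight a (d + a - c) c d * ennreal (equil \<mu> c * (a / (d + a - c)) powr (1/4))
          \<le> slice_kernel \<mu> a d c"
      proof (cases "c < d + a")
        case True
        then show ?thesis by (intro tilted_slice_le \<mu> a d) auto
      next
        case False
        then have "coll_weight a (d + a - c) c d = 0" by (intro coll_weight_eq_0) auto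
        then show ?thesis by simp
      qed
    qed
  qed (auto simp: less_imp_le[OF equil_pos[OF \<mu>]])
  then show "(\<integral>\<^sup>+b. \<integral>\<^sup>+c. coll_weight a b c (b + c - a) * ennreal ((equil \<mu> c * (a / b) powr (1/4))
      * (equil \<mu> (b + c - a) * \<bar>z (b + c - a)\<bar>)) \<partial>lborel \<partial>lborel)
    \<le> ennreal (pair_const \<mu> * Z * sqrt a)"
    using fibre_integral_outer_dc[of "\<lambda>(b, c, d). coll_weight a b c d * ennreal ((equil \<mu> c
        * (a / b) powr (1/4)) * (equil \<mu> d * \<bar>z d\<bar>))" a]
    by simp
qed

lemma frequency_bounded_opposite_dual:
  "frequency_bounded (pair_const \<mu> * Z) (\<lambda>a b c d. (equil \<mu> d * (a / b) powr (1/4)) * (equil \<mu> c * \<bar>z c\<bar>))"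
  unfolding frequency_bounded_def
proof (intro allI impI)
  fix a :: real assume a: "a > 0"
  have "(\<integral>\<^sup>+c. \<integral>\<^sup>+d. coll_weight a (d + a - c) c d * ennreal ((equil \<mu> d * (a / (d
      + a - c)) powr (1/4)) * (equil \<mu> c * \<bar>z c\<bar>)) \<partial>lborel \<partial>lborel)
      \<le> ennreal (pair_const \<mu> * Z * sqrt a)"
  proof (rule nn_integral_coll_slices_le[OF \<mu> a z_measurable z])
    fix c :: real assume c: "c > 0"
    show "(\<integral>\<^sup>+d. coll_weight a (d + a - c) c d * ennreal (equil \<mu> d * (a / (d + a - c)) powr (1/4)) \<partial>lborel)
        \<le> ennreal (slice_const \<mu> * sqrt a * (1 + c) powr (1/8))"
      using a c by (intro nn_integral_slice_le[OF \<mu> a c] tilted_slice_le \<mu>) auto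
  qed (auto simp: less_imp_le[OF equil_pos[OF \<mu>]])
  then show "(\<integral>\<^sup>+b. \<integral>\<^sup>+c. coll_weight a b c (b + c - a) * ennreal ((equil \<mu> (b + c - a)
      * (a / b) powr (1/4)) * (equil \<mu> c * \<bar>z c\<bar>)) \<partial>lborel \<partial>lborel)
    \<le> ennreal (pair_const \<mu> * Z * sqrt a)"
    using fibre_integral_outer_cd[of "\<lambda>(b, c, d). coll_weight a b c d * ennreal ((equil \<mu> d
        * (a / b) powr (1/4)) * (equil \<mu> c * \<bar>z c\<bar>))" a]
    by simp
qed

text \<open>For the Schur test that exchanges \<open>\<omega>\<^sub>0\<close> and \<open>\<omega>\<^sub>3\<close>, which leaves the kernel unchanged.\<close>

lemma frequency_bounded_same_side:
  "frequency_bounded (pair_const \<mu> * Z) (\<lambda>a b c d. (equil \<mu> c * (a / d) powr (1/4)) * (equil \<mu> b * \<bar>z b\<bar>))"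
  unfolding frequency_bounded_def
proof (intro allI impI)
  fix a :: real assume a: "a > 0"
  show "(\<integral>\<^sup>+b. \<integral>\<^sup>+c. coll_weight a b c (b + c - a) * ennreal ((equil \<mu> c * (a / (b
      + c - a)) powr (1/4)) * (equil \<mu> b * \<bar>z b\<bar>)) \<partial>lborel \<partial>lborel)
      \<le> ennreal (pair_const \<mu> * Z * sqrt a)"
  proof (rule nn_integral_coll_slices_le[OF \<mu> a z_measurable z])
    fix b :: real assume b: "b > 0"
    show "(\<integral>\<^sup>+c. coll_weight a b c (b + c - a) * ennreal (equil \<mu> c * (a / (b + c - a)) powr (1/4)) \<partial>lborel)
        \<le> ennreal (slice_const \<mu> * sqrt a * (1 + b) powr (1/8))"
      using a b by (intro nn_integral_slice_le[OF \<mu> a b] tilted_slice_le \<mu>) auto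
  qed (auto simp: less_imp_le[OF equil_pos[OF \<mu>]])
qed

end

text \<open>Two factors \<open>n z\<close> and \<open>n v\<close> make both integrations converge, so that \<open>\<Omega> \<le> 1\<close> suffices.\<close>

lemma nn_integral_coll_products_le:
  fixes S :: "real \<Rightarrow> real \<Rightarrow> ennreal"
  assumes \<mu>: "\<mu> > 0" and [measurable]: "z \<in> borel_measurable borel" "v \<in> borel_measurable borel"
    and z: "l2_square z \<le> ennreal (Z\<^sup>2)" "Z \<ge> 0" and v: "l2_square v \<le> ennreal (V\<^sup>2)" "V \<ge> 0"
    and S: "\<And>x y. 0 < x \<Longrightarrow> 0 < y \<Longrightarrow> S x y \<le> ennreal (sqrt a * ((equil \<mu> x * \<bar>z x\<bar>) * (equil \<mu> y * \<bar>v y\<bar>)))"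
    and S0: "\<And>x y. x \<le> 0 \<or> y \<le> 0 \<Longrightarrow> S x y = 0" and a: "a > 0"
  shows "(\<integral>\<^sup>+x. \<integral>\<^sup>+y. S x y \<partial>lborel \<partial>lborel) \<le> ennreal ((4 * (1 + 1 / \<mu>))\<^sup>2 * (Z * V) * sqrt a)"
proof -
  define k where "k u x = indicator {0<..} x * ennreal (equil \<mu> x * \<bar>u x\<bar>)" for u :: "real \<Rightarrow> real" and x
  have [measurable]: "k z \<in> borel_measurable borel" "k v \<in> borel_measurable borel"
    unfolding k_def[abs_def] by measurable
  have k: "(\<integral>\<^sup>+x. k u x \<partial>lborel) \<le> ennreal (4 * (1 + 1 / \<mu>) * U)"
    if [measurable]: "u \<in> borel_measurable borel" and u: "l2_square u \<le> ennreal (U\<^sup>2)" "U \<ge> 0" for u U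
  proof -
    have "(\<integral>\<^sup>+x. k u x \<partial>lborel) \<le> (\<integral>\<^sup>+w. indicator {0<..} w * ennreal (equil \<mu> w * \<bar>u w\<bar> * (1
        + w) powr (1/8)) \<partial>lborel)"
    proof (intro nn_integral_mono)
      fix w :: real
      have "1 \<le> (1 + w) powr (1/8)" if "w > 0"
        using that by (intro ge_one_powr_ge_zero) auto
      then have "w > 0 \<Longrightarrow> equil \<mu> w * \<bar>u w\<bar> * 1 \<le> equil \<mu> w * \<bar>u w\<bar> * (1 + w) powr (1/8)"
        using equil_pos[OF \<mu>, of w] by (intro mult_left_mono) auto
      then show "k u w \<le> indicator {0<..} w * ennreal (equil \<mu> w * \<bar>u w\<bar> * (1 + w) powr (1/8))"
        by (auto simp: k_def indicator_def intro!: ennreal_leI)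
    qed
    also have "\<dots> \<le> ennreal (4 * (1 + 1 / \<mu>) * U)"
      by (intro nn_integral_equil_mult_le \<mu> that)
    finally show ?thesis .
  qed
  have "(\<integral>\<^sup>+x. \<integral>\<^sup>+y. S x y \<partial>lborel \<partial>lborel) \<le> (\<integral>\<^sup>+x. \<integral>\<^sup>+y. (ennreal (sqrt a) * k z x)
      * k v y \<partial>lborel \<partial>lborel)"
  proof (intro nn_integral_mono)
    fix x y :: real
    show "S x y \<le> (ennreal (sqrt a) * k z x) * k v y"
    proof (cases "0 < x \<and> 0 < y")
      case True
      then show ?thesis
        using S[of x y] equil_pos[OF \<mu>, of x] equil_pos[OF \<mu>, of y] a
        by (simp add: k_def ennreal_mult mult.assoc)
    qed (use S0[of x y] in auto)
  qed
  also have "\<dots> = (\<integral>\<^sup>+x. (ennreal (sqrt a) * k z x) * (\<integral>\<^sup>+y. k v y \<partial>lborel) \<partial>lborel)"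
    by (intro nn_integral_cong nn_integral_cmult) measurable
  also have "\<dots> = (ennreal (sqrt a) * (\<integral>\<^sup>+x. k z x \<partial>lborel)) * (\<integral>\<^sup>+y. k v y \<partial>lborel)"
    by (simp add: nn_integral_multc nn_integral_cmult)
  also have "\<dots> \<le> (ennreal (sqrt a) * ennreal (4 * (1 + 1 / \<mu>) * Z)) * ennreal (4 * (1 + 1 / \<mu>) * V)"
    by (intro mult_mono mult_left_mono k z v) auto
  also have "\<dots> = ennreal (sqrt a * (4 * (1 + 1 / \<mu>) * Z) * (4 * (1 + 1 / \<mu>) * V))"
    using z(2) v(2) \<mu> a by (subst ennreal_mult[symmetric], simp, simp)+ simp
  also have "sqrt a * (4 * (1 + 1 / \<mu>) * Z) * (4 * (1 + 1 / \<mu>) * V) = (4 * (1 + 1 / \<mu>))\<^sup>2 * (Z * V)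
      * sqrt a"
    by (simp only: power2_eq_square ac_simps)
  finally show ?thesis .
qed

context
  fixes \<mu> :: real and z v :: "real \<Rightarrow> real" and Z V :: real
  assumes \<mu>: "\<mu> > 0" and z_measurable [measurable]: "z \<in> borel_measurable borel"
    and v_measurable [measurable]: "v \<in> borel_measurable borel"
    and z: "l2_square z \<le> ennreal (Z\<^sup>2)" "Z \<ge> 0" and v: "l2_square v \<le> ennreal (V\<^sup>2)" "V \<ge> 0"
begin

lemma coll_weight_mult_le:
  assumes "a > 0" "r \<ge> 0"
  shows "coll_weight a b c d * ennreal r \<le> ennreal (sqrt a * r)"
proof -
  have "coll_weight a b c d \<le> ennreal (sqrt a)"
    using assms(1) by (auto simp: coll_weight_def intro!: ennreal_leI)
  then have "coll_weight a b c d * ennreal r \<le> ennreal (sqrt a) * ennreal r"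
    by (rule mult_right_mono) simp
  then show ?thesis using assms by (simp add: ennreal_mult)
qed

lemma frequency_bounded_product_bc:
  "frequency_bounded ((4 * (1 + 1 / \<mu>))\<^sup>2 * (Z * V)) (\<lambda>a b c d. (equil \<mu> b * \<bar>z b\<bar>) * (equil \<mu> c * \<bar>v c\<bar>))"
  unfolding frequency_bounded_def
proof (intro allI impI)
  fix a :: real assume a: "a > 0"
  show "(\<integral>\<^sup>+b. \<integral>\<^sup>+c. coll_weight a b c (b + c - a) * ennreal ((equil \<mu> b * \<bar>z b\<bar>) * (equil \<mu> c
      * \<bar>v c\<bar>)) \<partial>lborel \<partial>lborel)
      \<le> ennreal ((4 * (1 + 1 / \<mu>))\<^sup>2 * (Z * V) * sqrt a)"
  proof (rule nn_integral_coll_products_le[OF \<mu> z_measurable v_measurable z v])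
    fix b c :: real
    show "coll_weight a b c (b + c - a) * ennreal ((equil \<mu> b * \<bar>z b\<bar>) * (equil \<mu> c * \<bar>v c\<bar>))
      \<le> ennreal (sqrt a * ((equil \<mu> b * \<bar>z b\<bar>) * (equil \<mu> c * \<bar>v c\<bar>)))" if "0 < b" "0 < c"
      using that equil_pos[OF \<mu>, of b] equil_pos[OF \<mu>, of c] by (intro coll_weight_mult_le a) auto
    show "coll_weight a b c (b + c - a) * ennreal ((equil \<mu> b * \<bar>z b\<bar>) * (equil \<mu> c * \<bar>v c\<bar>))
        = 0" if "b \<le> 0 \<or> c \<le> 0"
      using that coll_weight_eq_0[of b c] by auto
  qed (rule a)
qed

lemma frequency_bounded_product_cd:
  "frequency_bounded ((4 * (1 + 1 / \<mu>))\<^sup>2 * (Z * V)) (\<lambda>a b c d. (equil \<mu> c * \<bar>z c\<bar>) * (equil \<mu> d * \<bar>v d\<bar>))"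
  unfolding frequency_bounded_def
proof (intro allI impI)
  fix a :: real assume a: "a > 0"
  have "(\<integral>\<^sup>+c. \<integral>\<^sup>+d. coll_weight a (d + a - c) c d * ennreal ((equil \<mu> c * \<bar>z c\<bar>) * (equil \<mu> d
      * \<bar>v d\<bar>)) \<partial>lborel \<partial>lborel)
      \<le> ennreal ((4 * (1 + 1 / \<mu>))\<^sup>2 * (Z * V) * sqrt a)"
  proof (rule nn_integral_coll_products_le[OF \<mu> z_measurable v_measurable z v])
    fix c d :: real
    show "coll_weight a (d + a - c) c d * ennreal ((equil \<mu> c * \<bar>z c\<bar>) * (equil \<mu> d * \<bar>v d\<bar>))
      \<le> ennreal (sqrt a * ((equil \<mu> c * \<bar>z c\<bar>) * (equil \<mu> d * \<bar>v d\<bar>)))" if "0 < c" "0 < d"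
      using that equil_pos[OF \<mu>, of c] equil_pos[OF \<mu>, of d] by (intro coll_weight_mult_le a) auto
    show "coll_weight a (d + a - c) c d * ennreal ((equil \<mu> c * \<bar>z c\<bar>) * (equil \<mu> d * \<bar>v d\<bar>))
        = 0" if "c \<le> 0 \<or> d \<le> 0"
      using that coll_weight_eq_0[of _ c d] by auto
  qed (rule a)
  then show "(\<integral>\<^sup>+b. \<integral>\<^sup>+c. coll_weight a b c (b + c - a) * ennreal ((equil \<mu> c * \<bar>z c\<bar>) * (equil \<mu> (b
      + c - a) * \<bar>v (b + c - a)\<bar>)) \<partial>lborel \<partial>lborel)
      \<le> ennreal ((4 * (1 + 1 / \<mu>))\<^sup>2 * (Z * V) * sqrt a)"
    using fibre_integral_outer_cd[of "\<lambda>(b, c, d). coll_weight a b c d * ennreal ((equil \<mu> c * \<bar>z c\<bar>)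
        * (equil \<mu> d * \<bar>v d\<bar>))" a]
    by simp
qed

lemma frequency_bounded_product_bd_tilted:
  "frequency_bounded ((4 * (1 + 1 / \<mu>))\<^sup>2 * (Z * V)) (\<lambda>a b c d. (equil \<mu> b * \<bar>z b\<bar>) * (equil \<mu> d
      * \<bar>v d\<bar>) * (a / c) powr (1/4))"
  unfolding frequency_bounded_def
proof (intro allI impI)
  fix a :: real assume a: "a > 0"
  have "(\<integral>\<^sup>+b. \<integral>\<^sup>+d. coll_weight a b (d + a - b) d * ennreal ((equil \<mu> b * \<bar>z b\<bar>) * (equil \<mu> d
      * \<bar>v d\<bar>) * (a / (d + a - b)) powr (1/4)) \<partial>lborel \<partial>lborel)
      \<le> ennreal ((4 * (1 + 1 / \<mu>))\<^sup>2 * (Z * V) * sqrt a)"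
  proof (rule nn_integral_coll_products_le[OF \<mu> z_measurable v_measurable z v])
    fix b d :: real
    show "coll_weight a b (d + a - b) d * ennreal ((equil \<mu> b * \<bar>z b\<bar>) * (equil \<mu> d * \<bar>v d\<bar>)
        * (a / (d + a - b)) powr (1/4))
      \<le> ennreal (sqrt a * ((equil \<mu> b * \<bar>z b\<bar>) * (equil \<mu> d * \<bar>v d\<bar>)))" if bd: "0 < b" "0 < d"
    proof (cases "d + a - b > 0")
      case True
      define R where "R = (equil \<mu> b * \<bar>z b\<bar>) * (equil \<mu> d * \<bar>v d\<bar>)"
      have R: "R \<ge> 0" using bd equil_pos[OF \<mu>, of b] equil_pos[OF \<mu>, of d] by (simp add: R_def)
      have "min 1 (b / a) powr (1/8) \<le> 1" "min 1 (a / (d + a - b)) powr (1/4) \<le> 1"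
        using a bd True by (auto intro!: powr_le1)
      then have "sqrt a * min 1 (b / a) powr (1/8) * min 1 (a / (d + a - b)) powr (1/4) * R \<le> sqrt a
          * 1 * 1 * R"
        using a R by (intro mult_mono) auto
      then have "coll_weight a b (d + a - b) d * ennreal (R * (a / (d + a - b)) powr (1/4))
          \<le> ennreal (sqrt a * R)"
        using a R by (intro order_trans[OF coll_weight_le_tilted_ramp[where s = b]] ennreal_leI) auto
      then show ?thesis by (simp only: R_def)
    next
      case False
      then have "coll_weight a b (d + a - b) d = 0" by (intro coll_weight_eq_0) auto
      then show ?thesis by simp
    qed
    show "coll_weight a b (d + a - b) d * ennreal ((equil \<mu> b * \<bar>z b\<bar>) * (equil \<mu> d * \<bar>v d\<bar>)
        * (a / (d + a - b)) powr (1/4)) = 0" if "b \<le> 0 \<or> d \<le> 0"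
      using that coll_weight_eq_0[of b _ d] by auto
  qed (rule a)
  then show "(\<integral>\<^sup>+b. \<integral>\<^sup>+c. coll_weight a b c (b + c - a) * ennreal ((equil \<mu> b * \<bar>z b\<bar>) * (equil \<mu> (b
      + c - a) * \<bar>v (b + c - a)\<bar>) * (a / c) powr (1/4)) \<partial>lborel \<partial>lborel)
      \<le> ennreal ((4 * (1 + 1 / \<mu>))\<^sup>2 * (Z * V) * sqrt a)"
    using fibre_integral_outer_bd[of "\<lambda>(b, c, d). coll_weight a b c d * ennreal ((equil \<mu> b * \<bar>z b\<bar>)
        * (equil \<mu> d * \<bar>v d\<bar>) * (a / c) powr (1/4))" a]
    by simp
qed

end

text \<open>For a kernel symmetric in \<open>b\<close> and \<open>c\<close> one may assume that \<open>b\<close> is the smaller of the two, at the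
  price of a factor two; then \<open>c \<ge> (a + d) / 2\<close>.\<close>

lemma fibre_integral_symmetric_le:
  assumes [measurable]: "H \<in> borel_measurable (borel \<Otimes>\<^sub>M borel \<Otimes>\<^sub>M borel)"
    and sym: "\<And>b c d. H (c, b, d) = H (b, c, d)"
  shows "(\<integral>\<^sup>+b. \<integral>\<^sup>+c. H (b, c, b + c - a) \<partial>lborel \<partial>lborel)
    \<le> 2 * (\<integral>\<^sup>+d. \<integral>\<^sup>+b. indicator {..(d + a) / 2} b * H (b, d + a - b, d) \<partial>lborel \<partial>(lborel :: real measure))"
proof -
  define K where "K = (\<lambda>(b, c, d). (if b \<le> c then 1 else 0) * H (b, c, d))"
  have [measurable]: "K \<in> borel_measurable (borel \<Otimes>\<^sub>M borel \<Otimes>\<^sub>M borel)"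
    unfolding K_def by measurable
  have "(\<integral>\<^sup>+b. \<integral>\<^sup>+c. H (b, c, b + c - a) \<partial>lborel \<partial>lborel)
    \<le> (\<integral>\<^sup>+b. \<integral>\<^sup>+c. K (b, c, b + c - a) + K (c, b, b + c - a) \<partial>lborel \<partial>lborel)"
    by (intro nn_integral_mono) (auto simp: K_def sym)
  also have "\<dots> = (\<integral>\<^sup>+b. \<integral>\<^sup>+c. K (b, c, b + c - a) \<partial>lborel \<partial>lborel) + (\<integral>\<^sup>+b. \<integral>\<^sup>+c. K (c, b, b
      + c - a) \<partial>lborel \<partial>lborel)"
    by (simp add: nn_integral_add)
  also have "\<dots> = 2 * (\<integral>\<^sup>+b. \<integral>\<^sup>+c. K (b, c, b + c - a) \<partial>lborel \<partial>lborel)"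
    using fibre_integral_swap[of K a] by (simp add: mult_2)
  also have "(\<integral>\<^sup>+b. \<integral>\<^sup>+c. K (b, c, b + c - a) \<partial>lborel \<partial>lborel) = (\<integral>\<^sup>+d. \<integral>\<^sup>+b. K (b, d
      + a - b, d) \<partial>lborel \<partial>lborel)"
    by (rule fibre_integral_outer_db) measurable
  also have "\<dots> = (\<integral>\<^sup>+d. \<integral>\<^sup>+b. indicator {..(d + a) / 2} b * H (b, d + a - b, d) \<partial>lborel \<partial>lborel)"
    by (intro nn_integral_cong) (auto simp: K_def indicator_def field_simps)
  finally show ?thesis .
qed

lemma nn_integral_equil_mass_le:
  assumes \<mu>: "\<mu> > 0" and a: "a > 0" and c: "c > 0" and A: "A \<ge> 0"
    and g: "\<And>s. 0 < s \<Longrightarrow> s \<le> c \<Longrightarrow> g s \<le> ennreal (A * (equil \<mu> s * min 1 (s / a) powr (1/8)))"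
    and g0: "\<And>s. s \<le> 0 \<or> c < s \<Longrightarrow> g s = 0"
  shows "(\<integral>\<^sup>+s. g s \<partial>lborel) \<le> ennreal (A * (16 * ramp_const \<mu>) * (c / (1 + a)) powr (1/8))"
proof (rule nn_integral_equil_kernel_le[OF \<mu> a c A])
  fix s :: real assume s: "s > 0"
  show "g s \<le> ennreal (A * (equil \<mu> s * min 1 (s / a) powr (1/8) * min 1 (c / s) powr (1/4)))"
  proof (cases "s \<le> c")
    case True
    then have "min 1 (c / s) = 1" using s by (simp add: field_simps)
    with g[OF s True] show ?thesis by simp
  qed (simp add: g0)
qed (use g0 in auto)

lemma ramp_const_nonneg: "ramp_const \<mu> \<ge> 0"
  by (simp add: ramp_const_def)

lemma powr_quotient_le_one: "a > 0 \<Longrightarrow> (a / (1 + a)) powr (1/8) \<le> (1::real)"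
  by (intro powr_le1) auto

text \<open>With \<open>b \<le> c\<close> one has \<open>n(c) \<le> 2 / (a + d)\<close>. Integrating \<open>b\<close> up to \<open>a + d\<close> costs only \<open>(a + d)\<^sup>1\<^sup>/\<^sup>8\<close>,
  and the remaining integral over \<open>d\<close> is the scaling integral.\<close>

lemma frequency_bounded_within:
  assumes \<mu>: "\<mu> > 0"
  shows "frequency_bounded (1024 * ramp_const \<mu>) (\<lambda>a b c d. (equil \<mu> b * equil \<mu> c) * (a / d) powr (1/4))"
  unfolding frequency_bounded_def
proof (intro allI impI)
  fix a :: real assume a: "a > 0"
  define H where "H = (\<lambda>(b, c, d). coll_weight a b c d * ennreal ((equil \<mu> b * equil \<mu> c)
      * (a / d) powr (1/4)))"
  have [measurable]: "H \<in> borel_measurable (borel \<Otimes>\<^sub>M borel \<Otimes>\<^sub>M borel)"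
    unfolding H_def by measurable
  define B where "B = sqrt a * 32 * ramp_const \<mu> * (1 + a) powr (-1/8)"
  have B: "B \<ge> 0" using a by (simp add: B_def ramp_const_nonneg)
  have inner: "(\<integral>\<^sup>+b. indicator {..(d + a) / 2} b * H (b, d + a - b, d) \<partial>lborel)
      \<le> ennreal B * (indicator {0<..} d * ennreal (d powr (-7/8) * min 1 (a / d) powr (1/4)))" for d
  proof (cases "d > 0")
    case d: True
    define A where "A = sqrt a * min 1 (a / d) powr (1/4) * (2 / (a + d))"
    have A: "A \<ge> 0" using a d by (simp add: A_def)
    have "(\<integral>\<^sup>+b. indicator {..(d + a) / 2} b * H (b, d + a - b, d) \<partial>lborel)
      \<le> ennreal (A * (16 * ramp_const \<mu>) * ((a + d) / (1 + a)) powr (1/8))"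
    proof (rule nn_integral_equil_mass_le[OF \<mu> a _ A])
      fix b :: real
      show "indicator {..(d + a) / 2} b * H (b, d + a - b, d) \<le> ennreal (A * (equil \<mu> b
          * min 1 (b / a) powr (1/8)))"
        if b: "0 < b" "b \<le> a + d"
      proof (cases "b \<le> (d + a) / 2")
        case True
        then have c: "(a + d) / 2 \<le> d + a - b" by (simp add: field_simps)
        have "equil \<mu> (d + a - b) \<le> 1 / (d + a - b)"
          using c a d by (intro equil_le_inverse \<mu>) auto
        also have "\<dots> \<le> 1 / ((a + d) / 2)"
          using c a d by (intro divide_left_mono) auto
        finally have n: "equil \<mu> (d + a - b) \<le> 2 / (a + d)" by simp
        have "H (b, d + a - b, d) \<le> ennreal (sqrt a * min 1 (b / a) powr (1/8)
            * min 1 (a / d) powr (1/4) * (equil \<mu> b * equil \<mu> (d + a - b)))"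
          unfolding H_def prod.case
          using equil_pos[OF \<mu>, of b] equil_pos[OF \<mu>, of "d + a - b"] b True c a d
          by (intro coll_weight_le_tilted_ramp a mult_nonneg_nonneg) auto
        also have "\<dots> \<le> ennreal (sqrt a * min 1 (b / a) powr (1/8) * min 1 (a / d) powr (1/4)
            * (equil \<mu> b * (2 / (a + d))))"
          using n equil_pos[OF \<mu>, of b] b a by (intro ennreal_leI mult_left_mono) auto
        also have "\<dots> = ennreal (A * (equil \<mu> b * min 1 (b / a) powr (1/8)))"
          by (simp only: A_def ac_simps)
        finally show ?thesis using True by simp
      qed simp
      show "indicator {..(d + a) / 2} b * H (b, d + a - b, d) = 0" if "b \<le> 0 \<or> a + d < b"
        using that coll_weight_eq_0[of b "d + a - b" d] by (auto simp: H_def)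
    qed (use a d in simp)
    also have "A * (16 * ramp_const \<mu>) * ((a + d) / (1 + a)) powr (1/8)
      = B * min 1 (a / d) powr (1/4) * (a + d) powr (-7/8)"
    proof -
      have "(a + d) powr (1/8) / (a + d) = (a + d) powr (1/8) * (a + d) powr (-1)"
        using a d by (simp add: powr_minus_divide)
      also have "\<dots> = (a + d) powr (-7/8)"
        by (rule trans[OF powr_add[symmetric]]) simp
      finally have e: "(a + d) powr (1/8) / (a + d) = (a + d) powr (-7/8)" .
      have "A * (16 * ramp_const \<mu>) * ((a + d) / (1 + a)) powr (1/8)
        = B * min 1 (a / d) powr (1/4) * ((a + d) powr (1/8) / (a + d))"
        using a d by (simp add: A_def B_def powr_divide powr_minus_divide mult.commute[of "a + d"])
      then show ?thesis by (simp only: e)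
    qed
    also have "ennreal \<dots> \<le> ennreal (B * min 1 (a / d) powr (1/4) * d powr (-7/8))"
      using a d B by (intro ennreal_leI mult_left_mono powr_mono2') auto
    also have "\<dots> = ennreal B * (indicator {0<..} d * ennreal (d powr (-7/8) * min 1 (a / d) powr (1/4)))"
      using d B by (simp add: ac_simps flip: ennreal_mult)
    finally show ?thesis .
  next
    case False
    then have "H (b, d + a - b, d) = 0" for b
      using coll_weight_eq_0[of b _ d] by (auto simp: H_def)
    then show ?thesis by simp
  qed
  have "(\<integral>\<^sup>+b. \<integral>\<^sup>+c. H (b, c, b + c - a) \<partial>lborel \<partial>lborel)
    \<le> 2 * (\<integral>\<^sup>+d. \<integral>\<^sup>+b. indicator {..(d + a) / 2} b * H (b, d + a - b, d) \<partial>lborel \<partial>lborel)"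
    by (rule fibre_integral_symmetric_le) (simp_all add: H_def coll_weight_sym mult.commute)
  also have "\<dots> \<le> 2 * (\<integral>\<^sup>+d. ennreal B * (indicator {0<..} d * ennreal (d powr (-7/8)
      * min 1 (a / d) powr (1/4))) \<partial>lborel)"
    by (intro mult_left_mono nn_integral_mono inner) auto
  also have "\<dots> = 2 * (ennreal B * (\<integral>\<^sup>+d. (indicator {0<..} d * ennreal (d powr (-7/8)
      * min 1 (a / d) powr (1/4))) \<partial>lborel))"
    by (subst nn_integral_cmult) simp_all
  also have "\<dots> \<le> 2 * (ennreal B * ennreal (16 * a powr (1/8)))"
    by (intro mult_left_mono nn_integral_scaling_kernel_le a) auto
  also have "\<dots> = ennreal (2 * (B * (16 * a powr (1/8))))"
    using B by (subst ennreal_mult, simp, simp, subst ennreal_mult) auto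
  also have "2 * (B * (16 * a powr (1/8))) = (1024 * ramp_const \<mu> * sqrt a) * (a / (1 + a)) powr (1/8)"
    using a by (simp add: B_def powr_divide powr_minus_divide)
  also have "ennreal \<dots> \<le> ennreal ((1024 * ramp_const \<mu> * sqrt a) * 1)"
    using a by (intro ennreal_leI mult_left_mono powr_quotient_le_one) (auto simp: ramp_const_nonneg)
  finally show "(\<integral>\<^sup>+b. \<integral>\<^sup>+c. coll_weight a b c (b + c - a) * ennreal ((equil \<mu> b * equil \<mu> c)
      * (a / (b + c - a)) powr (1/4)) \<partial>lborel \<partial>lborel)
     \<le> ennreal (1024 * ramp_const \<mu> * sqrt a)"
    by (simp add: H_def)
qed

text \<open>Let \<open>e = \<bar>a - b\<bar>\<close>. The larger of \<open>c\<close> and \<open>d\<close> exceeds the smaller one, \<open>s\<close>, by \<open>e\<close>, so its factor is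
  at most \<open>min 1 (e/s) / e\<close>. The integral over \<open>s\<close> turns the \<open>1/e\<close> into the integrable singularity
  \<open>e\<^sup>-\<^sup>7\<^sup>/\<^sup>8\<close> at \<open>b = a\<close>.\<close>

lemma frequency_bounded_across:
  assumes \<mu>: "\<mu> > 0"
  shows "frequency_bounded (1024 * ramp_const \<mu>) (\<lambda>a b c d. (equil \<mu> c * equil \<mu> d) * (a / b) powr (1/4))"
  unfolding frequency_bounded_def
proof (intro allI impI)
  fix a :: real assume a: "a > 0"
  define B where "B = sqrt a * 32 * ramp_const \<mu> * (1 + a) powr (-1/8)"
  have B: "B \<ge> 0" using a by (simp add: B_def ramp_const_nonneg)
  have inner: "(\<integral>\<^sup>+c. coll_weight a b c (b + c - a) * ennreal ((equil \<mu> c * equil \<mu> (b + c - a))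
      * (a / b) powr (1/4)) \<partial>lborel)
      \<le> ennreal B * (indicator {0<..} b * ennreal (\<bar>b - a\<bar> powr (-7/8)
          * min 1 (a / b) powr (1/4)))" if "b \<noteq> a" for b
  proof (cases "b > 0")
    case b: True
    define e where "e = \<bar>b - a\<bar>"
    have e: "e > 0" using that by (simp add: e_def)
    define A where "A = sqrt a * min 1 (a / b) powr (1/4) / e"
    have A: "A \<ge> 0" using a e by (simp add: A_def)
    define G where "G s = indicator {0<..} s * ennreal (A * (equil \<mu> s * min 1 (s / a) powr (1/8)
        * min 1 (e / s) powr (1/4)))" for s
    have [measurable]: "G \<in> borel_measurable borel" unfolding G_def by measurable
    have pt: "coll_weight a b c d * ennreal ((equil \<mu> s * equil \<mu> (s + e)) * (a / b) powr (1/4)) \<le> G s"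
      if s: "s > 0" "s \<in> {b, c, d}" for s c d
    proof -
      have "equil \<mu> (s + e) \<le> 1 / (s + e)"
        using s e by (intro equil_le_inverse \<mu>) auto
      also have "\<dots> \<le> min 1 (e / s) / e"
        using s e by (auto simp: min_def field_simps)
      also have "\<dots> \<le> min 1 (e / s) powr (1/4) / e"
      proof -
        have "min 1 (e / s) powr 1 \<le> min 1 (e / s) powr (1/4)"
          using s e by (intro powr_mono') auto
        then show ?thesis using e s by (intro divide_right_mono) auto
      qed
      finally have n: "equil \<mu> (s + e) \<le> min 1 (e / s) powr (1/4) / e" .
      have "coll_weight a b c d * ennreal ((equil \<mu> s * equil \<mu> (s + e)) * (a / b) powr (1/4))
        \<le> ennreal (sqrt a * min 1 (s / a) powr (1/8) * min 1 (a / b) powr (1/4) * (equil \<mu> s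
            * equil \<mu> (s + e)))"
        using s e equil_pos[OF \<mu>, of s] equil_pos[OF \<mu>, of "s + e"]
        by (intro coll_weight_le_tilted_ramp a mult_nonneg_nonneg) auto
      also have "\<dots> \<le> ennreal (sqrt a * min 1 (s / a) powr (1/8) * min 1 (a / b) powr (1/4)
          * (equil \<mu> s * (min 1 (e / s) powr (1/4) / e)))"
        using n s a equil_pos[OF \<mu>, of s] by (intro ennreal_leI mult_left_mono) auto
      also have "\<dots> = G s"
        using s by (simp add: G_def A_def ac_simps)
      finally show ?thesis .
    qed
    have "(\<integral>\<^sup>+c. coll_weight a b c (b + c - a) * ennreal ((equil \<mu> c * equil \<mu> (b + c - a))
        * (a / b) powr (1/4)) \<partial>lborel)
      \<le> (\<integral>\<^sup>+c. G c + G ((b - a) + c) \<partial>lborel)"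
    proof (intro nn_integral_mono)
      fix c :: real
      define d where "d = b + c - a"
      have "coll_weight a b c d * ennreal ((equil \<mu> c * equil \<mu> d) * (a / b) powr (1/4)) \<le> G c + G d"
      proof (cases "0 < c \<and> 0 < d")
        case True
        show ?thesis
        proof (cases "c \<le> d")
          case le: True
          then have "d = c + e" by (simp add: d_def e_def)
          then show ?thesis using pt[of c c d] True by (simp add: add_increasing2)
        next
          case False
          then have "c = d + e" by (simp add: d_def e_def)
          then have "coll_weight a b c d * ennreal ((equil \<mu> c * equil \<mu> d) * (a / b) powr (1/4)) \<le> G d"
            using pt[of d c d] True by (simp only: mult.commute[of "equil \<mu> d"]) simp
          then show ?thesis by (simp add: add_increasing)
        qed
      next
        case False
        then have "coll_weight a b c d = 0" by (intro coll_weight_eq_0) auto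
        then show ?thesis by simp
      qed
      then show "coll_weight a b c (b + c - a) * ennreal ((equil \<mu> c * equil \<mu> (b + c - a))
          * (a / b) powr (1/4)) \<le> G c + G ((b - a) + c)"
        by (simp add: d_def algebra_simps)
    qed
    also have "\<dots> = (\<integral>\<^sup>+c. G c \<partial>lborel) + (\<integral>\<^sup>+c. G c \<partial>lborel)"
      using nn_integral_lborel_shift[of G "b - a"] by (simp add: nn_integral_add)
    also have "\<dots> \<le> ennreal (A * (16 * ramp_const \<mu>) * (e / (1 + a)) powr (1/8)) + ennreal (A * (16
        * ramp_const \<mu>) * (e / (1 + a)) powr (1/8))"
      by (intro add_mono nn_integral_equil_kernel_le \<mu> a e A) (auto simp: G_def)
    also have "\<dots> = ennreal (A * (32 * ramp_const \<mu>) * (e / (1 + a)) powr (1/8))"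
      using A by (subst ennreal_plus[symmetric]) (auto simp: ramp_const_nonneg)
    also have "A * (32 * ramp_const \<mu>) * (e / (1 + a)) powr (1/8) = B * (e powr (-7/8)
        * min 1 (a / b) powr (1/4))"
    proof -
      have "e powr (1/8) / e = e powr (1/8) * e powr (-1)"
        using e by (simp add: powr_minus_divide)
      also have "\<dots> = e powr (-7/8)"
        by (rule trans[OF powr_add[symmetric]]) simp
      finally have q: "e powr (1/8) / e = e powr (-7/8)" .
      have "A * (32 * ramp_const \<mu>) * (e / (1 + a)) powr (1/8) = B * ((e powr (1/8) / e)
          * min 1 (a / b) powr (1/4))"
        using a e by (simp add: A_def B_def powr_divide powr_minus_divide mult.commute[of e])
      then show ?thesis by (simp only: q)
    qed
    also have "ennreal \<dots> = ennreal B * (indicator {0<..} b * ennreal (\<bar>b - a\<bar> powr (-7/8)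
        * min 1 (a / b) powr (1/4)))"
      using b B by (simp add: e_def flip: ennreal_mult)
    finally show ?thesis .
  next
    case False
    then have "coll_weight a b c d = 0" for c d by (intro coll_weight_eq_0) auto
    then show ?thesis by simp
  qed
  have "(\<integral>\<^sup>+b. \<integral>\<^sup>+c. coll_weight a b c (b + c - a) * ennreal ((equil \<mu> c * equil \<mu> (b + c - a))
      * (a / b) powr (1/4)) \<partial>lborel \<partial>lborel)
    \<le> (\<integral>\<^sup>+b. ennreal B * (indicator {0<..} b * ennreal (\<bar>b - a\<bar> powr (-7/8)
        * min 1 (a / b) powr (1/4))) \<partial>lborel)"
    using AE_lborel_singleton[of a] by (intro nn_integral_mono_AE, elim eventually_mono) (rule inner)
  also have "\<dots> = ennreal B * (\<integral>\<^sup>+b. (indicator {0<..} b * ennreal (\<bar>b - a\<bar> powr (-7/8)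
      * min 1 (a / b) powr (1/4))) \<partial>lborel)"
    by (subst nn_integral_cmult) simp_all
  also have "\<dots> \<le> ennreal B * ennreal (32 * a powr (1/8))"
    by (intro mult_left_mono nn_integral_shifted_kernel_le a) auto
  also have "\<dots> = ennreal (B * (32 * a powr (1/8)))"
    using B by (simp add: ennreal_mult)
  also have "B * (32 * a powr (1/8)) = (1024 * ramp_const \<mu> * sqrt a) * (a / (1 + a)) powr (1/8)"
    using a by (simp add: B_def powr_divide powr_minus_divide)
  also have "ennreal \<dots> \<le> ennreal ((1024 * ramp_const \<mu> * sqrt a) * 1)"
    using a by (intro ennreal_leI mult_left_mono powr_quotient_le_one) (auto simp: ramp_const_nonneg)
  finally show "(\<integral>\<^sup>+b. \<integral>\<^sup>+c. coll_weight a b c (b + c - a) * ennreal ((equil \<mu> c * equil \<mu> (b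
      + c - a)) * (a / b) powr (1/4)) \<partial>lborel \<partial>lborel)
     \<le> ennreal (1024 * ramp_const \<mu> * sqrt a)"
    by simp
qed

definition loss_const :: "real \<Rightarrow> real" where
  "loss_const \<mu> = 1024 * (ramp_const \<mu>)\<^sup>2 * ((1 + \<mu>) * (1 + 1 / (2 * \<mu>)))"

text \<open>The multiplication part of \<open>L\<close>. With \<open>b \<le> c\<close> the quotient \<open>n(c) / n(a)\<close> is at most a constant times
  \<open>(1+a) / (1+a+d)\<close>, which beats the growth of the integral over \<open>b\<close> and gives decay in \<open>d\<close>.\<close>

lemma frequency_bounded_loss:
  assumes \<mu>: "\<mu> > 0"
  shows "frequency_bounded (loss_const \<mu>) (\<lambda>a b c d. equil \<mu> b * equil \<mu> c * equil \<mu> d / equil \<mu> a)"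
  unfolding frequency_bounded_def
proof (intro allI impI)
  fix a :: real assume a: "a > 0"
  define H where "H = (\<lambda>(b, c, d). coll_weight a b c d * ennreal (equil \<mu> b * equil \<mu> c
      * equil \<mu> d / equil \<mu> a))"
  have [measurable]: "H \<in> borel_measurable (borel \<Otimes>\<^sub>M borel \<Otimes>\<^sub>M borel)"
    unfolding H_def by measurable
  (* With this constant (a + \<mu>) / (a + d + 2 \<mu>) is at most M (1 + a) / (1 + a + d), also for small a. *)
  define M where "M = (1 + \<mu>) * (1 + 1 / (2 * \<mu>))"
  have M: "M \<ge> 0" using \<mu> by (simp add: M_def)
  define B where "B = sqrt a * (2 * M) * (16 * ramp_const \<mu>)"
  have B: "B \<ge> 0" using a M by (simp add: B_def ramp_const_nonneg)
  have inner: "(\<integral>\<^sup>+b. indicator {..(d + a) / 2} b * H (b, d + a - b, d) \<partial>lborel)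
      \<le> ennreal (B * (equil \<mu> d * min 1 (d / a) powr (1/8) * min 1 ((1
          + a) / d) powr (1/4)))" if d: "d > 0" for d
  proof -
    define y where "y = (1 + a) / (1 + a + d)"
    have y: "0 < y" "y \<le> 1" "y \<le> min 1 ((1 + a) / d)"
      using a d by (auto simp: y_def intro!: divide_left_mono)
    define A where "A = sqrt a * (equil \<mu> d * min 1 (d / a) powr (1/8)) * (2 * (M * y))"
    have A: "A \<ge> 0" using a d M y equil_pos[OF \<mu>, of d] by (simp add: A_def)
    have "(\<integral>\<^sup>+b. indicator {..(d + a) / 2} b * H (b, d + a - b, d) \<partial>lborel)
      \<le> ennreal (A * (16 * ramp_const \<mu>) * ((a + d) / (1 + a)) powr (1/8))"
    proof (rule nn_integral_equil_mass_le[OF \<mu> a _ A])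
      fix b :: real
      show "indicator {..(d + a) / 2} b * H (b, d + a - b, d) \<le> ennreal (A * (equil \<mu> b
          * min 1 (b / a) powr (1/8)))"
        if b: "0 < b" "b \<le> a + d"
      proof (cases "b \<le> (d + a) / 2")
        case True
        then have c: "(a + d) / 2 \<le> d + a - b" by (simp add: field_simps)
        have "equil \<mu> (d + a - b) / equil \<mu> a = (a + \<mu>) / (d + a - b + \<mu>)"
          using a \<mu> by (simp add: equil_def)
        also have "\<dots> \<le> (a + \<mu>) / ((a + d + 2 * \<mu>) / 2)"
          using c a d \<mu> by (intro divide_left_mono) auto
        also have "\<dots> = 2 * ((a + \<mu>) / (a + d + 2 * \<mu>))" by simp
        also have "\<dots> \<le> 2 * (M * y)"
        proof (intro mult_left_mono)
          have "(a + \<mu>) * (1 + a + d) \<le> ((1 + \<mu>) * (1 + a)) * ((1 + 1 / (2 * \<mu>)) * (a + d + 2 * \<mu>))"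
          proof (intro mult_mono)
            show "1 + a + d \<le> (1 + 1 / (2 * \<mu>)) * (a + d + 2 * \<mu>)"
              using a d \<mu> by (simp add: field_simps)
          qed (use a d \<mu> in \<open>auto simp: algebra_simps\<close>)
          then have "(a + \<mu>) * (1 + a + d) \<le> M * (1 + a) * (a + d + 2 * \<mu>)"
            by (simp only: M_def ac_simps)
          then show "(a + \<mu>) / (a + d + 2 * \<mu>) \<le> M * y"
            using a d \<mu> by (simp add: y_def field_simps)
        qed simp
        finally have n: "equil \<mu> (d + a - b) / equil \<mu> a \<le> 2 * (M * y)" .
        have R: "0 \<le> equil \<mu> b * equil \<mu> (d + a - b) * equil \<mu> d / equil \<mu> a"
          using equil_pos[OF \<mu>, of b] equil_pos[OF \<mu>, of "d
              + a - b"] equil_pos[OF \<mu>, of d] equil_pos[OF \<mu>, of a] b c d a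
          by simp
        have "H (b, d + a - b, d) \<le> ennreal (sqrt a * min 1 (b / a) powr (1/8)
            * min 1 (d / a) powr (1/8) * (equil \<mu> b * equil \<mu> (d + a - b) * equil \<mu> d / equil \<mu> a))"
          unfolding H_def prod.case by (intro coll_weight_le_ramp R a) auto
        also have "equil \<mu> b * equil \<mu> (d + a - b) * equil \<mu> d / equil \<mu> a = equil \<mu> b * equil \<mu> d
            * (equil \<mu> (d + a - b) / equil \<mu> a)"
          by simp
        also have "ennreal (sqrt a * min 1 (b / a) powr (1/8) * min 1 (d / a) powr (1/8)
            * (equil \<mu> b * equil \<mu> d * (equil \<mu> (d + a - b) / equil \<mu> a)))
          \<le> ennreal (sqrt a * min 1 (b / a) powr (1/8) * min 1 (d / a) powr (1/8) * (equil \<mu> b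
              * equil \<mu> d * (2 * (M * y))))"
          using n equil_pos[OF \<mu>, of b] equil_pos[OF \<mu>, of d] b d a by (intro ennreal_leI
              mult_left_mono) auto
        also have "\<dots> = ennreal (A * (equil \<mu> b * min 1 (b / a) powr (1/8)))"
          by (simp only: A_def ac_simps)
        finally show ?thesis using True by simp
      qed simp
      show "indicator {..(d + a) / 2} b * H (b, d + a - b, d) = 0" if "b \<le> 0 \<or> a + d < b"
        using that coll_weight_eq_0[of b "d + a - b" d] by (auto simp: H_def)
    qed (use a d in simp)
    also have "\<dots> \<le> ennreal (B * (equil \<mu> d * min 1 (d / a) powr (1/8) * min 1 ((1 + a) / d) powr (1/4)))"
    proof (rule ennreal_leI)
      have "((a + d) / (1 + a)) powr (1/8) \<le> (1 / y) powr (1/8)"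
        using a d by (intro powr_mono2) (auto simp: y_def divide_right_mono)
      then have "y * ((a + d) / (1 + a)) powr (1/8) \<le> y powr 1 * (1 / y) powr (1/8)"
        using y by (simp add: mult_left_mono)
      also have "\<dots> = y powr 1 * y powr (-1/8)"
        using y by (simp add: powr_divide powr_minus_divide)
      also have "\<dots> = y powr (7/8)"
        by (rule trans[OF powr_add[symmetric]]) simp
      also have "\<dots> \<le> y powr (1/4)"
        using y by (intro powr_mono') auto
      also have "\<dots> \<le> min 1 ((1 + a) / d) powr (1/4)"
        using y by (intro powr_mono2) auto
      finally have "(B * (equil \<mu> d * min 1 (d / a) powr (1/8))) * (y * ((a + d) / (1 + a)) powr (1/8))
        \<le> (B * (equil \<mu> d * min 1 (d / a) powr (1/8))) * min 1 ((1 + a) / d) powr (1/4)"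
        using B d equil_pos[OF \<mu>, of d] by (intro mult_left_mono) auto
      moreover have "(B * (equil \<mu> d * min 1 (d / a) powr (1/8))) * (y * ((a + d) / (1 + a)) powr (1/8))
        = A * (16 * ramp_const \<mu>) * ((a + d) / (1 + a)) powr (1/8)"
        by (simp only: A_def B_def ac_simps)
      ultimately show "A * (16 * ramp_const \<mu>) * ((a + d) / (1 + a)) powr (1/8)
        \<le> B * (equil \<mu> d * min 1 (d / a) powr (1/8) * min 1 ((1 + a) / d) powr (1/4))"
        by (simp only: mult.assoc)
    qed
    finally show ?thesis .
  qed
  have "(\<integral>\<^sup>+b. \<integral>\<^sup>+c. H (b, c, b + c - a) \<partial>lborel \<partial>lborel)
    \<le> 2 * (\<integral>\<^sup>+d. \<integral>\<^sup>+b. indicator {..(d + a) / 2} b * H (b, d + a - b, d) \<partial>lborel \<partial>lborel)"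
    by (rule fibre_integral_symmetric_le) (simp_all add: H_def coll_weight_sym mult.commute)
  also have "\<dots> \<le> 2 * ennreal (B * (16 * ramp_const \<mu>) * ((1 + a) / (1 + a)) powr (1/8))"
  proof (intro mult_left_mono nn_integral_equil_kernel_le[OF \<mu> a _ B])
    fix d :: real assume "d \<le> 0"
    then have "H (b, d + a - b, d) = 0" for b
      using coll_weight_eq_0[of b _ d] by (auto simp: H_def)
    then show "(\<integral>\<^sup>+b. indicator {..(d + a) / 2} b * H (b, d + a - b, d) \<partial>lborel) = 0"
      by simp
  qed (use a inner in auto)
  also have "\<dots> = ennreal (2 * (B * (16 * ramp_const \<mu>)))"
    using a B by (subst ennreal_mult) (auto simp: ramp_const_nonneg)
  also have "2 * (B * (16 * ramp_const \<mu>)) = loss_const \<mu> * sqrt a"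
    by (simp add: B_def loss_const_def M_def power2_eq_square)
  finally show "(\<integral>\<^sup>+b. \<integral>\<^sup>+c. coll_weight a b c (b + c - a) * ennreal (equil \<mu> b * equil \<mu> c
      * equil \<mu> (b + c - a) / equil \<mu> a) \<partial>lborel \<partial>lborel)
     \<le> ennreal (loss_const \<mu> * sqrt a)"
    by (simp add: H_def)
qed

section \<open>Multilinear bounds on the collision measure\<close>

lemma weighted_Cauchy_Schwarz:
  assumes [measurable]: "u \<in> borel_measurable borel" "h \<in> borel_measurable borel"
    and u: "l2_square u \<le> ennreal (U\<^sup>2)" "U \<ge> 0" and h: "l2_square h \<le> ennreal (H\<^sup>2)" "H \<ge> 0"
  shows "(\<integral>\<^sup>+a. ennreal (\<bar>u a\<bar> * \<bar>h a\<bar>) \<partial>weight_measure) \<le> ennreal (U * H)"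
proof (rule ennreal_le_of_square_le)
  have sq: "(ennreal \<bar>f a\<bar>)\<^sup>2 = ennreal ((f a)\<^sup>2)" for f :: "real \<Rightarrow> real" and a
    by (simp add: ennreal_power)
  have "(\<integral>\<^sup>+a. ennreal (\<bar>u a\<bar> * \<bar>h a\<bar>) \<partial>weight_measure)\<^sup>2
      = (\<integral>\<^sup>+a. ennreal \<bar>u a\<bar> * ennreal \<bar>h a\<bar> \<partial>weight_measure)\<^sup>2"
    by (simp add: ennreal_mult)
  also have "\<dots> \<le> (\<integral>\<^sup>+a. (ennreal \<bar>u a\<bar>)\<^sup>2 \<partial>weight_measure) * (\<integral>\<^sup>+a. (ennreal \<bar>h a\<bar>)\<^sup>2 \<partial>weight_measure)"
    by (rule Cauchy_Schwarz_nn_integral) simp_all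
  also have "\<dots> = l2_square u * l2_square h"
    by (simp only: sq l2_square_def)
  also have "\<dots> \<le> ennreal (U\<^sup>2) * ennreal (H\<^sup>2)"
    by (intro mult_mono u h) auto
  also have "\<dots> = ennreal ((U * H)\<^sup>2)"
    by (simp only: power_mult_distrib ennreal_mult zero_le_power2)
  finally show "(\<integral>\<^sup>+a. ennreal (\<bar>u a\<bar> * \<bar>h a\<bar>) \<partial>weight_measure)\<^sup>2 \<le> ennreal ((U * H)\<^sup>2)" .
qed (use u h in simp)

text \<open>Fubini: integrate over \<open>\<omega>\<^sub>1\<close> and \<open>\<omega>\<^sub>2\<close> first.\<close>

lemma frequency_form_le:
  assumes R [measurable]: "R \<in> borel_measurable M4" and e [measurable]: "e \<in> borel_measurable borel"
    and A: "A \<ge> 0" and fr: "frequency_bounded A (\<lambda>a b c d. R (a, b, c, d))"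
    and e0: "\<And>a. e a \<ge> 0"
  shows "(\<integral>\<^sup>+p. ennreal (R p) * ennreal (e (fst p)) \<partial>coll_measure)
    \<le> ennreal A * (\<integral>\<^sup>+a. ennreal (e a) \<partial>weight_measure)"
proof -
  have "(\<integral>\<^sup>+p. ennreal (R p) * ennreal (e (fst p)) \<partial>coll_measure)
    = (\<integral>\<^sup>+a. \<integral>\<^sup>+b. \<integral>\<^sup>+c. coll_weight a b c (b + c - a) * ennreal (R (a, b, c, b + c - a))
        * ennreal (e a) \<partial>lborel \<partial>lborel \<partial>lborel)"
    by (subst nn_integral_coll_measure) (simp_all add: mult.assoc)
  also have "\<dots> \<le> (\<integral>\<^sup>+a. ennreal A * (indicator {0<..} a * ennreal (sqrt a) * ennreal (e a)) \<partial>lborel)"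
  proof (rule nn_integral_mono)
    fix a :: real
    have "(\<integral>\<^sup>+b. \<integral>\<^sup>+c. coll_weight a b c (b + c - a) * ennreal (R (a, b, c, b + c - a))
        * ennreal (e a) \<partial>lborel \<partial>lborel)
      = (\<integral>\<^sup>+b. \<integral>\<^sup>+c. coll_weight a b c (b + c - a) * ennreal (R (a, b, c, b
          + c - a)) \<partial>lborel \<partial>lborel) * ennreal (e a)"
      by (simp add: nn_integral_multc)
    also have "\<dots> \<le> ennreal A * (indicator {0<..} a * ennreal (sqrt a) * ennreal (e a))"
    proof (cases "a > 0")
      case True
      have "(\<integral>\<^sup>+b. \<integral>\<^sup>+c. coll_weight a b c (b + c - a) * ennreal (R (a, b, c, b
          + c - a)) \<partial>lborel \<partial>lborel) * ennreal (e a)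
        \<le> ennreal (A * sqrt a) * ennreal (e a)"
        using fr True unfolding frequency_bounded_def by (intro mult_right_mono) auto
      then show ?thesis using True A by (simp add: ennreal_mult mult.assoc)
    next
      case False
      then have "coll_weight a b c d = 0" for b c d by (auto simp: coll_weight_def)
      then show ?thesis by simp
    qed
    finally show "(\<integral>\<^sup>+b. \<integral>\<^sup>+c. coll_weight a b c (b + c - a) * ennreal (R (a, b, c, b + c - a))
        * ennreal (e a) \<partial>lborel \<partial>lborel)
      \<le> ennreal A * (indicator {0<..} a * ennreal (sqrt a) * ennreal (e a))" .
  qed
  also have "\<dots> = ennreal A * (\<integral>\<^sup>+a. (indicator {0<..} a * ennreal (sqrt a) * ennreal (e a)) \<partial>lborel)"
    by (rule nn_integral_cmult) measurable
  also have "(\<integral>\<^sup>+a. (indicator {0<..} a * ennreal (sqrt a) * ennreal (e a)) \<partial>lborel)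
      = (\<integral>\<^sup>+a. ennreal (e a) \<partial>weight_measure)"
    by (subst nn_integral_weight_measure) simp_all
  finally show ?thesis .
qed

text \<open>\<open>\<Psi>\<close> is an integrand whose pairing with functions of \<open>\<omega>\<^sub>0\<close> is bounded by \<open>K\<close> in norm. By duality this
  is what makes a collision integral with integrand \<open>\<Psi>\<close> square integrable.\<close>

definition coll_bounded :: "real \<Rightarrow> (real \<times> real \<times> real \<times> real \<Rightarrow> real) \<Rightarrow> bool" where
  "coll_bounded K \<Psi> \<longleftrightarrow> \<Psi> \<in> borel_measurable M4 \<and>
     (\<forall>h H. h \<in> borel_measurable borel \<longrightarrow> l2_square h \<le> ennreal (H\<^sup>2) \<longrightarrow> H \<ge> 0 \<longrightarrow>
       (\<integral>\<^sup>+p. ennreal (\<Psi> p) * ennreal \<bar>h (fst p)\<bar> \<partial>coll_measure) \<le> ennreal (K * H))"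

lemma ennreal_add_le: "ennreal (x + y) \<le> ennreal x + ennreal y"
proof (cases "x \<ge> 0 \<and> y \<ge> 0")
  case True
  then show ?thesis by simp
next
  case False
  then consider "x \<le> 0" | "y \<le> 0" by linarith
  then show ?thesis
    by cases (auto intro!: ennreal_leI order_trans[OF ennreal_leI[of "x
        + y" y]] order_trans[OF ennreal_leI[of "x + y" x]] simp: ennreal_neg)
qed

lemma coll_bounded_add:
  assumes "coll_bounded K \<Psi>" "coll_bounded L \<Theta>" "K \<ge> 0" "L \<ge> 0"
  shows "coll_bounded (K + L) (\<lambda>p. \<Psi> p + \<Theta> p)"
  unfolding coll_bounded_def
proof (intro conjI allI impI)
  have [measurable]: "\<Psi> \<in> borel_measurable M4" "\<Theta> \<in> borel_measurable M4"
    using assms by (auto simp: coll_bounded_def)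
  show "(\<lambda>p. \<Psi> p + \<Theta> p) \<in> borel_measurable M4" by measurable
  fix h H assume h [measurable]: "h \<in> borel_measurable borel" and H: "l2_square h \<le> ennreal (H\<^sup>2)" "H \<ge> 0"
  have "(\<integral>\<^sup>+p. ennreal (\<Psi> p + \<Theta> p) * ennreal \<bar>h (fst p)\<bar> \<partial>coll_measure)
    \<le> (\<integral>\<^sup>+p. ennreal (\<Psi> p) * ennreal \<bar>h (fst p)\<bar> + ennreal (\<Theta> p) * ennreal \<bar>h (fst p)\<bar> \<partial>coll_measure)"
    by (intro nn_integral_mono) (auto simp: ennreal_add_le mult_right_mono simp flip: distrib_right)
  also have "\<dots> = (\<integral>\<^sup>+p. ennreal (\<Psi> p) * ennreal \<bar>h (fst p)\<bar> \<partial>coll_measure) + (\<integral>\<^sup>+p. ennreal (\<Theta> p)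
      * ennreal \<bar>h (fst p)\<bar> \<partial>coll_measure)"
    by (rule nn_integral_add) measurable
  also have "\<dots> \<le> ennreal (K * H) + ennreal (L * H)"
    using assms h H by (intro add_mono) (auto simp: coll_bounded_def)
  also have "\<dots> = ennreal ((K + L) * H)"
    using assms H by (simp add: distrib_right flip: ennreal_plus)
  finally show "(\<integral>\<^sup>+p. ennreal (\<Psi> p + \<Theta> p) * ennreal \<bar>h (fst p)\<bar> \<partial>coll_measure) \<le> ennreal ((K + L) * H)" .
qed

lemma coll_bounded_mono:
  assumes "coll_bounded K \<Psi>" and "\<Theta> \<in> borel_measurable M4"
    and le: "\<And>a b c d. 0 < a \<Longrightarrow> 0 < b \<Longrightarrow> 0 < c \<Longrightarrow> 0 < d \<Longrightarrow> a + d = b + c \<Longrightarrow> \<Theta> (a, b, c, d) \<le> \<Psi> (a, b, c, d)"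
    and "K \<le> L"
  shows "coll_bounded L \<Theta>"
  unfolding coll_bounded_def
proof (intro conjI allI impI)
  fix h H assume h: "h \<in> borel_measurable borel" "l2_square h \<le> ennreal (H\<^sup>2)" and H: "(H::real) \<ge> 0"
  have "(\<integral>\<^sup>+p. ennreal (\<Theta> p) * ennreal \<bar>h (fst p)\<bar> \<partial>coll_measure)
    \<le> (\<integral>\<^sup>+p. ennreal (\<Psi> p) * ennreal \<bar>h (fst p)\<bar> \<partial>coll_measure)"
    using AE_coll_measure
    by (intro nn_integral_mono_AE, elim eventually_mono) (auto intro!: mult_right_mono ennreal_leI le)
  also have "\<dots> \<le> ennreal (K * H)"
    using assms(1) h H by (simp add: coll_bounded_def)
  also have "\<dots> \<le> ennreal (L * H)"
    using \<open>K \<le> L\<close> H by (intro ennreal_leI mult_right_mono)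
  finally show "(\<integral>\<^sup>+p. ennreal (\<Theta> p) * ennreal \<bar>h (fst p)\<bar> \<partial>coll_measure) \<le> ennreal (L * H)" .
qed fact

lemma coll_bounded_swap12:
  assumes "coll_bounded K \<Psi>"
  shows "coll_bounded K (\<lambda>(a, b, c, d). \<Psi> (a, c, b, d))"
  unfolding coll_bounded_def
proof (intro conjI allI impI)
  have [measurable]: "\<Psi> \<in> borel_measurable M4"
    using assms by (simp add: coll_bounded_def)
  show "(\<lambda>(a, b, c, d). \<Psi> (a, c, b, d)) \<in> borel_measurable M4"
    by measurable
  fix h H assume h [measurable]: "h \<in> borel_measurable borel" and H: "l2_square h
      \<le> ennreal (H\<^sup>2)" "(H::real) \<ge> 0"
  have "(\<integral>\<^sup>+p. ennreal ((\<lambda>(a, b, c, d). \<Psi> (a, c, b, d)) p) * ennreal \<bar>h (fst p)\<bar> \<partial>coll_measure)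
      = (\<integral>\<^sup>+p. ennreal (\<Psi> p) * ennreal \<bar>h (fst p)\<bar> \<partial>coll_measure)"
    using nn_integral_coll_swap12[of "\<lambda>p. ennreal (\<Psi> p) * ennreal \<bar>h (fst p)\<bar>"]
    by (simp add: case_prod_beta')
  also have "\<dots> \<le> ennreal (K * H)"
    using assms h H by (simp add: coll_bounded_def)
  finally show "(\<integral>\<^sup>+p. ennreal ((\<lambda>(a, b, c, d). \<Psi> (a, c, b, d)) p)
      * ennreal \<bar>h (fst p)\<bar> \<partial>coll_measure) \<le> ennreal (K * H)" .
qed

lemma coll_bounded_diagonal:
  assumes R [measurable]: "R \<in> borel_measurable M4" and [measurable]: "u \<in> borel_measurable borel"
    and u: "l2_square u \<le> ennreal (U\<^sup>2)" "U \<ge> 0" and A: "A \<ge> 0"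
    and fr: "frequency_bounded A (\<lambda>a b c d. R (a, b, c, d))"
  shows "coll_bounded (A * U) (\<lambda>p. R p * \<bar>u (fst p)\<bar>)"
  unfolding coll_bounded_def
proof (intro conjI allI impI)
  show "(\<lambda>p. R p * \<bar>u (fst p)\<bar>) \<in> borel_measurable M4" by measurable
  fix h H assume h [measurable]: "h \<in> borel_measurable borel" and H: "l2_square h
      \<le> ennreal (H\<^sup>2)" "(H::real) \<ge> 0"
  have "(\<integral>\<^sup>+p. ennreal (R p * \<bar>u (fst p)\<bar>) * ennreal \<bar>h (fst p)\<bar> \<partial>coll_measure)
    = (\<integral>\<^sup>+p. ennreal (R p) * ennreal (\<bar>u (fst p)\<bar> * \<bar>h (fst p)\<bar>) \<partial>coll_measure)"
    by (intro nn_integral_cong) (simp add: ennreal_mult ennreal_mult'' mult.assoc)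
  also have "\<dots> \<le> ennreal A * (\<integral>\<^sup>+a. ennreal (\<bar>u a\<bar> * \<bar>h a\<bar>) \<partial>weight_measure)"
    using frequency_form_le[OF R _ A fr, of "\<lambda>a. \<bar>u a\<bar> * \<bar>h a\<bar>"] by simp
  also have "\<dots> \<le> ennreal A * ennreal (U * H)"
    by (intro mult_left_mono weighted_Cauchy_Schwarz u H) auto
  also have "\<dots> = ennreal (A * U * H)"
    using A u H by (simp add: ennreal_mult mult.assoc)
  finally show "(\<integral>\<^sup>+p. ennreal (R p * \<bar>u (fst p)\<bar>) * ennreal \<bar>h (fst p)\<bar> \<partial>coll_measure) \<le> ennreal (A
      * U * H)" .
qed

text \<open>Schur's test on the collision measure. The map \<open>\<sigma>\<close> is a symmetry that exchanges \<open>\<omega>\<^sub>0\<close> with the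
  frequency \<open>l\<close> at which \<open>u\<close> is evaluated. Cauchy-Schwarz with the weight \<open>(\<omega>\<^sub>0/l)\<^sup>1\<^sup>/\<^sup>4\<close> leaves two
  diagonal forms, one in \<open>h(\<omega>\<^sub>0)\<close> and one in \<open>u(l)\<close>; \<open>\<sigma>\<close> carries the second into a form at \<open>\<omega>\<^sub>0\<close>.\<close>

lemma coll_bounded_Schur:
  assumes R [measurable]: "R \<in> borel_measurable M4" and [measurable]: "u \<in> borel_measurable borel"
    and u: "l2_square u \<le> ennreal (U\<^sup>2)" "U \<ge> 0" and A: "A \<ge> 0"
    and l [measurable]: "l \<in> borel_measurable M4" and \<sigma> [measurable]: "\<sigma> \<in> measurable M4 M4"
    and inv: "\<And>F. F \<in> borel_measurable M4 \<Longrightarrow> (\<integral>\<^sup>+p. F (\<sigma> p) \<partial>coll_measure) = (\<integral>\<^sup>+p. F p \<partial>coll_measure)"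
    and swap: "\<And>p. l (\<sigma> p) = fst p" "\<And>p. fst (\<sigma> p) = l p"
    and pos: "\<And>a b c d. 0 < a \<Longrightarrow> 0 < b \<Longrightarrow> 0 < c \<Longrightarrow> 0 < d \<Longrightarrow> l (a, b, c, d) > 0 \<and> R (a, b, c, d) \<ge> 0"
    and fr: "frequency_bounded A (\<lambda>a b c d. R (a, b, c, d) * (a / l (a, b, c, d)) powr (1/4))"
    and dual: "frequency_bounded A (\<lambda>a b c d. R (\<sigma> (a, b, c, d)) * (a / l (a, b, c, d)) powr (1/4))"
  shows "coll_bounded (A * U) (\<lambda>p. R p * \<bar>u (l p)\<bar>)"
  unfolding coll_bounded_def
proof (intro conjI allI impI)
  show "(\<lambda>p. R p * \<bar>u (l p)\<bar>) \<in> borel_measurable M4" by measurable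
  fix h H assume h [measurable]: "h \<in> borel_measurable borel" and H: "l2_square h
      \<le> ennreal (H\<^sup>2)" "(H::real) \<ge> 0"
  have tilt: "(x / y) powr (1/8) * (y / x) powr (1/8) = 1" "((x / y) powr (1/8))\<^sup>2 = (x / y) powr (1/4)"
    if "x > 0" "y > 0" for x y :: real
    using that by (simp_all add: powr_divide power2_eq_square flip: powr_add)
  define f where "f p = ennreal (sqrt (R p) * \<bar>h (fst p)\<bar> * (fst p / l p) powr (1/8))" for p
  define g where "g p = ennreal (sqrt (R p) * \<bar>u (l p)\<bar> * (l p / fst p) powr (1/8))" for p
  have [measurable]: "f \<in> borel_measurable M4" "g \<in> borel_measurable M4"
    unfolding f_def[abs_def] g_def[abs_def] by measurable
  define e where "e v a = (v a)\<^sup>2" for v :: "real \<Rightarrow> real" and a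
  have pt: "ennreal (R p * \<bar>u (l p)\<bar>) * ennreal \<bar>h (fst p)\<bar> = f p * g p
      \<and> (f p)\<^sup>2 = ennreal (R p * (fst p / l p) powr (1/4)) * ennreal (e h (fst p))
      \<and> (g p)\<^sup>2 = ennreal (R p * (l p / fst p) powr (1/4)) * ennreal (e u (l p))"
    if p: "case p of (a, b, c, d) \<Rightarrow> 0 < a \<and> 0 < b \<and> 0 < c \<and> 0 < d \<and> a + d = b + c" for p
  proof -
    obtain a b c d where p': "p = (a, b, c, d)" by (cases p)
    have q: "fst p > 0" "l p > 0" "R p \<ge> 0" using p pos[of a b c d] by (auto simp: p')
    note t = tilt(1)[OF q(1,2)] tilt(2)[OF q(1,2)] tilt(2)[OF q(2,1)]
    have "R p * \<bar>u (l p)\<bar> * \<bar>h (fst p)\<bar>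
      = (sqrt (R p) * sqrt (R p)) * \<bar>u (l p)\<bar> * \<bar>h (fst p)\<bar> * ((fst p / l p) powr (1/8)
          * (l p / fst p) powr (1/8))"
      using q t by simp
    also have "\<dots> = (sqrt (R p) * \<bar>h (fst p)\<bar> * (fst p / l p) powr (1/8)) * (sqrt (R p) * \<bar>u (l p)\<bar>
        * (l p / fst p) powr (1/8))"
      by (simp only: ac_simps)
    finally show ?thesis
      using q t by (simp add: f_def g_def e_def ennreal_power power_mult_distrib ac_simps flip:
          ennreal_mult)
  qed
  have ae: "AE p in coll_measure. ennreal (R p * \<bar>u (l p)\<bar>) * ennreal \<bar>h (fst p)\<bar> = f p * g p
      \<and> (f p)\<^sup>2 = ennreal (R p * (fst p / l p) powr (1/4)) * ennreal (e h (fst p))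
      \<and> (g p)\<^sup>2 = ennreal (R p * (l p / fst p) powr (1/4)) * ennreal (e u (l p))"
    using AE_coll_measure by (elim eventually_mono) (rule pt)
  have "(\<integral>\<^sup>+p. ennreal (R p * \<bar>u (l p)\<bar>) * ennreal \<bar>h (fst p)\<bar> \<partial>coll_measure) = (\<integral>\<^sup>+p. f p
      * g p \<partial>coll_measure)"
    using ae by (intro nn_integral_cong_AE) (auto elim: eventually_mono)
  then have "(\<integral>\<^sup>+p. ennreal (R p * \<bar>u (l p)\<bar>) * ennreal \<bar>h (fst p)\<bar> \<partial>coll_measure)\<^sup>2
    \<le> (\<integral>\<^sup>+p. (f p)\<^sup>2 \<partial>coll_measure) * (\<integral>\<^sup>+p. (g p)\<^sup>2 \<partial>coll_measure)"
    using Cauchy_Schwarz_nn_integral[of f coll_measure g] by simp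
  also have "\<dots> \<le> (ennreal A * ennreal (H\<^sup>2)) * (ennreal A * ennreal (U\<^sup>2))"
  proof (intro mult_mono)
    have "(\<integral>\<^sup>+p. (f p)\<^sup>2 \<partial>coll_measure) = (\<integral>\<^sup>+p. ennreal (R p * (fst p / l p) powr (1/4))
        * ennreal (e h (fst p)) \<partial>coll_measure)"
      using ae by (intro nn_integral_cong_AE) (auto elim: eventually_mono)
    also have "\<dots> \<le> ennreal A * (\<integral>\<^sup>+a. ennreal (e h a) \<partial>weight_measure)"
      using fr by (intro frequency_form_le A) (auto simp: e_def[abs_def])
    also have "\<dots> \<le> ennreal A * ennreal (H\<^sup>2)"
      using H(1) by (intro mult_left_mono) (auto simp: e_def l2_square_def)
    finally show "(\<integral>\<^sup>+p. (f p)\<^sup>2 \<partial>coll_measure) \<le> ennreal A * ennreal (H\<^sup>2)" .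
    have "(\<integral>\<^sup>+p. (g p)\<^sup>2 \<partial>coll_measure) = (\<integral>\<^sup>+p. ennreal (R p * (l p / fst p) powr (1/4))
        * ennreal (e u (l p)) \<partial>coll_measure)"
      using ae by (intro nn_integral_cong_AE) (auto elim: eventually_mono)
    also have "\<dots> = (\<integral>\<^sup>+p. ennreal (R (\<sigma> p) * (fst p / l p) powr (1/4))
        * ennreal (e u (fst p)) \<partial>coll_measure)"
      by (subst inv[symmetric]) (simp_all add: swap e_def[abs_def])
    also have "\<dots> \<le> ennreal A * (\<integral>\<^sup>+a. ennreal (e u a) \<partial>weight_measure)"
      using dual by (intro frequency_form_le A) (auto simp: e_def[abs_def])
    also have "\<dots> \<le> ennreal A * ennreal (U\<^sup>2)"
      using u(1) by (intro mult_left_mono) (auto simp: e_def l2_square_def)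
    finally show "(\<integral>\<^sup>+p. (g p)\<^sup>2 \<partial>coll_measure) \<le> ennreal A * ennreal (U\<^sup>2)" .
  qed auto
  also have "\<dots> = ennreal ((A * U * H)\<^sup>2)"
    using A by (simp add: power_mult_distrib power2_eq_square[of A] ac_simps flip: ennreal_mult)
  finally show "(\<integral>\<^sup>+p. ennreal (R p * \<bar>u (l p)\<bar>) * ennreal \<bar>h (fst p)\<bar> \<partial>coll_measure) \<le> ennreal (A * U * H)"
    by (rule ennreal_le_of_square_le) (use A u H in simp)
qed

context
  fixes u :: "real \<Rightarrow> real" and U A :: real and R :: "real \<times> real \<times> real \<times> real \<Rightarrow> real"
  assumes R [measurable]: "R \<in> borel_measurable M4" and u_meas [measurable]: "u \<in> borel_measurable borel"
    and u: "l2_square u \<le> ennreal (U\<^sup>2)" "U \<ge> 0" and A: "A \<ge> 0"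
    and pos: "\<And>a b c d. 0 < a \<Longrightarrow> 0 < b \<Longrightarrow> 0 < c \<Longrightarrow> 0 < d \<Longrightarrow> R (a, b, c, d) \<ge> 0"
begin

lemma coll_bounded_Schur03:
  assumes "frequency_bounded A (\<lambda>a b c d. R (a, b, c, d) * (a / d) powr (1/4))"
    and "frequency_bounded A (\<lambda>a b c d. R (d, b, c, a) * (a / d) powr (1/4))"
  shows "coll_bounded (A * U) (\<lambda>(a, b, c, d). R (a, b, c, d) * \<bar>u d\<bar>)"
proof -
  have "coll_bounded (A * U) (\<lambda>p. R p * \<bar>u (case p of (a, b, c, d) \<Rightarrow> d)\<bar>)"
  proof (rule coll_bounded_Schur[OF R u_meas u A, where \<sigma> = "\<lambda>(a, b, c, d). (d, b, c, a)"])
    fix F :: "real \<times> real \<times> real \<times> real \<Rightarrow> ennreal" assume [measurable]: "F \<in> borel_measurable M4"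
    show "(\<integral>\<^sup>+p. F (case p of (a, b, c, d) \<Rightarrow> (d, b, c, a)) \<partial>coll_measure) = (\<integral>\<^sup>+p. F p \<partial>coll_measure)"
      using nn_integral_coll_swap03[of F] by (simp add: case_prod_beta')
  qed (use assms pos in \<open>simp_all split: prod.split\<close>)
  then show ?thesis by (simp add: case_prod_beta')
qed

lemma coll_bounded_Schur01:
  assumes "frequency_bounded A (\<lambda>a b c d. R (a, b, c, d) * (a / b) powr (1/4))"
    and "frequency_bounded A (\<lambda>a b c d. R (b, a, d, c) * (a / b) powr (1/4))"
  shows "coll_bounded (A * U) (\<lambda>(a, b, c, d). R (a, b, c, d) * \<bar>u b\<bar>)"
proof -
  have "coll_bounded (A * U) (\<lambda>p. R p * \<bar>u (case p of (a, b, c, d) \<Rightarrow> b)\<bar>)"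
  proof (rule coll_bounded_Schur[OF R u_meas u A, where \<sigma> = "\<lambda>(a, b, c, d). (b, a, d, c)"])
    fix F :: "real \<times> real \<times> real \<times> real \<Rightarrow> ennreal" assume [measurable]: "F \<in> borel_measurable M4"
    show "(\<integral>\<^sup>+p. F (case p of (a, b, c, d) \<Rightarrow> (b, a, d, c)) \<partial>coll_measure) = (\<integral>\<^sup>+p. F p \<partial>coll_measure)"
      using nn_integral_coll_swap_sides[of F] by (simp add: case_prod_beta')
  qed (use assms pos in \<open>simp_all split: prod.split\<close>)
  then show ?thesis by (simp add: case_prod_beta')
qed

lemma coll_bounded_Schur02:
  assumes "frequency_bounded A (\<lambda>a b c d. R (a, b, c, d) * (a / c) powr (1/4))"
    and "frequency_bounded A (\<lambda>a b c d. R (c, d, a, b) * (a / c) powr (1/4))"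
  shows "coll_bounded (A * U) (\<lambda>(a, b, c, d). R (a, b, c, d) * \<bar>u c\<bar>)"
proof -
  have "coll_bounded (A * U) (\<lambda>p. R p * \<bar>u (case p of (a, b, c, d) \<Rightarrow> c)\<bar>)"
  proof (rule coll_bounded_Schur[OF R u_meas u A, where \<sigma> = "\<lambda>(a, b, c, d). (c, d, a, b)"])
    fix F :: "real \<times> real \<times> real \<times> real \<Rightarrow> ennreal" assume [measurable]: "F \<in> borel_measurable M4"
    show "(\<integral>\<^sup>+p. F (case p of (a, b, c, d) \<Rightarrow> (c, d, a, b)) \<partial>coll_measure) = (\<integral>\<^sup>+p. F p \<partial>coll_measure)"
      using nn_integral_coll_swap12[of "\<lambda>(a, b, c, d). F (b, d, a, c)"]
        nn_integral_coll_swap_sides[of "\<lambda>(a, b, c, d). F (a, c, b, d)"] nn_integral_coll_swap12[of F]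
      by (simp add: case_prod_beta')
  qed (use assms pos in \<open>simp_all split: prod.split\<close>)
  then show ?thesis by (simp add: case_prod_beta')
qed

end

text \<open>The majorants bound \<open>n\<^sub>1 n\<^sub>2 n\<^sub>3\<close> times the brackets of \<open>L\<close>, \<open>\<Gamma>\<close> and \<open>Q\<close>, with one argument for each
  factor so that differences can be estimated. In the quadratic one the difference \<open>n\<^sub>2 - n\<^sub>3\<close> is
  kept only where \<open>u\<close> sits at \<open>\<omega>\<^sub>0\<close>; in the other terms the triangle inequality loses nothing
  essential.\<close>

definition linear_majorant :: "real \<Rightarrow> (real \<Rightarrow> real) \<Rightarrow> real \<times> real \<times> real \<times> real \<Rightarrow> real" where
  "linear_majorant \<mu> u = (\<lambda>(a, b, c, d).
     equil \<mu> b * equil \<mu> c * equil \<mu> d / equil \<mu> a * \<bar>u a\<bar> + equil \<mu> b * equil \<mu> c * \<bar>u d\<bar>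
     + equil \<mu> c * equil \<mu> d * \<bar>u b\<bar> + equil \<mu> b * equil \<mu> d * \<bar>u c\<bar>)"

definition quadratic_majorant :: "real \<Rightarrow> (real \<Rightarrow> real) \<Rightarrow> (real \<Rightarrow> real) \<Rightarrow> real \<times> real \<times> real \<times> real \<Rightarrow>
    real" where
  "quadratic_majorant \<mu> u v = (\<lambda>(a, b, c, d).
     equil \<mu> d * (equil \<mu> b + equil \<mu> c) * (\<bar>u a\<bar> * \<bar>v d\<bar>)
     + equil \<mu> b * \<bar>equil \<mu> c - equil \<mu> d\<bar> * (\<bar>u a\<bar> * \<bar>v b\<bar>)
     + equil \<mu> c * \<bar>equil \<mu> b - equil \<mu> d\<bar> * (\<bar>u a\<bar> * \<bar>v c\<bar>)
     + equil \<mu> c * (equil \<mu> d + equil \<mu> b) * (\<bar>u d\<bar> * \<bar>v b\<bar>)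
     + equil \<mu> b * (equil \<mu> d + equil \<mu> c) * (\<bar>u d\<bar> * \<bar>v c\<bar>)
     + equil \<mu> d * (equil \<mu> b + equil \<mu> c) * (\<bar>u b\<bar> * \<bar>v c\<bar>))"

definition cubic_majorant :: "real \<Rightarrow> (real \<Rightarrow> real) \<Rightarrow> (real \<Rightarrow> real) \<Rightarrow> (real \<Rightarrow> real) \<Rightarrow> real \<times> real \<times>
    real \<times> real \<Rightarrow> real" where
  "cubic_majorant \<mu> u v w = (\<lambda>(a, b, c, d).
     equil \<mu> b * equil \<mu> c * (\<bar>u a\<bar> * \<bar>v b\<bar> * \<bar>w c\<bar>)
     + equil \<mu> d * (equil \<mu> b + equil \<mu> c) * (\<bar>u b\<bar> * \<bar>v c\<bar> * \<bar>w d\<bar>)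
     + equil \<mu> c * equil \<mu> d * (\<bar>u a\<bar> * \<bar>v c\<bar> * \<bar>w d\<bar>)
     + equil \<mu> b * equil \<mu> d * (\<bar>u a\<bar> * \<bar>v b\<bar> * \<bar>w d\<bar>))"

definition linear_const :: "real \<Rightarrow> real" where
  "linear_const \<mu> = loss_const \<mu> + 3 * (1024 * ramp_const \<mu>)"

definition quadratic_const :: "real \<Rightarrow> real" where
  "quadratic_const \<mu> = 10 * pair_const \<mu>"

definition cubic_const :: "real \<Rightarrow> real" where
  "cubic_const \<mu> = 5 * (4 * (1 + 1 / \<mu>))\<^sup>2"

context
  fixes \<mu> :: real
  assumes \<mu>: "\<mu> > 0"
begin

lemma equil_nonneg: "s > 0 \<Longrightarrow> equil \<mu> s \<ge> 0"
  using equil_pos[OF \<mu>, of s] by simp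

lemma pair_const_nonneg: "pair_const \<mu> \<ge> 0"
  using \<mu> by (simp add: pair_const_def slice_const_def ramp_const_def)

lemma loss_const_nonneg: "loss_const \<mu> \<ge> 0"
  using \<mu> by (simp add: loss_const_def)

lemma linear_const_nonneg: "linear_const \<mu> \<ge> 0"
  using loss_const_nonneg by (simp add: linear_const_def ramp_const_nonneg)

lemma coll_bounded_linear:
  assumes [measurable]: "u \<in> borel_measurable borel" and u: "l2_square u \<le> ennreal (U\<^sup>2)" "U \<ge> 0"
  shows "coll_bounded (linear_const \<mu> * U) (linear_majorant \<mu> u)"
proof -
  note C = loss_const_nonneg ramp_const_nonneg
  have t0: "coll_bounded (loss_const \<mu> * U) (\<lambda>p. (\<lambda>(a, b, c, d). equil \<mu> b * equil \<mu> c
      * equil \<mu> d / equil \<mu> a) p * \<bar>u (fst p)\<bar>)"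
    using frequency_bounded_loss[OF \<mu>] by (intro coll_bounded_diagonal u) (simp_all add: C)
  have t1: "coll_bounded (1024 * ramp_const \<mu> * U) (\<lambda>(a, b, c, d). (\<lambda>(a, b, c, d). equil \<mu> b
      * equil \<mu> c) (a, b, c, d) * \<bar>u d\<bar>)"
    using frequency_bounded_within[OF \<mu>] by (intro coll_bounded_Schur03 u) (simp_all add: C equil_nonneg)
  have t2: "coll_bounded (1024 * ramp_const \<mu> * U) (\<lambda>(a, b, c, d). (\<lambda>(a, b, c, d). equil \<mu> c
      * equil \<mu> d) (a, b, c, d) * \<bar>u b\<bar>)"
    using frequency_bounded_across[OF \<mu>] by (intro coll_bounded_Schur01 u) (simp_all add: C
        equil_nonneg mult.commute[of "equil \<mu> _" "equil \<mu> _"])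
  note t3 = coll_bounded_swap12[OF t2]
  have "coll_bounded (loss_const \<mu> * U + 1024 * ramp_const \<mu> * U + 1024 * ramp_const \<mu> * U + 1024
      * ramp_const \<mu> * U) (linear_majorant \<mu> u)"
    by (rule coll_bounded_mono[OF coll_bounded_add[OF coll_bounded_add[OF coll_bounded_add[OF t0 t1]
        t2] t3]])
       (use u in \<open>simp_all add: C linear_majorant_def\<close>)
  then show ?thesis by (simp add: linear_const_def algebra_simps)
qed

lemma quadratic_const_nonneg: "quadratic_const \<mu> \<ge> 0"
  using pair_const_nonneg by (simp add: quadratic_const_def)

text \<open>Each term has one factor that is integrated against an equilibrium weight and two that are paired
  with each other or with \<open>h(\<omega>\<^sub>0)\<close>; the terms that are missing below arise by exchanging \<open>\<omega>\<^sub>1\<close> and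
  \<open>\<omega>\<^sub>2\<close>.\<close>

lemma coll_bounded_quadratic:
  assumes u_meas [measurable]: "u \<in> borel_measurable borel" and v_meas [measurable]: "v
      \<in> borel_measurable borel"
    and u: "l2_square u \<le> ennreal (U\<^sup>2)" "U \<ge> 0" and v: "l2_square v \<le> ennreal (V\<^sup>2)" "V \<ge> 0"
  shows "coll_bounded (quadratic_const \<mu> * (U * V)) (quadratic_majorant \<mu> u v)"
proof -
  define P where "P = pair_const \<mu>"
  have P: "P \<ge> 0" using pair_const_nonneg by (simp add: P_def)
  note fr_u = frequency_bounded_untilted[OF \<mu> u_meas u, folded P_def]
      frequency_bounded_difference[OF \<mu> u_meas u, folded P_def]
    frequency_bounded_opposite[OF \<mu> u_meas u, folded P_def] frequency_bounded_opposite_dual[OF \<mu>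
        u_meas u, folded P_def]
    frequency_bounded_same_side[OF \<mu> u_meas u, folded P_def]
  note fr_v = frequency_bounded_untilted[OF \<mu> v_meas v, folded P_def]
      frequency_bounded_difference[OF \<mu> v_meas v, folded P_def]
    frequency_bounded_opposite[OF \<mu> v_meas v, folded P_def] frequency_bounded_opposite_dual[OF \<mu>
        v_meas v, folded P_def]
    frequency_bounded_same_side[OF \<mu> v_meas v, folded P_def]
  have ac: "x * (y * z) * t = x * t * (y * z)" for x y z t :: real by simp
  have t1: "coll_bounded (P * V * U) (\<lambda>p. (\<lambda>(a, b, c, d). equil \<mu> b * (equil \<mu> d * \<bar>v d\<bar>)) p * \<bar>u (fst p)\<bar>)"
    using fr_v by (intro coll_bounded_diagonal u) (simp_all add: P v)
  have t2: "coll_bounded (P * V * U) (\<lambda>p. (\<lambda>(a, b, c, d). \<bar>equil \<mu> c - equil \<mu> d\<bar> * (equil \<mu> b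
      * \<bar>v b\<bar>)) p * \<bar>u (fst p)\<bar>)"
    using fr_v by (intro coll_bounded_diagonal u) (simp_all add: P v)
  have t4: "coll_bounded (P * U * V) (\<lambda>(a, b, c, d). (\<lambda>(a, b, c, d). equil \<mu> c * (equil \<mu> d
      * \<bar>u d\<bar>)) (a, b, c, d) * \<bar>v b\<bar>)"
    using fr_u by (intro coll_bounded_Schur01 v) (simp_all add: P u equil_nonneg ac)
  have t4b: "coll_bounded (P * V * U) (\<lambda>(a, b, c, d). (\<lambda>(a, b, c, d). equil \<mu> c * (equil \<mu> b
      * \<bar>v b\<bar>)) (a, b, c, d) * \<bar>u d\<bar>)"
    using fr_v by (intro coll_bounded_Schur03 u) (simp_all add: P v equil_nonneg ac)
  have t6: "coll_bounded (P * U * V) (\<lambda>(a, b, c, d). (\<lambda>(a, b, c, d). equil \<mu> d * (equil \<mu> c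
      * \<bar>u c\<bar>)) (a, b, c, d) * \<bar>v b\<bar>)"
    using fr_u by (intro coll_bounded_Schur01 v) (simp_all add: P u equil_nonneg ac)
  have t6b: "coll_bounded (P * V * U) (\<lambda>(a, b, c, d). (\<lambda>(a, b, c, d). equil \<mu> d * (equil \<mu> c
      * \<bar>v c\<bar>)) (a, b, c, d) * \<bar>u b\<bar>)"
    using fr_v by (intro coll_bounded_Schur01 u) (simp_all add: P v equil_nonneg ac)
  note s = coll_bounded_swap12[OF t1] coll_bounded_swap12[OF t2] coll_bounded_swap12[OF t4]
    coll_bounded_swap12[OF t4b] coll_bounded_swap12[OF t6]
  note sums = coll_bounded_add[OF t1 coll_bounded_add[OF t2 coll_bounded_add[OF t4 coll_bounded_add[OF t4b
    coll_bounded_add[OF t6b coll_bounded_add[OF s(1) coll_bounded_add[OF s(2) coll_bounded_add[OF s(3)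
    coll_bounded_add[OF s(4) s(5)]]]]]]]]]
  have [measurable]: "quadratic_majorant \<mu> u v \<in> borel_measurable M4"
    unfolding quadratic_majorant_def by measurable
  show ?thesis
    by (rule coll_bounded_mono[OF sums])
       (use P u v in \<open>simp_all add: quadratic_majorant_def quadratic_const_def P_def algebra_simps\<close>)
qed

lemma cubic_const_nonneg: "cubic_const \<mu> \<ge> 0"
  by (simp add: cubic_const_def)

text \<open>Two factors absorb the equilibrium weights and the third one is paired with \<open>h(\<omega>\<^sub>0)\<close>.\<close>

lemma coll_bounded_cubic:
  assumes u_meas [measurable]: "u \<in> borel_measurable borel" and v_meas [measurable]: "v
      \<in> borel_measurable borel"
    and w_meas [measurable]: "w \<in> borel_measurable borel"
    and u: "l2_square u \<le> ennreal (U\<^sup>2)" "U \<ge> 0" and v: "l2_square v \<le> ennreal (V\<^sup>2)" "V \<ge> 0"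
    and w: "l2_square w \<le> ennreal (W\<^sup>2)" "W \<ge> 0"
  shows "coll_bounded (cubic_const \<mu> * (U * V * W)) (cubic_majorant \<mu> u v w)"
proof -
  define P where "P = (4 * (1 + 1 / \<mu>))\<^sup>2"
  have P: "P \<ge> 0" by (simp add: P_def)
  have ac: "x * \<bar>y\<bar> * (z * \<bar>t\<bar>) = z * \<bar>t\<bar> * (x * \<bar>y\<bar>)" for x y z t :: real by simp
  have t1: "coll_bounded (P * (V * W) * U) (\<lambda>p. (\<lambda>(a, b, c, d). (equil \<mu> b * \<bar>v b\<bar>) * (equil \<mu> c
      * \<bar>w c\<bar>)) p * \<bar>u (fst p)\<bar>)"
    using frequency_bounded_product_bc[OF \<mu> v_meas w_meas v w, folded P_def]
    by (intro coll_bounded_diagonal u) (simp_all add: P v w)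
  have t3: "coll_bounded (P * (V * W) * U) (\<lambda>p. (\<lambda>(a, b, c, d). (equil \<mu> c * \<bar>v c\<bar>) * (equil \<mu> d
      * \<bar>w d\<bar>)) p * \<bar>u (fst p)\<bar>)"
    using frequency_bounded_product_cd[OF \<mu> v_meas w_meas v w, folded P_def]
    by (intro coll_bounded_diagonal u) (simp_all add: P v w)
  have t2: "coll_bounded (P * (U * W) * V) (\<lambda>(a, b, c, d). (\<lambda>(a, b, c, d). (equil \<mu> b * \<bar>u b\<bar>)
      * (equil \<mu> d * \<bar>w d\<bar>)) (a, b, c, d) * \<bar>v c\<bar>)"
    using frequency_bounded_product_bd_tilted[OF \<mu> u_meas w_meas u w, folded P_def]
      frequency_bounded_product_bd_tilted[OF \<mu> w_meas u_meas w u, folded P_def]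
    by (intro coll_bounded_Schur02 v)
       (simp_all add: P u w equil_nonneg ac[of "equil \<mu> _" "w _"] mult.commute[of U W])
  have t2b: "coll_bounded (P * (V * W) * U) (\<lambda>(a, b, c, d). (\<lambda>(a, b, c, d). (equil \<mu> b * \<bar>v b\<bar>)
      * (equil \<mu> d * \<bar>w d\<bar>)) (a, b, c, d) * \<bar>u c\<bar>)"
    using frequency_bounded_product_bd_tilted[OF \<mu> v_meas w_meas v w, folded P_def]
      frequency_bounded_product_bd_tilted[OF \<mu> w_meas v_meas w v, folded P_def]
    by (intro coll_bounded_Schur02 u)
       (simp_all add: P v w equil_nonneg ac[of "equil \<mu> _" "w _"] mult.commute[of V W])
  note sums = coll_bounded_add[OF t1 coll_bounded_add[OF t3 coll_bounded_add[OF t2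
    coll_bounded_add[OF coll_bounded_swap12[OF t2b] coll_bounded_swap12[OF t3]]]]]
  have [measurable]: "cubic_majorant \<mu> u v w \<in> borel_measurable M4"
    unfolding cubic_majorant_def by measurable
  show ?thesis
    by (rule coll_bounded_mono[OF sums])
       (use P u v w in \<open>simp_all add: cubic_majorant_def cubic_const_def P_def algebra_simps\<close>)
qed

end

section \<open>From integrands to operators\<close>

definition coll_weight_real :: "real \<Rightarrow> real \<Rightarrow> real \<Rightarrow> real \<Rightarrow> real" where
  "coll_weight_real a b c d =
     (if 0 < a \<and> 0 < b \<and> 0 < c \<and> 0 < d then sqrt (min (min a b) (min c d)) else 0)"

lemma coll_weight_eq_ennreal: "coll_weight a b c d = ennreal (coll_weight_real a b c d)"
  by (simp add: coll_weight_def coll_weight_real_def)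

lemma coll_weight_real_nonneg: "coll_weight_real a b c d \<ge> 0"
  by (simp add: coll_weight_real_def)

lemma measurable_coll_weight_real [measurable (raw)]:
  assumes [measurable]: "f \<in> borel_measurable M" "g \<in> borel_measurable M" "h
      \<in> borel_measurable M" "k \<in> borel_measurable M"
  shows "(\<lambda>x. coll_weight_real (f x) (g x) (h x) (k x)) \<in> borel_measurable M"
  unfolding coll_weight_real_def by measurable

text \<open>The collision integral with integrand \<open>\<Omega> \<Phi>\<close>, written over the whole plane: the weight vanishes
  outside the domain of integration.\<close>

definition coll_op :: "(real \<times> real \<times> real \<times> real \<Rightarrow> real) \<Rightarrow> real \<Rightarrow> real" where
  "coll_op \<Phi> a =
     (LINT q|lborel. coll_weight_real a (fst q) (snd q) (fst q + snd q - a)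
         * \<Phi> (a, fst q, snd q, fst q + snd q - a)) / sqrt a"

definition with_equilibria :: "real \<Rightarrow> (real \<times> real \<times> real \<times> real \<Rightarrow> real) \<Rightarrow> real \<times> real \<times> real \<times> real
    \<Rightarrow> real" where
  "with_equilibria \<mu> F = (\<lambda>(a, b, c, d). equil \<mu> b * equil \<mu> c * equil \<mu> d * F (a, b, c, d))"

text \<open>On the boundary of the domain one of the four frequencies is zero and so is the minimum; hence the
  strict inequalities in the weight make no difference.\<close>

lemma coll_integral_eq_coll_op:
  assumes "a > 0"
  shows "coll_integral \<mu> a (\<lambda>b c d. F (a, b, c, d)) = coll_op (with_equilibria \<mu> F) a"
proof -
  have "coll_integral \<mu> a (\<lambda>b c d. F (a, b, c, d))
    = (LINT q|lborel. (coll_weight_real a (fst q) (snd q) (fst q + snd q - a)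
        * with_equilibria \<mu> F (a, fst q, snd q, fst q + snd q - a)) / sqrt a)"
    unfolding coll_integral_def set_lebesgue_integral_def
  proof (rule Bochner_Integration.integral_cong[OF refl])
    fix q :: "real \<times> real"
    obtain b c where q: "q = (b, c)" by (cases q)
    have w: "(if 0 \<le> b \<and> 0 \<le> c \<and> a \<le> b + c then Min {sqrt a, sqrt b, sqrt c, sqrt (b + c - a)} else 0)
        = coll_weight_real a b c (b + c - a)"
    proof (cases "0 \<le> b \<and> 0 \<le> c \<and> a \<le> b + c")
      case True
      have "sqrt (min (min a b) (min c (b + c - a))) = min (min (sqrt a) (sqrt b)) (min (sqrt c)
          (sqrt (b + c - a)))"
        by (simp add: min_def)
      moreover have "coll_weight_real a b c (b + c - a) = sqrt (min (min a b) (min c (b + c - a)))"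
        using True assms by (auto simp: coll_weight_real_def min_def)
      ultimately show ?thesis using True by (simp add: min.assoc)
    qed (auto simp: coll_weight_real_def)
    show "indicat_real (coll_dom a) q *\<^sub>R
         (case q of (b, c) \<Rightarrow> let d = b + c - a; \<Omega> = Min {sqrt a, sqrt b, sqrt c, sqrt d} / sqrt a
            in \<Omega> * equil \<mu> b * equil \<mu> c * equil \<mu> d * F (a, b, c, d))
       = (coll_weight_real a (fst q) (snd q) (fst q + snd q - a)
           * with_equilibria \<mu> F (a, fst q, snd q, fst q + snd q - a)) / sqrt a"
      unfolding q prod.case fst_conv snd_conv w[symmetric] with_equilibria_def Let_def
      by (simp add: coll_dom_def indicator_def)
  qed
  then show ?thesis by (simp add: coll_op_def)
qed

lemma borel_measurable_borel_lborel_pair: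
  "borel_measurable (borel \<Otimes>\<^sub>M (lborel :: (real \<times> real) measure))
     = (borel_measurable (borel \<Otimes>\<^sub>M borel \<Otimes>\<^sub>M borel) :: ((real \<times> real \<times> real) \<Rightarrow> real) set)"
proof (rule measurable_cong_sets)
  have "sets (borel \<Otimes>\<^sub>M (lborel :: (real \<times> real) measure))
      = sets ((borel :: real measure) \<Otimes>\<^sub>M (borel :: (real \<times> real) measure))"
    by (rule sets_pair_measure_cong) simp_all
  then show "sets (borel \<Otimes>\<^sub>M (lborel :: (real \<times> real) measure))
      = sets ((borel :: real measure) \<Otimes>\<^sub>M (borel :: real measure) \<Otimes>\<^sub>M (borel :: real measure))"
    by (simp only: borel_prod)
qed simp

lemma borel_measurable_coll_integral:
  assumes [measurable]: "F \<in> borel_measurable M4"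
  shows "(\<lambda>a. coll_integral \<mu> a (\<lambda>b c d. F (a, b, c, d))) \<in> borel_measurable borel"
proof -
  have [measurable]: "Measurable.pred (borel \<Otimes>\<^sub>M borel) (\<lambda>(a, q). q \<in> coll_dom a)"
    unfolding coll_dom_def borel_prod[symmetric] by measurable
  have "(\<lambda>(a, q). indicat_real (coll_dom a) q *\<^sub>R
         (case q of (b, c) \<Rightarrow> Min {sqrt a, sqrt b, sqrt c, sqrt (b + c - a)} / sqrt a
            * equil \<mu> b * equil \<mu> c * equil \<mu> (b + c - a) * F (a, b, c, b + c - a)))
      \<in> borel_measurable (borel \<Otimes>\<^sub>M (borel \<Otimes>\<^sub>M borel))"
    by (simp add: coll_dom_def indicator_def) 
  then show ?thesis
    unfolding coll_integral_def set_lebesgue_integral_def Let_def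
    by (intro lborel.borel_measurable_lebesgue_integral) (simp only: borel_measurable_borel_lborel_pair)
qed

lemma borel_measurable_coll_op:
  assumes [measurable]: "\<Phi> \<in> borel_measurable M4"
  shows "coll_op \<Phi> \<in> borel_measurable borel"
proof -
  have "(\<lambda>(a, q). coll_weight_real a (fst q) (snd q) (fst q + snd q - a) * \<Phi> (a, fst q, snd q, fst q
      + snd q - a))
      \<in> borel_measurable (borel \<Otimes>\<^sub>M (borel \<Otimes>\<^sub>M borel))"
    by measurable
  then have [measurable]: "(\<lambda>a. LINT q|lborel. coll_weight_real a (fst q) (snd q) (fst q
      + snd q - a) * \<Phi> (a, fst q, snd q, fst q + snd q - a))
    \<in> borel_measurable borel"
    by (intro lborel.borel_measurable_lebesgue_integral) (simp only: borel_measurable_borel_lborel_pair)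
  show ?thesis unfolding coll_op_def[abs_def] by measurable
qed

lemma coll_bounded_nn_integral_le:
  assumes "coll_bounded K (\<lambda>p. \<bar>\<Phi> p\<bar>)" and "h \<in> borel_measurable borel"
    and "l2_square h \<le> ennreal (H\<^sup>2)" "H \<ge> 0"
  shows "(\<integral>\<^sup>+p. ennreal \<bar>\<Phi> p * h (fst p)\<bar> \<partial>coll_measure) \<le> ennreal (K * H)"
  using assms by (simp add: coll_bounded_def abs_mult ennreal_mult)

lemma integrable_coll_measure:
  assumes [measurable]: "\<Phi> \<in> borel_measurable M4" and b: "coll_bounded K (\<lambda>p. \<bar>\<Phi> p\<bar>)"
    and h: "square_integrable h"
  shows "integrable coll_measure (\<lambda>p. \<Phi> p * h (fst p))"
proof (rule integrableI_bounded)
  have [measurable]: "h \<in> borel_measurable borel"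
    using h by (simp add: square_integrable_iff_l2_square)
  show "(\<lambda>p. \<Phi> p * h (fst p)) \<in> borel_measurable coll_measure" by measurable
  have "(\<integral>\<^sup>+p. ennreal \<bar>\<Phi> p * h (fst p)\<bar> \<partial>coll_measure) \<le> ennreal (K * norm (abs_L2 h))"
    using l2_square_eq[OF h] by (intro coll_bounded_nn_integral_le b) auto
  then show "(\<integral>\<^sup>+p. ennreal (norm (\<Phi> p * h (fst p))) \<partial>coll_measure) < \<infinity>"
    by (auto intro: order_le_less_trans)
qed

lemma integral_weight_measure:
  fixes f :: "real \<Rightarrow> real"
  assumes [measurable]: "f \<in> borel_measurable borel"
  shows "(LINT a|weight_measure. f a) = (LINT a|lborel. indicator {0<..} a * sqrt a * f a)"
proof -
  have eq: "weight_measure = density lborel (\<lambda>a. ennreal (indicator {0<..} a * sqrt a))"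
    unfolding weight_measure_def by (intro density_cong AE_I2) (auto simp: indicator_def)
  show ?thesis
    unfolding eq by (subst integral_density) (auto intro!: AE_I2 simp: indicator_def)
qed

text \<open>Fubini, which is justified by the absolute bound.\<close>

lemma coll_op_weak_form:
  assumes [measurable]: "\<Phi> \<in> borel_measurable M4" and b: "coll_bounded K (\<lambda>p. \<bar>\<Phi> p\<bar>)"
    and h: "square_integrable h"
  shows "(LINT a|weight_measure. coll_op \<Phi> a * h a) = (LINT p|coll_measure. \<Phi> p * h (fst p))"
proof -
  have [measurable]: "h \<in> borel_measurable borel"
    using h by (simp add: square_integrable_iff_l2_square)
  have [measurable]: "coll_op \<Phi> \<in> borel_measurable borel"
    by (rule borel_measurable_coll_op) measurable
  define G where "G = (\<lambda>(a, q). coll_weight_real a (fst q) (snd q) (fst q + snd q - a)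
      * (\<Phi> (a, fst q, snd q, fst q + snd q - a) * h a))"
  have G [measurable]: "G \<in> borel_measurable (borel \<Otimes>\<^sub>M borel \<Otimes>\<^sub>M borel)"
    unfolding G_def by measurable
  define D where "D = density (lborel \<Otimes>\<^sub>M lborel \<Otimes>\<^sub>M lborel) (\<lambda>q. ennreal (case q of (a, b, c) \<Rightarrow>
      coll_weight_real a b c (b + c - a)))"
  have cm: "coll_measure = distr D M4 (\<lambda>(a, b, c). (a, b, c, b + c - a))"
    by (simp add: coll_measure_def D_def coll_weight_eq_ennreal case_prod_beta')
  have [measurable_cong]: "sets D = sets (borel \<Otimes>\<^sub>M borel \<Otimes>\<^sub>M borel)"
    by (simp add: D_def)
  have eqG: "(case q of (a, b, c) \<Rightarrow> coll_weight_real a b c (b + c - a))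
      * (case q of (a, b, c) \<Rightarrow> \<Phi> (a, b, c, b + c - a) * h a) = G q" for q
    by (auto simp: G_def case_prod_beta')
  have int: "integrable (lborel \<Otimes>\<^sub>M lborel \<Otimes>\<^sub>M lborel) G"
  proof -
    have "integrable (distr D M4 (\<lambda>(a, b, c). (a, b, c, b + c - a))) (\<lambda>p. \<Phi> p * h (fst p))"
      using integrable_coll_measure[OF _ b h] by (simp add: cm)
    then have "integrable D (\<lambda>q. case q of (a, b, c) \<Rightarrow> \<Phi> (a, b, c, b + c - a) * h a)"
      by (subst (asm) integrable_distr_eq) (simp_all add: case_prod_beta')
    then have "integrable (lborel \<Otimes>\<^sub>M lborel \<Otimes>\<^sub>M lborel)
        (\<lambda>q. (case q of (a, b, c) \<Rightarrow> coll_weight_real a b c (b + c - a))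
            * (case q of (a, b, c) \<Rightarrow> \<Phi> (a, b, c, b + c - a) * h a))"
      unfolding D_def using coll_weight_real_nonneg
      by (subst (asm) integrable_density) (auto simp: case_prod_beta' real_scaleR_def)
    then show ?thesis by (simp only: eqG)
  qed
  have "(LINT p|coll_measure. \<Phi> p * h (fst p)) = (LINT q|D. (case q of (a, b, c) \<Rightarrow> \<Phi> (a, b, c, b
      + c - a) * h a))"
    unfolding cm by (subst integral_distr) (simp_all add: case_prod_beta')
  also have "\<dots> = (LINT q|(lborel \<Otimes>\<^sub>M lborel \<Otimes>\<^sub>M lborel). (case q of (a, b, c) \<Rightarrow> coll_weight_real a b
      c (b + c - a)) * (case q of (a, b, c) \<Rightarrow> \<Phi> (a, b, c, b + c - a) * h a))"
    unfolding D_def using coll_weight_real_nonneg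
    by (subst integral_density) (auto simp: case_prod_beta' real_scaleR_def)
  also have "\<dots> = (LINT q|(lborel \<Otimes>\<^sub>M lborel). G q)"
    by (simp only: eqG lborel_prod)
  also have "\<dots> = (LINT a|lborel. LINT q|lborel. G (a, q))"
    using int by (intro lborel_pair.integral_fst'[symmetric]) (simp only: lborel_prod)
  also have "\<dots> = (LINT a|lborel. indicator {0<..} a * sqrt a * (coll_op \<Phi> a * h a))"
  proof (rule Bochner_Integration.integral_cong[OF refl])
    fix a :: real
    have "(LINT q|lborel. G (a, q)) = (LINT q|lborel. coll_weight_real a (fst q) (snd q) (fst q
        + snd q - a) * \<Phi> (a, fst q, snd q, fst q + snd q - a)) * h a"
      by (simp add: G_def mult.assoc[symmetric])
    also have "\<dots> = indicator {0<..} a * sqrt a * (coll_op \<Phi> a * h a)"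
      by (auto simp: coll_op_def indicator_def coll_weight_real_def)
    finally show "(LINT q|lborel. G (a, q)) = indicator {0<..} a * sqrt a * (coll_op \<Phi> a * h a)" .
  qed
  also have "\<dots> = (LINT a|weight_measure. coll_op \<Phi> a * h a)"
    by (rule integral_weight_measure[symmetric]) measurable
  finally show ?thesis by simp
qed

lemma ennreal_abs_integral_le: "ennreal \<bar>LINT x|M. f x\<bar> \<le> (\<integral>\<^sup>+x. ennreal \<bar>f x :: real\<bar> \<partial>M)"
proof (cases "integrable M f")
  case True
  then show ?thesis using integral_norm_bound_ennreal[OF True] by simp
qed (simp add: not_integrable_integral_eq)

lemma coll_op_form_le:
  assumes [measurable]: "\<Phi> \<in> borel_measurable M4" "h \<in> borel_measurable borel"
  shows "(\<integral>\<^sup>+a. ennreal \<bar>coll_op \<Phi> a * h a\<bar> \<partial>weight_measure) \<le> (\<integral>\<^sup>+p. ennreal \<bar>\<Phi> p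
      * h (fst p)\<bar> \<partial>coll_measure)"
proof -
  have [measurable]: "coll_op \<Phi> \<in> borel_measurable borel"
    by (rule borel_measurable_coll_op) measurable
  have "(\<integral>\<^sup>+a. ennreal \<bar>coll_op \<Phi> a * h a\<bar> \<partial>weight_measure)
    = (\<integral>\<^sup>+a. indicator {0<..} a * ennreal (sqrt a) * ennreal \<bar>coll_op \<Phi> a * h a\<bar> \<partial>lborel)"
    by (rule nn_integral_weight_measure) measurable
  also have "\<dots> \<le> (\<integral>\<^sup>+a. \<integral>\<^sup>+b. \<integral>\<^sup>+c. coll_weight a b c (b + c - a) * ennreal \<bar>\<Phi> (a, b, c, b + c - a)
      * h a\<bar> \<partial>lborel \<partial>lborel \<partial>lborel)"
  proof (rule nn_integral_mono)
    fix a :: real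
    define f where "f q = coll_weight_real a (fst q) (snd q) (fst q + snd q - a)
        * \<Phi> (a, fst q, snd q, fst q + snd q - a)" for q
    show "indicator {0<..} a * ennreal (sqrt a) * ennreal \<bar>coll_op \<Phi> a * h a\<bar>
      \<le> (\<integral>\<^sup>+b. \<integral>\<^sup>+c. coll_weight a b c (b + c - a) * ennreal \<bar>\<Phi> (a, b, c, b + c - a)
          * h a\<bar> \<partial>lborel \<partial>lborel)"
    proof (cases "a > 0")
      case True
      have f [measurable]: "f \<in> borel_measurable (borel \<Otimes>\<^sub>M borel)" unfolding f_def[abs_def] by measurable
      have "indicator {0<..} a * ennreal (sqrt a) * ennreal \<bar>coll_op \<Phi> a * h a\<bar>
          = ennreal \<bar>LINT q|lborel. f q * h a\<bar>"
        using True by (simp add: coll_op_def f_def abs_mult flip: ennreal_mult)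
      also have "\<dots> \<le> (\<integral>\<^sup>+q. ennreal \<bar>f q * h a\<bar> \<partial>lborel)"
        by (rule ennreal_abs_integral_le)
      also have "\<dots> = (\<integral>\<^sup>+q. ennreal \<bar>f q * h a\<bar> \<partial>(lborel \<Otimes>\<^sub>M lborel))"
        by (simp only: lborel_prod)
      also have "\<dots> = (\<integral>\<^sup>+b. \<integral>\<^sup>+c. ennreal \<bar>f (b, c) * h a\<bar> \<partial>lborel \<partial>lborel)"
        by (rule lborel.nn_integral_fst[symmetric]) simp
      also have "\<dots> = (\<integral>\<^sup>+b. \<integral>\<^sup>+c. coll_weight a b c (b + c - a) * ennreal \<bar>\<Phi> (a, b, c, b + c - a)
          * h a\<bar> \<partial>lborel \<partial>lborel)"
        by (intro nn_integral_cong)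
           (simp add: f_def coll_weight_eq_ennreal abs_mult coll_weight_real_nonneg ennreal_mult mult.assoc)
      finally show ?thesis .
    qed simp
  qed
  also have "\<dots> = (\<integral>\<^sup>+p. ennreal \<bar>\<Phi> p * h (fst p)\<bar> \<partial>coll_measure)"
    by (subst nn_integral_coll_measure) simp_all
  finally show ?thesis .
qed

text \<open>Test with truncations \<open>h\<^sub>k\<close> of \<open>\<bar>u\<bar>\<close>: from \<open>\<parallel>h\<^sub>k\<parallel>\<^sup>2 \<le> \<integral> \<bar>u\<bar> h\<^sub>k \<le> K \<parallel>h\<^sub>k\<parallel>\<close> their norms are at most
  \<open>K\<close>, and Fatou's lemma removes the truncation.\<close>

lemma l2_square_le_by_duality:
  assumes [measurable]: "u \<in> borel_measurable borel" and K: "K \<ge> 0"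
    and dual: "\<And>h H. h \<in> borel_measurable borel \<Longrightarrow> l2_square h \<le> ennreal (H\<^sup>2) \<Longrightarrow> H \<ge> 0 \<Longrightarrow>
       (\<integral>\<^sup>+a. ennreal \<bar>u a * h a\<bar> \<partial>weight_measure) \<le> ennreal (K * H)"
  shows "l2_square u \<le> ennreal (K\<^sup>2)"
proof -
  (* The truncation also cuts off large frequencies, where constants are not square integrable. *)
  define h where "h k a = min \<bar>u a\<bar> (real k) * indicator {0<..<real k} a" for k a
  have [measurable]: "h k \<in> borel_measurable borel" for k
    unfolding h_def[abs_def] by measurable
  have hk: "l2_square (h k) \<le> ennreal (K\<^sup>2)" for k
  proof -
    have "square_integrable (\<lambda>a. real k * indicator {0..real k} a)"
      by (intro square_integrable_scale square_integrable_indicator[of _ 0 "real k"]) auto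
    then have sq: "square_integrable (h k)"
      by (rule square_integrable_mono[rotated]) (auto intro!: AE_I2 simp: h_def indicator_def)
    define H where "H = norm (abs_L2 (h k))"
    have H: "H \<ge> 0" "l2_square (h k) = ennreal (H\<^sup>2)"
      using l2_square_eq[OF sq] by (auto simp: H_def)
    have "ennreal (H\<^sup>2) \<le> (\<integral>\<^sup>+a. ennreal \<bar>u a * h k a\<bar> \<partial>weight_measure)"
      unfolding H(2)[symmetric] l2_square_def
    proof (intro nn_integral_mono ennreal_leI)
      fix a
      have "0 \<le> h k a" "h k a \<le> \<bar>u a\<bar>" by (auto simp: h_def indicator_def)
      then show "(h k a)\<^sup>2 \<le> \<bar>u a * h k a\<bar>"
        by (simp add: power2_eq_square abs_mult mult_right_mono)
    qed
    also have "\<dots> \<le> ennreal (K * H)" using H by (intro dual) auto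
    finally have "H * H \<le> K * H" using K H by (simp add: power2_eq_square)
    then have "H \<le> K" using H(1) K by (cases "H = 0") (auto simp: mult_le_cancel_right)
    then show ?thesis using H by (auto intro!: ennreal_leI power_mono)
  qed
  have "l2_square u = (\<integral>\<^sup>+a. liminf (\<lambda>k. ennreal ((h k a)\<^sup>2)) \<partial>weight_measure)"
    unfolding l2_square_def
  proof (rule nn_integral_cong_AE)
    have "AE a in weight_measure. a > 0"
      unfolding weight_measure_def by (subst AE_density) (auto simp: indicator_def)
    then show "AE a in weight_measure. ennreal ((u a)\<^sup>2) = liminf (\<lambda>k. ennreal ((h k a)\<^sup>2))"
    proof eventually_elim
      fix a :: real assume a: "a > 0"
      have "\<forall>\<^sub>F k in sequentially. max a \<bar>u a\<bar> < real k"
        using filterlim_real_sequentially unfolding filterlim_at_top_dense by blast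
      then have "\<forall>\<^sub>F k in sequentially. ennreal ((u a)\<^sup>2) = ennreal ((h k a)\<^sup>2)"
        by eventually_elim (use a in \<open>auto simp: h_def\<close>)
      then have "(\<lambda>k. ennreal ((h k a)\<^sup>2)) \<longlonglongrightarrow> ennreal ((u a)\<^sup>2)"
        by (rule Lim_transform_eventually[OF tendsto_const])
      from lim_imp_Liminf[OF sequentially_bot this] show "ennreal ((u a)\<^sup>2)
          = liminf (\<lambda>k. ennreal ((h k a)\<^sup>2))"
        by (rule sym)
    qed
  qed
  also have "\<dots> \<le> liminf (\<lambda>k. \<integral>\<^sup>+a. ennreal ((h k a)\<^sup>2) \<partial>weight_measure)"
    by (rule nn_integral_liminf) measurable
  also have "\<dots> \<le> liminf (\<lambda>k::nat. ennreal (K\<^sup>2))"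
    using hk by (intro Liminf_mono always_eventually allI) (simp add: l2_square_def)
  finally show ?thesis by (simp add: Liminf_const)
qed

lemma square_integrable_coll_op:
  assumes m: "\<Phi> \<in> borel_measurable M4" and b: "coll_bounded K (\<lambda>p. \<bar>\<Phi> p\<bar>)" and K: "K \<ge> 0"
  shows "square_integrable (coll_op \<Phi>)"
proof -
  have "l2_square (coll_op \<Phi>) \<le> ennreal (K\<^sup>2)"
    by (rule l2_square_le_by_duality[OF borel_measurable_coll_op[OF m] K])
       (rule order_trans[OF coll_op_form_le[OF m] coll_bounded_nn_integral_le[OF b]])
  then show ?thesis
    using norm_abs_L2_le[OF borel_measurable_coll_op[OF m] _ K] by blast
qed

lemma inner_coll_op:
  assumes "\<Phi> \<in> borel_measurable M4" "coll_bounded K (\<lambda>p. \<bar>\<Phi> p\<bar>)" "K \<ge> 0" "square_integrable h"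
  shows "abs_L2 (coll_op \<Phi>) \<bullet> abs_L2 h = (LINT p|coll_measure. \<Phi> p * h (fst p))"
  using assms by (simp add: inner_abs_L2 square_integrable_coll_op coll_op_weak_form)

text \<open>Testing the difference of the two functions against itself avoids subtracting the inner integrals
  pointwise.\<close>

lemma norm_coll_op_diff_le:
  assumes m: "\<Phi> \<in> borel_measurable M4" "\<Theta> \<in> borel_measurable M4"
    and b: "coll_bounded K (\<lambda>p. \<bar>\<Phi> p\<bar>)" "coll_bounded K' (\<lambda>p. \<bar>\<Theta> p\<bar>)" "coll_bounded L (\<lambda>p. \<bar>\<Phi> p - \<Theta> p\<bar>)"
    and K: "K \<ge> 0" "K' \<ge> 0" "L \<ge> 0"
  shows "norm (abs_L2 (coll_op \<Phi>) - abs_L2 (coll_op \<Theta>)) \<le> L"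
proof -
  note sq = square_integrable_coll_op[OF m(1) b(1) K(1)] square_integrable_coll_op[OF m(2) b(2) K(2)]
  define h where "h a = coll_op \<Phi> a - coll_op \<Theta> a" for a
  have h: "square_integrable h" "abs_L2 h = abs_L2 (coll_op \<Phi>) - abs_L2 (coll_op \<Theta>)"
    unfolding h_def[abs_def] by (rule square_integrable_diff[OF sq], rule abs_L2_diff[OF sq, symmetric])
  have hm: "h \<in> borel_measurable borel" using h(1) by (simp add: square_integrable_iff_l2_square)
  have int: "integrable coll_measure (\<lambda>p. \<Phi> p * h (fst p))" "integrable coll_measure (\<lambda>p. \<Theta> p * h (fst p))"
    by (rule integrable_coll_measure[OF m(1) b(1) h(1)], rule integrable_coll_measure[OF m(2) b(2) h(1)])
  have "abs_L2 h \<bullet> abs_L2 h = (LINT p|coll_measure. \<Phi> p * h (fst p)) - (LINT p|coll_measure. \<Theta> p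
      * h (fst p))"
    unfolding inner_coll_op[OF m(1) b(1) K(1) h(1), symmetric] inner_coll_op[OF m(2) b(2) K(2) h(1),
        symmetric]
    by (simp only: h(2) inner_diff_left)
  also have "\<dots> = (LINT p|coll_measure. (\<Phi> p - \<Theta> p) * h (fst p))"
    using int by (simp add: left_diff_distrib)
  finally have "ennreal ((norm (abs_L2 h))\<^sup>2) \<le> ennreal \<bar>LINT p|coll_measure. (\<Phi> p - \<Theta> p) * h (fst p)\<bar>"
    by (intro ennreal_leI) (simp add: power2_norm_eq_inner)
  also have "\<dots> \<le> (\<integral>\<^sup>+p. ennreal \<bar>(\<Phi> p - \<Theta> p) * h (fst p)\<bar> \<partial>coll_measure)"
    by (rule ennreal_abs_integral_le)
  also have "\<dots> \<le> ennreal (L * norm (abs_L2 h))"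
    using l2_square_eq[OF h(1)] by (intro coll_bounded_nn_integral_le b hm) auto
  finally have "norm (abs_L2 h) * norm (abs_L2 h) \<le> L * norm (abs_L2 h)"
    using K by (simp add: power2_eq_square)
  then have "norm (abs_L2 h) \<le> L"
    using K by (cases "norm (abs_L2 h) = 0") (auto simp: mult_le_cancel_right)
  then show ?thesis by (simp only: h(2))
qed

text \<open>An integrand \<open>\<Phi> g\<close> that depends on \<open>g\<close> in a locally Lipschitz way, measured by \<open>coll_bounded\<close>: \<open>\<kappa> S\<close>
  is the Lipschitz constant for functions whose absolute values sum to norm \<open>S\<close>. It defines a
  locally Lipschitz operator on the space of classes of functions.\<close>

locale collision_form =
  fixes \<Phi> :: "(real \<Rightarrow> real) \<Rightarrow> real \<times> real \<times> real \<times> real \<Rightarrow> real" and \<kappa> :: "real \<Rightarrow> real"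
  assumes measurable_form: "\<And>g. g \<in> borel_measurable borel \<Longrightarrow> \<Phi> g \<in> borel_measurable M4"
    and form_zero: "\<And>p. \<Phi> (\<lambda>_. 0) p = 0"
    and \<kappa>_nonneg: "\<And>S. S \<ge> 0 \<Longrightarrow> \<kappa> S \<ge> 0" and \<kappa>_mono: "\<And>S T. 0 \<le> S \<Longrightarrow> S \<le> T \<Longrightarrow> \<kappa> S \<le> \<kappa> T"
    and form_diff: "\<And>g h D S. \<lbrakk>g \<in> borel_measurable borel; h \<in> borel_measurable borel; D \<ge> 0; S \<ge> 0;
       l2_square (\<lambda>\<omega>. g \<omega> - h \<omega>) \<le> ennreal (D\<^sup>2); l2_square (\<lambda>\<omega>. \<bar>g \<omega>\<bar> + \<bar>h \<omega>\<bar>) \<le> ennreal (S\<^sup>2)\<rbrakk>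
       \<Longrightarrow> coll_bounded (\<kappa> S * D) (\<lambda>p. \<bar>\<Phi> g p - \<Phi> h p\<bar>)"
begin

lemma square_integrable_abs: "square_integrable g \<Longrightarrow> square_integrable (\<lambda>\<omega>. \<bar>g \<omega>\<bar>)"
  by (rule square_integrable_mono) (auto simp: square_integrable_iff_l2_square)

lemma norm_abs_L2_abs: "square_integrable g \<Longrightarrow> norm (abs_L2 (\<lambda>\<omega>. \<bar>g \<omega>\<bar>)) = norm (abs_L2 g)"
  by (rule power2_eq_imp_eq) (simp_all add: norm_abs_L2 square_integrable_abs)

lemma l2_square_diff_eq:
  assumes "square_integrable g" "square_integrable h"
  shows "l2_square (\<lambda>\<omega>. g \<omega> - h \<omega>) = ennreal ((norm (abs_L2 g - abs_L2 h))\<^sup>2)"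
  by (simp only: l2_square_eq[OF square_integrable_diff[OF assms]] abs_L2_diff[OF assms])

lemma l2_square_abs_sum_le:
  assumes g: "square_integrable g" and h: "square_integrable h"
  shows "l2_square (\<lambda>\<omega>. \<bar>g \<omega>\<bar> + \<bar>h \<omega>\<bar>) \<le> ennreal ((norm (abs_L2 g) + norm (abs_L2 h))\<^sup>2)"
proof -
  note s = square_integrable_abs[OF g] square_integrable_abs[OF h]
  have "norm (abs_L2 (\<lambda>\<omega>. \<bar>g \<omega>\<bar>) + abs_L2 (\<lambda>\<omega>. \<bar>h \<omega>\<bar>)) \<le> norm (abs_L2 g) + norm (abs_L2 h)"
    by (rule norm_triangle_le) (simp only: norm_abs_L2_abs[OF g] norm_abs_L2_abs[OF h])
  then show ?thesis
    unfolding l2_square_eq[OF square_integrable_add[OF s]] abs_L2_add[OF s, symmetric]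
    by (intro ennreal_leI power_mono) auto
qed

lemma form_diff_bounded:
  assumes g: "square_integrable g" and h: "square_integrable h"
  shows "coll_bounded (\<kappa> (norm (abs_L2 g) + norm (abs_L2 h))
      * norm (abs_L2 g - abs_L2 h)) (\<lambda>p. \<bar>\<Phi> g p - \<Phi> h p\<bar>)"
  using g h l2_square_diff_eq[OF g h] l2_square_abs_sum_le[OF g h]
  by (intro form_diff) (auto simp: square_integrable_iff_l2_square)

lemma form_bounded:
  assumes g: "square_integrable g"
  shows "coll_bounded (\<kappa> (norm (abs_L2 g)) * norm (abs_L2 g)) (\<lambda>p. \<bar>\<Phi> g p\<bar>)"
proof -
  have "abs_L2 (\<lambda>_. 0) = 0" by (simp add: zero_L2_def)
  then show ?thesis
    using form_diff_bounded[OF g square_integrable_0] by (simp only: form_zero) simp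
qed

lemma form_bound_nonneg: "\<kappa> (norm x) * norm (y :: L2) \<ge> 0" for x :: L2
  by (intro mult_nonneg_nonneg \<kappa>_nonneg) auto

lemma measurable_form': "square_integrable g \<Longrightarrow> \<Phi> g \<in> borel_measurable M4"
  by (rule measurable_form) (simp add: square_integrable_iff_l2_square)

lemma form_square_integrable: "square_integrable g \<Longrightarrow> square_integrable (coll_op (\<Phi> g))"
  by (rule square_integrable_coll_op[OF measurable_form' form_bounded form_bound_nonneg])

definition op :: "L2 \<Rightarrow> L2" where
  "op x = abs_L2 (coll_op (\<Phi> (rep_L2 x)))"

lemma form_lipschitz:
  assumes g: "square_integrable g" and h: "square_integrable h"
  shows "norm (abs_L2 (coll_op (\<Phi> g)) - abs_L2 (coll_op (\<Phi> h)))
    \<le> \<kappa> (norm (abs_L2 g) + norm (abs_L2 h)) * norm (abs_L2 g - abs_L2 h)"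
  by (rule norm_coll_op_diff_le[OF measurable_form'[OF g] measurable_form'[OF h] form_bounded[OF g]
      form_bounded[OF h]
        form_diff_bounded[OF g h] form_bound_nonneg form_bound_nonneg])
     (intro mult_nonneg_nonneg \<kappa>_nonneg add_nonneg_nonneg norm_ge_zero)

lemma op_abs_L2:
  assumes g: "square_integrable g"
  shows "op (abs_L2 g) = abs_L2 (coll_op (\<Phi> g))"
proof -
  have "norm (op (abs_L2 g) - abs_L2 (coll_op (\<Phi> g))) \<le> 0"
    using form_lipschitz[OF rep_L2_square_integrable g, of "abs_L2 g"]
    unfolding op_def abs_rep_L2 by simp
  then show ?thesis by simp
qed

lemma op_lipschitz: "norm (op x - op y) \<le> \<kappa> (norm x + norm y) * norm (x - y)"
  using form_lipschitz[OF rep_L2_square_integrable rep_L2_square_integrable, of x y]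
  unfolding op_def abs_rep_L2 .

lemma op_zero: "op 0 = 0"
proof -
  have z: "abs_L2 (\<lambda>_. 0) = 0" by (simp add: zero_L2_def)
  have "coll_op (\<Phi> (\<lambda>_. 0)) = (\<lambda>_. 0)"
    by (intro ext) (simp add: coll_op_def form_zero)
  then show ?thesis
    using op_abs_L2[OF square_integrable_0] z by metis
qed

lemma norm_op_le: "norm (op x) \<le> \<kappa> (norm x) * norm x"
  using op_lipschitz[of x 0] by (simp add: op_zero)

lemma op_lipschitz_on_balls:
  "\<exists>K. \<forall>x y. norm x \<le> R \<longrightarrow> norm y \<le> R \<longrightarrow> norm (op x - op y) \<le> K * norm (x - y)"
proof (intro exI[of _ "\<kappa> (2 * R)"] allI impI)
  fix x y :: L2 assume "norm x \<le> R" "norm y \<le> R"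
  then have "\<kappa> (norm x + norm y) * norm (x - y) \<le> \<kappa> (2 * R) * norm (x - y)"
    by (intro mult_right_mono \<kappa>_mono) auto
  then show "norm (op x - op y) \<le> \<kappa> (2 * R) * norm (x - y)"
    using op_lipschitz[of x y] by linarith
qed

lemma continuous_on_op: "continuous_on UNIV op"
proof (rule continuous_at_imp_continuous_on, intro ballI)
  fix x :: L2
  obtain K where K: "\<And>u v. norm u \<le> norm x + 1 \<Longrightarrow> norm v \<le> norm x + 1 \<Longrightarrow> norm (op u - op v) \<le> K
      * norm (u - v)"
    using op_lipschitz_on_balls[of "norm x + 1"] by metis
  have "(op \<longlongrightarrow> op x) (at x)"
  proof (rule LIM_zero_cancel, rule Lim_null_comparison)
    have "\<forall>\<^sub>F y in at x. dist y x < 1"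
      by (simp add: eventually_at) (auto intro: exI[of _ 1])
    then show "\<forall>\<^sub>F y in at x. norm (op y - op x) \<le> K * norm (y - x)"
    proof eventually_elim
      fix y assume "dist y x < 1"
      then have "norm y \<le> norm x + 1"
        using norm_triangle_sub[of y x] by (simp add: dist_norm)
      then show "norm (op y - op x) \<le> K * norm (y - x)" by (intro K) auto
    qed
    show "((\<lambda>y. K * norm (y - x)) \<longlongrightarrow> 0) (at x)"
      by (auto intro!: tendsto_eq_intros)
  qed
  then show "isCont op x" by (simp add: isCont_def)
qed

lemma inner_op:
  assumes "square_integrable g" "square_integrable h"
  shows "op (abs_L2 g) \<bullet> abs_L2 h = (LINT p|coll_measure. \<Phi> g p * h (fst p))"
  unfolding op_abs_L2[OF assms(1)]
  by (rule inner_coll_op[OF measurable_form'[OF assms(1)] form_bounded[OF assms(1)]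
      form_bound_nonneg assms(2)])

lemma integrable_form:
  assumes "square_integrable g" "square_integrable h"
  shows "integrable coll_measure (\<lambda>p. \<Phi> g p * h (fst p))"
  by (rule integrable_coll_measure[OF measurable_form'[OF assms(1)] form_bounded[OF assms(1)] assms(2)])

text \<open>Nonpositive frequencies form a null set, so the class of \<open>F g\<close> is determined by the values at
  \<open>a > 0\<close>, where \<open>F g\<close> is the explicit integral.\<close>

lemma dense_extension_eq_op:
  assumes \<Phi>: "\<And>g. \<Phi> g = with_equilibria \<mu> (B g)"
    and B: "\<And>g. g \<in> borel_measurable borel \<Longrightarrow> B g \<in> borel_measurable M4"
    and F: "\<And>g a. F g a = coll_integral \<mu> a (\<lambda>b c d. B g (a, b, c, d))"
  shows "dense_extension F = op"
proof (rule dense_extension_eqI[OF continuous_on_op])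
  fix g assume "test_function g"
  then have g: "square_integrable g" by (rule square_integrable_test_function)
  then have gm: "g \<in> borel_measurable borel" by (simp add: square_integrable_iff_l2_square)
  have Fm: "F g \<in> borel_measurable borel"
    unfolding F[abs_def] by (rule borel_measurable_coll_integral[OF B[OF gm]])
  have "AE a in weight_measure. a > 0"
    unfolding weight_measure_def by (subst AE_density) (auto simp: indicator_def)
  then have ae: "AE a in weight_measure. F g a = coll_op (\<Phi> g) a"
    by eventually_elim (simp only: F \<Phi> coll_integral_eq_coll_op)
  have sq: "square_integrable (F g)"
    by (rule square_integrable_mono[OF Fm form_square_integrable[OF g]])
       (use ae in \<open>auto elim: eventually_mono\<close>)
  then show "square_integrable (F g) \<and> op (abs_L2 g) = abs_L2 (F g)"
    unfolding op_abs_L2[OF g] abs_L2_eq_iff[OF form_square_integrable[OF g] sq]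
    using ae by (auto elim: eventually_mono)
qed

end

section \<open>The linear, quadratic and cubic forms\<close>

definition linear_bracket :: "real \<Rightarrow> (real \<Rightarrow> real) \<Rightarrow> real \<times> real \<times> real \<times> real \<Rightarrow> real" where
  "linear_bracket \<mu> g = (\<lambda>(a, b, c, d).
     - g a / equil \<mu> a - g d / equil \<mu> d + g b / equil \<mu> b + g c / equil \<mu> c)"

definition quadratic_bracket :: "real \<Rightarrow> (real \<Rightarrow> real) \<Rightarrow> real \<times> real \<times> real \<times> real \<Rightarrow> real" where
  "quadratic_bracket \<mu> g = (\<lambda>(a, b, c, d).
     let m1 = inverse (equil \<mu> b); m2 = inverse (equil \<mu> c); m3 = inverse (equil \<mu> d)
     in - g a * g d * (m2 + m1) + g a * g b * (m3 - m2) + g a * g c * (m3 - m1)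
        + g d * g b * (m1 - m3) + g d * g c * (m2 - m3) + g b * g c * (m2 + m1))"

definition cubic_bracket :: "real \<Rightarrow> (real \<Rightarrow> real) \<Rightarrow> real \<times> real \<times> real \<times> real \<Rightarrow> real" where
  "cubic_bracket \<mu> g = (\<lambda>(a, b, c, d).
     let m0 = inverse (equil \<mu> a); m1 = inverse (equil \<mu> b);
         m2 = inverse (equil \<mu> c); m3 = inverse (equil \<mu> d)
     in m3 * g a * g b * g c + m0 * g b * g c * g d - m1 * g a * g c * g d - m2 * g a * g b * g d)"

abbreviation "linear_form \<mu> g \<equiv> with_equilibria \<mu> (linear_bracket \<mu> g)"
abbreviation "quadratic_form \<mu> g \<equiv> with_equilibria \<mu> (quadratic_bracket \<mu> g)"
abbreviation "cubic_form \<mu> g \<equiv> with_equilibria \<mu> (cubic_bracket \<mu> g)"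

lemma measurable_with_equilibria [measurable]:
  assumes [measurable]: "F \<in> borel_measurable M4"
  shows "with_equilibria \<mu> F \<in> borel_measurable M4"
  unfolding with_equilibria_def by measurable

lemma measurable_brackets [measurable]:
  assumes [measurable]: "g \<in> borel_measurable borel"
  shows "linear_bracket \<mu> g \<in> borel_measurable M4" "quadratic_bracket \<mu> g \<in> borel_measurable M4"
    "cubic_bracket \<mu> g \<in> borel_measurable M4"
  unfolding linear_bracket_def quadratic_bracket_def cubic_bracket_def Let_def by measurable

lemma L_test_eq: "L_test \<mu> g a = coll_integral \<mu> a (\<lambda>b c d. linear_bracket \<mu> g (a, b, c, d))"
  by (simp add: L_test_def linear_bracket_def)

lemma Gamma_test_eq: "Gamma_test \<mu> g a = coll_integral \<mu> a (\<lambda>b c d. quadratic_bracket \<mu> g (a, b, c, d))"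
  by (simp add: Gamma_test_def quadratic_bracket_def)

lemma Q_test_eq: "Q_test \<mu> g a = coll_integral \<mu> a (\<lambda>b c d. cubic_bracket \<mu> g (a, b, c, d))"
  by (simp add: Q_test_def cubic_bracket_def)

lemma abs_mult_diff_le2:
  "\<bar>x * y - x' * y'\<bar> \<le> \<bar>x - x'\<bar> * (\<bar>y\<bar> + \<bar>y'\<bar>) + (\<bar>x\<bar> + \<bar>x'\<bar>) * \<bar>y - y'\<bar>" for x y :: real
proof -
  have "x * y - x' * y' = (x - x') * y + x' * (y - y')" by (simp add: algebra_simps)
  then have "\<bar>x * y - x' * y'\<bar> \<le> \<bar>x - x'\<bar> * \<bar>y\<bar> + \<bar>x'\<bar> * \<bar>y - y'\<bar>"
    by (metis abs_mult abs_triangle_ineq)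
  also have "\<dots> \<le> \<bar>x - x'\<bar> * (\<bar>y\<bar> + \<bar>y'\<bar>) + (\<bar>x\<bar> + \<bar>x'\<bar>) * \<bar>y - y'\<bar>"
    by (intro add_mono mult_mono) auto
  finally show ?thesis .
qed

lemma abs_mult_diff_le3:
  "\<bar>x * y * z - x' * y' * z'\<bar> \<le> \<bar>x - x'\<bar> * (\<bar>y\<bar> + \<bar>y'\<bar>) * (\<bar>z\<bar> + \<bar>z'\<bar>)
     + (\<bar>x\<bar> + \<bar>x'\<bar>) * \<bar>y - y'\<bar> * (\<bar>z\<bar> + \<bar>z'\<bar>) + (\<bar>x\<bar> + \<bar>x'\<bar>) * (\<bar>y\<bar> + \<bar>y'\<bar>) * \<bar>z - z'\<bar>" for x y z :: real
proof -
  have "\<bar>x * y * z - x' * y' * z'\<bar> \<le> \<bar>x * y - x' * y'\<bar> * (\<bar>z\<bar> + \<bar>z'\<bar>) + (\<bar>x * y\<bar> + \<bar>x' * y'\<bar>) * \<bar>z - z'\<bar>"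
    by (rule abs_mult_diff_le2)
  also have "\<dots> \<le> (\<bar>x - x'\<bar> * (\<bar>y\<bar> + \<bar>y'\<bar>) + (\<bar>x\<bar> + \<bar>x'\<bar>) * \<bar>y - y'\<bar>) * (\<bar>z\<bar> + \<bar>z'\<bar>)
      + ((\<bar>x\<bar> + \<bar>x'\<bar>) * (\<bar>y\<bar> + \<bar>y'\<bar>)) * \<bar>z - z'\<bar>"
    by (intro add_mono mult_right_mono abs_mult_diff_le2) (auto simp: abs_mult algebra_simps)
  finally show ?thesis by (simp add: algebra_simps)
qed

lemma abs_add4_le: "\<bar>x + y + z + w\<bar> \<le> \<bar>x\<bar> + \<bar>y\<bar> + \<bar>z\<bar> + \<bar>w\<bar>" for x y z w :: real
  by linarith

lemma abs_add6_le: "\<bar>x + y + z + w + u + v\<bar> \<le> \<bar>x\<bar> + \<bar>y\<bar> + \<bar>z\<bar> + \<bar>w\<bar> + \<bar>u\<bar> + \<bar>v\<bar>" for x y z w u v :: real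
  by linarith

text \<open>The cancellation that makes \<open>\<Gamma>\<close> bounded: \<open>n\<^sub>2 n\<^sub>3 (1/n\<^sub>3 - 1/n\<^sub>2) = n\<^sub>2 - n\<^sub>3\<close> and its analogues.\<close>

lemma quadratic_form_eq:
  assumes "\<mu> > 0" "0 < b" "0 < c" "0 < d"
  shows "quadratic_form \<mu> g (a, b, c, d) =
    - (equil \<mu> d * (equil \<mu> b + equil \<mu> c)) * (g a * g d)
    + equil \<mu> b * (equil \<mu> c - equil \<mu> d) * (g a * g b)
    + equil \<mu> c * (equil \<mu> b - equil \<mu> d) * (g a * g c)
    + equil \<mu> c * (equil \<mu> d - equil \<mu> b) * (g d * g b)
    + equil \<mu> b * (equil \<mu> d - equil \<mu> c) * (g d * g c)
    + equil \<mu> d * (equil \<mu> b + equil \<mu> c) * (g b * g c)"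
proof -
  define nb nc nd where "nb = equil \<mu> b" "nc = equil \<mu> c" "nd = equil \<mu> d"
  note N = nb_nc_nd_def
  have p: "nb > 0" "nc > 0" "nd > 0" using assms by (auto simp: N intro!: equil_pos)
  have k: "nb * nc * nd * (inverse nc + inverse nb) = nd * (nb + nc)"
    "nb * nc * nd * (inverse nd - inverse nc) = nb * (nc - nd)"
    "nb * nc * nd * (inverse nd - inverse nb) = nc * (nb - nd)"
    "nb * nc * nd * (inverse nb - inverse nd) = nc * (nd - nb)"
    "nb * nc * nd * (inverse nc - inverse nd) = nb * (nd - nc)"
    using p by (simp_all add: field_simps)
  have expand: "M * (- ga * gd * x1 + ga * gb * x2 + ga * gc * x3 + gd * gb * x4 + gd * gc * x5 + gb
      * gc * x1)
      = - (M * x1) * (ga * gd) + M * x2 * (ga * gb) + M * x3 * (ga * gc) + M * x4 * (gd * gb) + M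
          * x5 * (gd * gc)
        + M * x1 * (gb * gc)" for M ga gb gc gd x1 x2 x3 x4 x5 :: real
    by (simp add: algebra_simps)
  show ?thesis
    unfolding with_equilibria_def quadratic_bracket_def Let_def prod.case N[symmetric] expand k ..
qed

lemma linear_form_diff_le:
  assumes "\<mu> > 0" "0 < a" "0 < b" "0 < c" "0 < d"
  shows "\<bar>linear_form \<mu> g (a, b, c, d) - linear_form \<mu> h (a, b, c, d)\<bar>
    \<le> linear_majorant \<mu> (\<lambda>\<omega>. g \<omega> - h \<omega>) (a, b, c, d)"
proof -
  note n = equil_pos[OF assms(1) less_imp_le[OF assms(2)]] equil_pos[OF assms(1) less_imp_le[OF assms(3)]]
    equil_pos[OF assms(1) less_imp_le[OF assms(4)]] equil_pos[OF assms(1) less_imp_le[OF assms(5)]]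
  define na nb nc nd where "na = equil \<mu> a" "nb = equil \<mu> b" "nc = equil \<mu> c" "nd = equil \<mu> d"
  note N = na_nb_nc_nd_def
  have p: "na > 0" "nb > 0" "nc > 0" "nd > 0" using n by (auto simp: N)
  have "linear_form \<mu> g (a, b, c, d) - linear_form \<mu> h (a, b, c, d)
     = - (nb * nc * nd / na) * (g a - h a) + - (nb * nc) * (g d - h d) + nc * nd * (g b - h b) + nb
         * nd * (g c - h c)"
    using p by (simp add: with_equilibria_def linear_bracket_def flip: N) (simp add: field_simps)
  also have "\<bar>\<dots>\<bar> \<le> \<bar>- (nb * nc * nd / na) * (g a - h a)\<bar> + \<bar>- (nb * nc) * (g d - h d)\<bar> + \<bar>nc * nd
      * (g b - h b)\<bar> + \<bar>nb * nd * (g c - h c)\<bar>"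
    by (rule abs_add4_le)
  also have "\<dots> = linear_majorant \<mu> (\<lambda>\<omega>. g \<omega> - h \<omega>) (a, b, c, d)"
    using p by (simp add: linear_majorant_def abs_mult flip: N)
  finally show ?thesis .
qed

lemma quadratic_form_diff_le:
  assumes "\<mu> > 0" "0 < a" "0 < b" "0 < c" "0 < d"
  shows "\<bar>quadratic_form \<mu> g (a, b, c, d) - quadratic_form \<mu> h (a, b, c, d)\<bar>
    \<le> quadratic_majorant \<mu> (\<lambda>\<omega>. g \<omega> - h \<omega>) (\<lambda>\<omega>. \<bar>g \<omega>\<bar> + \<bar>h \<omega>\<bar>) (a, b, c, d)
      + quadratic_majorant \<mu> (\<lambda>\<omega>. \<bar>g \<omega>\<bar> + \<bar>h \<omega>\<bar>) (\<lambda>\<omega>. g \<omega> - h \<omega>) (a, b, c, d)"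
proof -
  note n = equil_pos[OF assms(1) less_imp_le[OF assms(2)]] equil_pos[OF assms(1) less_imp_le[OF assms(3)]]
    equil_pos[OF assms(1) less_imp_le[OF assms(4)]] equil_pos[OF assms(1) less_imp_le[OF assms(5)]]
  define nb nc nd where "nb = equil \<mu> b" "nc = equil \<mu> c" "nd = equil \<mu> d"
  note N = nb_nc_nd_def
  have p: "nb > 0" "nc > 0" "nd > 0" using n by (auto simp: N)
  define q where "q x y = g x * g y - h x * h y" for x y
  define r where "r x y = \<bar>g x - h x\<bar> * (\<bar>g y\<bar> + \<bar>h y\<bar>) + (\<bar>g x\<bar> + \<bar>h x\<bar>) * \<bar>g y - h y\<bar>" for x y
  have qr: "\<bar>q x y\<bar> \<le> r x y" for x y
    unfolding q_def r_def by (rule abs_mult_diff_le2)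
  have r0: "r x y \<ge> 0" for x y using qr[of x y] by linarith
  have b: "\<bar>k * q x y\<bar> \<le> K * r x y" if "\<bar>k\<bar> \<le> K" for k K x y
    unfolding abs_mult using that qr by (intro mult_mono) auto
  have "quadratic_form \<mu> g (a, b, c, d) - quadratic_form \<mu> h (a, b, c, d)
     = - (nd * (nb + nc)) * q a d + nb * (nc - nd) * q a b + nc * (nb - nd) * q a c
       + nc * (nd - nb) * q d b + nb * (nd - nc) * q d c + nd * (nb + nc) * q b c"
    unfolding quadratic_form_eq[OF assms(1,3-5)] N[symmetric] q_def
    by (simp only: right_diff_distrib)
  also have "\<bar>\<dots>\<bar> \<le> \<bar>- (nd * (nb + nc)) * q a d\<bar> + \<bar>nb * (nc - nd) * q a b\<bar> + \<bar>nc * (nb - nd) * q a c\<bar>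
       + \<bar>nc * (nd - nb) * q d b\<bar> + \<bar>nb * (nd - nc) * q d c\<bar> + \<bar>nd * (nb + nc) * q b c\<bar>"
    by (rule abs_add6_le)
  also have "\<dots> \<le> nd * (nb + nc) * r a d + nb * \<bar>nc - nd\<bar> * r a b + nc * \<bar>nb - nd\<bar> * r a c
       + nc * (nd + nb) * r d b + nb * (nd + nc) * r d c + nd * (nb + nc) * r b c"
    using p by (intro add_mono b) (auto simp: abs_mult intro!: mult_left_mono)
  also have "\<dots> = quadratic_majorant \<mu> (\<lambda>\<omega>. g \<omega> - h \<omega>) (\<lambda>\<omega>. \<bar>g \<omega>\<bar> + \<bar>h \<omega>\<bar>) (a, b, c, d)
      + quadratic_majorant \<mu> (\<lambda>\<omega>. \<bar>g \<omega>\<bar> + \<bar>h \<omega>\<bar>) (\<lambda>\<omega>. g \<omega> - h \<omega>) (a, b, c, d)"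
    by (simp add: quadratic_majorant_def r_def algebra_simps flip: N)
  finally show ?thesis .
qed

text \<open>The term with \<open>1/n\<^sub>0\<close> is controlled by the conservation of energy, \<open>1/n\<^sub>0 \<le> 1/n\<^sub>1 + 1/n\<^sub>2\<close>.\<close>

lemma cubic_form_diff_le:
  assumes "\<mu> > 0" "0 < a" "0 < b" "0 < c" "0 < d" and energy: "a + d = b + c"
  shows "\<bar>cubic_form \<mu> g (a, b, c, d) - cubic_form \<mu> h (a, b, c, d)\<bar>
    \<le> cubic_majorant \<mu> (\<lambda>\<omega>. g \<omega> - h \<omega>) (\<lambda>\<omega>. \<bar>g \<omega>\<bar> + \<bar>h \<omega>\<bar>) (\<lambda>\<omega>. \<bar>g \<omega>\<bar> + \<bar>h \<omega>\<bar>) (a, b, c, d)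
      + cubic_majorant \<mu> (\<lambda>\<omega>. \<bar>g \<omega>\<bar> + \<bar>h \<omega>\<bar>) (\<lambda>\<omega>. g \<omega> - h \<omega>) (\<lambda>\<omega>. \<bar>g \<omega>\<bar> + \<bar>h \<omega>\<bar>) (a, b, c, d)
      + cubic_majorant \<mu> (\<lambda>\<omega>. \<bar>g \<omega>\<bar> + \<bar>h \<omega>\<bar>) (\<lambda>\<omega>. \<bar>g \<omega>\<bar> + \<bar>h \<omega>\<bar>) (\<lambda>\<omega>. g \<omega> - h \<omega>) (a, b, c, d)"
proof -
  note n = equil_pos[OF assms(1) less_imp_le[OF assms(2)]] equil_pos[OF assms(1) less_imp_le[OF assms(3)]]
    equil_pos[OF assms(1) less_imp_le[OF assms(4)]] equil_pos[OF assms(1) less_imp_le[OF assms(5)]]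
  define na nb nc nd where "na = equil \<mu> a" "nb = equil \<mu> b" "nc = equil \<mu> c" "nd = equil \<mu> d"
  note N = na_nb_nc_nd_def
  have p: "na > 0" "nb > 0" "nc > 0" "nd > 0" using n by (auto simp: N)
  have "1 / na \<le> 1 / nb + 1 / nc"
    using assms by (simp add: N equil_def)
  then have "nb * nc * nd * (1 / na) \<le> nb * nc * nd * (1 / nb + 1 / nc)"
    using p by (intro mult_left_mono) auto
  also have "\<dots> = nd * (nb + nc)" using p by (simp add: field_simps)
  finally have loss: "nb * nc * nd / na \<le> nd * (nb + nc)" by simp
  define q where "q x y z = g x * g y * g z - h x * h y * h z" for x y z
  define r where "r x y z = \<bar>g x - h x\<bar> * (\<bar>g y\<bar> + \<bar>h y\<bar>) * (\<bar>g z\<bar> + \<bar>h z\<bar>)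
     + (\<bar>g x\<bar> + \<bar>h x\<bar>) * \<bar>g y - h y\<bar> * (\<bar>g z\<bar> + \<bar>h z\<bar>) + (\<bar>g x\<bar> + \<bar>h x\<bar>) * (\<bar>g y\<bar> + \<bar>h y\<bar>)
         * \<bar>g z - h z\<bar>" for x y z
  have qr: "\<bar>q x y z\<bar> \<le> r x y z" for x y z
    unfolding q_def r_def by (rule abs_mult_diff_le3)
  have b: "\<bar>k * q x y z\<bar> \<le> K * r x y z" if "\<bar>k\<bar> \<le> K" for k K x y z
    unfolding abs_mult using that qr by (intro mult_mono) auto
  have "cubic_form \<mu> g (a, b, c, d) - cubic_form \<mu> h (a, b, c, d)
     = nb * nc * q a b c + (nb * nc * nd / na) * q b c d + - (nc * nd) * q a c d + - (nb * nd) * q a b d"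
    using p by (simp add: with_equilibria_def cubic_bracket_def Let_def q_def flip: N) (simp add:
        field_simps)
  also have "\<bar>\<dots>\<bar> \<le> \<bar>nb * nc * q a b c\<bar> + \<bar>(nb * nc * nd / na) * q b c d\<bar> + \<bar>- (nc * nd) * q a c d\<bar>
      + \<bar>- (nb * nd) * q a b d\<bar>"
    by (rule abs_add4_le)
  also have "\<dots> \<le> nb * nc * r a b c + nd * (nb + nc) * r b c d + nc * nd * r a c d + nb * nd * r a b d"
    using p loss by (intro add_mono b) (auto simp: abs_mult)
  also have "\<dots> = cubic_majorant \<mu> (\<lambda>\<omega>. g \<omega> - h \<omega>) (\<lambda>\<omega>. \<bar>g \<omega>\<bar> + \<bar>h \<omega>\<bar>) (\<lambda>\<omega>. \<bar>g \<omega>\<bar> + \<bar>h \<omega>\<bar>) (a, b, c, d)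
      + cubic_majorant \<mu> (\<lambda>\<omega>. \<bar>g \<omega>\<bar> + \<bar>h \<omega>\<bar>) (\<lambda>\<omega>. g \<omega> - h \<omega>) (\<lambda>\<omega>. \<bar>g \<omega>\<bar> + \<bar>h \<omega>\<bar>) (a, b, c, d)
      + cubic_majorant \<mu> (\<lambda>\<omega>. \<bar>g \<omega>\<bar> + \<bar>h \<omega>\<bar>) (\<lambda>\<omega>. \<bar>g \<omega>\<bar> + \<bar>h \<omega>\<bar>) (\<lambda>\<omega>. g \<omega> - h \<omega>) (a, b, c, d)"
    by (simp add: cubic_majorant_def r_def flip: N) (simp add: algebra_simps)
  finally show ?thesis .
qed

lemma collision_form_linear:
  assumes \<mu>: "\<mu> > 0"
  shows "collision_form (linear_form \<mu>) (\<lambda>_. linear_const \<mu>)"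
proof
  fix g h :: "real \<Rightarrow> real" and D S :: real
  assume [measurable]: "g \<in> borel_measurable borel" "h \<in> borel_measurable borel" and D: "D \<ge> 0"
    and l: "l2_square (\<lambda>\<omega>. g \<omega> - h \<omega>) \<le> ennreal (D\<^sup>2)"
  have "coll_bounded (linear_const \<mu> * D) (linear_majorant \<mu> (\<lambda>\<omega>. g \<omega> - h \<omega>))"
    by (rule coll_bounded_linear[OF \<mu> _ l D]) measurable
  then show "coll_bounded (linear_const \<mu> * D) (\<lambda>p. \<bar>linear_form \<mu> g p - linear_form \<mu> h p\<bar>)"
    by (rule coll_bounded_mono) (simp_all add: linear_form_diff_le[OF \<mu>])
qed (simp_all add: linear_const_nonneg[OF \<mu>] with_equilibria_def linear_bracket_def case_prod_beta')

lemma collision_form_quadratic: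
  assumes \<mu>: "\<mu> > 0"
  shows "collision_form (quadratic_form \<mu>) (\<lambda>S. 2 * quadratic_const \<mu> * S)"
proof
  fix g h :: "real \<Rightarrow> real" and D S :: real
  assume [measurable]: "g \<in> borel_measurable borel" "h \<in> borel_measurable borel" and D: "D \<ge> 0" and
      S: "S \<ge> 0"
    and l: "l2_square (\<lambda>\<omega>. g \<omega> - h \<omega>) \<le> ennreal (D\<^sup>2)" "l2_square (\<lambda>\<omega>. \<bar>g \<omega>\<bar> + \<bar>h \<omega>\<bar>) \<le> ennreal (S\<^sup>2)"
  have b: "coll_bounded (quadratic_const \<mu> * (D * S)) (quadratic_majorant \<mu> (\<lambda>\<omega>. g \<omega> - h \<omega>) (\<lambda>\<omega>. \<bar>g
      \<omega>\<bar> + \<bar>h \<omega>\<bar>))"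
    "coll_bounded (quadratic_const \<mu> * (S * D)) (quadratic_majorant \<mu> (\<lambda>\<omega>. \<bar>g \<omega>\<bar> + \<bar>h \<omega>\<bar>) (\<lambda>\<omega>. g \<omega> - h \<omega>))"
    by (rule coll_bounded_quadratic[OF \<mu> _ _ l(1) D l(2) S], measurable)
       (rule coll_bounded_quadratic[OF \<mu> _ _ l(2) S l(1) D], measurable)
  show "coll_bounded (2 * quadratic_const \<mu> * S * D) (\<lambda>p. \<bar>quadratic_form \<mu> g p - quadratic_form \<mu> h p\<bar>)"
    by (rule coll_bounded_mono[OF coll_bounded_add[OF b]])
       (use quadratic_const_nonneg[OF \<mu>] D S in \<open>simp_all add: quadratic_form_diff_le[OF \<mu>]\<close>)
qed (use quadratic_const_nonneg[OF \<mu>] in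
      \<open>simp_all add: with_equilibria_def quadratic_bracket_def Let_def case_prod_beta' mult_left_mono\<close>)

lemma collision_form_cubic:
  assumes \<mu>: "\<mu> > 0"
  shows "collision_form (cubic_form \<mu>) (\<lambda>S. 3 * cubic_const \<mu> * S\<^sup>2)"
proof
  fix g h :: "real \<Rightarrow> real" and D S :: real
  assume [measurable]: "g \<in> borel_measurable borel" "h \<in> borel_measurable borel" and D: "D \<ge> 0" and
      S: "S \<ge> 0"
    and l: "l2_square (\<lambda>\<omega>. g \<omega> - h \<omega>) \<le> ennreal (D\<^sup>2)" "l2_square (\<lambda>\<omega>. \<bar>g \<omega>\<bar> + \<bar>h \<omega>\<bar>) \<le> ennreal (S\<^sup>2)"
  define \<delta> s where "\<delta> \<omega> = g \<omega> - h \<omega>" and "s \<omega> = \<bar>g \<omega>\<bar> + \<bar>h \<omega>\<bar>" for \<omega>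
  have [measurable]: "\<delta> \<in> borel_measurable borel" "s \<in> borel_measurable borel"
    unfolding \<delta>_def[abs_def] s_def[abs_def] by measurable
  have l': "l2_square \<delta> \<le> ennreal (D\<^sup>2)" "l2_square s \<le> ennreal (S\<^sup>2)"
    using l by (simp_all add: \<delta>_def[abs_def] s_def[abs_def])
  have b: "coll_bounded (cubic_const \<mu> * (D * S * S)) (cubic_majorant \<mu> \<delta> s s)"
    "coll_bounded (cubic_const \<mu> * (S * D * S)) (cubic_majorant \<mu> s \<delta> s)"
    "coll_bounded (cubic_const \<mu> * (S * S * D)) (cubic_majorant \<mu> s s \<delta>)"
    by (rule coll_bounded_cubic[OF \<mu>]; (rule l' D S | measurable))+
  have le: "\<bar>cubic_form \<mu> g (a, b, c, d) - cubic_form \<mu> h (a, b, c, d)\<bar>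
      \<le> cubic_majorant \<mu> \<delta> s s (a, b, c, d) + cubic_majorant \<mu> s \<delta> s (a, b, c, d)
          + cubic_majorant \<mu> s s \<delta> (a, b, c, d)"
    if "0 < a" "0 < b" "0 < c" "0 < d" "a + d = b + c" for a b c d
    using cubic_form_diff_le[OF \<mu> that, of g h] by (simp only: \<delta>_def[abs_def] s_def[abs_def])
  show "coll_bounded (3 * cubic_const \<mu> * S\<^sup>2 * D) (\<lambda>p. \<bar>cubic_form \<mu> g p - cubic_form \<mu> h p\<bar>)"
    by (rule coll_bounded_mono[OF coll_bounded_add[OF coll_bounded_add[OF b(1,2)] b(3)]])
       (use cubic_const_nonneg[OF \<mu>] D S le in \<open>simp_all add: power2_eq_square\<close>)
qed (use cubic_const_nonneg[OF \<mu>] in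
      \<open>simp_all add: with_equilibria_def cubic_bracket_def Let_def case_prod_beta' mult_left_mono\<close>)

section \<open>Symmetrisation and the kernel of the linear operator\<close>

lemma distr_coll_measure:
  assumes [measurable]: "\<sigma> \<in> measurable M4 M4"
    and inv: "\<And>F. F \<in> borel_measurable M4 \<Longrightarrow> (\<integral>\<^sup>+p. F (\<sigma> p) \<partial>coll_measure) = (\<integral>\<^sup>+p. F p \<partial>coll_measure)"
  shows "distr coll_measure M4 \<sigma> = coll_measure"
proof (rule measure_eqI)
  fix A assume "A \<in> sets (distr coll_measure M4 \<sigma>)"
  then have A [measurable]: "A \<in> sets M4" by simp
  have "emeasure (distr coll_measure M4 \<sigma>) A = (\<integral>\<^sup>+p. indicator A p \<partial>distr coll_measure M4 \<sigma>)"
    by simp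
  also have "\<dots> = (\<integral>\<^sup>+p. indicator A (\<sigma> p) \<partial>coll_measure)"
    by (rule nn_integral_distr) simp_all
  also have "\<dots> = (\<integral>\<^sup>+p. indicator A p \<partial>coll_measure)"
    by (rule inv) simp
  also have "\<dots> = emeasure coll_measure A" by simp
  finally show "emeasure (distr coll_measure M4 \<sigma>) A = emeasure coll_measure A" .
qed simp

lemma coll_integral_invariant:
  fixes X :: "real \<times> real \<times> real \<times> real \<Rightarrow> real"
  assumes [measurable]: "\<sigma> \<in> measurable M4 M4"
    and "\<And>F. F \<in> borel_measurable M4 \<Longrightarrow> (\<integral>\<^sup>+p. F (\<sigma> p) \<partial>coll_measure) = (\<integral>\<^sup>+p. F p \<partial>coll_measure)"
    and [measurable]: "X \<in> borel_measurable M4" and X: "integrable coll_measure X"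
  shows "integrable coll_measure (\<lambda>p. X (\<sigma> p))" "(LINT p|coll_measure. X (\<sigma> p))
      = (LINT p|coll_measure. X p)"
proof -
  have d: "distr coll_measure M4 \<sigma> = coll_measure"
    by (rule distr_coll_measure[OF assms(1)]) (rule assms(2))
  have "integrable (distr coll_measure M4 \<sigma>) X" by (simp only: d X)
  then show "integrable coll_measure (\<lambda>p. X (\<sigma> p))"
    by (rule integrable_distr[rotated]) simp
  show "(LINT p|coll_measure. X (\<sigma> p)) = (LINT p|coll_measure. X p)"
    using integral_distr[of \<sigma> coll_measure M4 X] by (simp add: d)
qed

text \<open>Invariance under exchanges on one side of the collision, change of sign when the sides are
  exchanged, both only on the support of the collision measure.\<close>

definition antisymmetric_bracket :: "(real \<times> real \<times> real \<times> real \<Rightarrow> real) \<Rightarrow> bool" where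
  "antisymmetric_bracket F \<longleftrightarrow> (\<forall>a b c d. 0 < a \<longrightarrow> 0 < b \<longrightarrow> 0 < c \<longrightarrow> 0 < d \<longrightarrow> a + d = b + c \<longrightarrow>
     F (d, b, c, a) = F (a, b, c, d) \<and> F (a, c, b, d) = F (a, b, c, d) \<and> F (b, a, d, c) = - F (a, b, c, d))"

text \<open>The quantity \<open>\<psi>\<^sub>0 + \<psi>\<^sub>3 - \<psi>\<^sub>1 - \<psi>\<^sub>2\<close> for \<open>\<psi> = h/n\<close>; it vanishes for collision invariants \<open>\<psi>\<close>.\<close>

definition collision_defect :: "real \<Rightarrow> (real \<Rightarrow> real) \<Rightarrow> real \<times> real \<times> real \<times> real \<Rightarrow> real" where
  "collision_defect \<mu> h = (\<lambda>(a, b, c, d). h a / equil \<mu> a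
      + h d / equil \<mu> d - h b / equil \<mu> b - h c / equil \<mu> c)"

text \<open>The weak formulation of kinetic theory: average over the four symmetries that carry \<open>\<omega>\<^sub>0\<close> to each of
  the frequencies.\<close>

lemma symmetrised_form:
  assumes \<mu>: "\<mu> > 0" and [measurable]: "F \<in> borel_measurable M4" "h \<in> borel_measurable borel"
    and anti: "antisymmetric_bracket F"
    and int: "integrable coll_measure (\<lambda>p. with_equilibria \<mu> F p * h (fst p))"
  shows "integrable coll_measure (\<lambda>p. equil \<mu> (fst p) * with_equilibria \<mu> F p
      * collision_defect \<mu> h p)" (is ?I)
    and "4 * (LINT p|coll_measure. with_equilibria \<mu> F p * h (fst p))
      = (LINT p|coll_measure. equil \<mu> (fst p) * with_equilibria \<mu> F p * collision_defect \<mu> h p)" (is ?E)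
proof -
  define X where "X p = with_equilibria \<mu> F p * h (fst p)" for p
  have [measurable]: "X \<in> borel_measurable M4" unfolding X_def[abs_def] by measurable
  have iX: "integrable coll_measure X" using int by (simp add: X_def[abs_def])
  define s03 s01 s12 :: "real \<times> real \<times> real \<times> real \<Rightarrow> real \<times> real \<times> real \<times> real"
    where "s03 = (\<lambda>(a, b, c, d). (d, b, c, a))" and "s01 = (\<lambda>(a, b, c, d). (b, a, d, c))" and "s12
        = (\<lambda>(a, b, c, d). (a, c, b, d))"
  have ms [measurable]: "s03 \<in> measurable M4 M4" "s01 \<in> measurable M4 M4" "s12 \<in> measurable M4 M4"
    unfolding s03_def s01_def s12_def by measurable
  have inv: "(\<integral>\<^sup>+p. G (s03 p) \<partial>coll_measure) = (\<integral>\<^sup>+p. G p \<partial>coll_measure)"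
    "(\<integral>\<^sup>+p. G (s01 p) \<partial>coll_measure) = (\<integral>\<^sup>+p. G p \<partial>coll_measure)"
    "(\<integral>\<^sup>+p. G (s12 p) \<partial>coll_measure) = (\<integral>\<^sup>+p. G p \<partial>coll_measure)" if "G \<in> borel_measurable M4" for G
    using nn_integral_coll_swap03[OF that] nn_integral_coll_swap_sides[OF that]
        nn_integral_coll_swap12[OF that]
    by (simp_all add: s03_def s01_def s12_def case_prod_beta')
  note X03 = coll_integral_invariant[OF ms(1) inv(1) _ iX]
  note X01 = coll_integral_invariant[OF ms(2) inv(2) _ iX]
  have X02: "integrable coll_measure (\<lambda>p. X (s01 (s12 p)))" "(LINT p|coll_measure. X (s01 (s12 p)))
      = (LINT p|coll_measure. X (s01 p))"
    using coll_integral_invariant[OF ms(3) inv(3), of "\<lambda>p. X (s01 p)"] X01 by simp_all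
  have ae: "AE p in coll_measure. equil \<mu> (fst p) * with_equilibria \<mu> F p * collision_defect \<mu> h p
      = X p + X (s03 p) + X (s01 p) + X (s01 (s12 p))"
    using AE_coll_measure
  proof (elim eventually_mono)
    fix p :: "real \<times> real \<times> real \<times> real"
    assume p: "case p of (a, b, c, d) \<Rightarrow> 0 < a \<and> 0 < b \<and> 0 < c \<and> 0 < d \<and> a + d = b + c"
    obtain a b c d where q: "p = (a, b, c, d)" by (cases p)
    have pos: "0 < a" "0 < b" "0 < c" "0 < d" "a + d = b + c" using p by (auto simp: q)
    have f: "F (d, b, c, a) = F (a, b, c, d)" "F (b, a, d, c) = - F (a, b, c, d)"
      using anti pos unfolding antisymmetric_bracket_def by blast+
    have "a + d = c + b" using pos by simp
    then have "F (a, c, b, d) = F (a, b, c, d)" "F (c, a, d, b) = - F (a, c, b, d)"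
      using anti pos unfolding antisymmetric_bracket_def by blast+
    then have f': "F (c, a, d, b) = - F (a, b, c, d)" by (simp only:)
    have n: "equil \<mu> a > 0" "equil \<mu> b > 0" "equil \<mu> c > 0" "equil \<mu> d > 0"
      using pos by (auto intro!: equil_pos[OF \<mu>])
    show "equil \<mu> (fst p) * with_equilibria \<mu> F p * collision_defect \<mu> h p
      = X p + X (s03 p) + X (s01 p) + X (s01 (s12 p))"
      unfolding q X_def s03_def s01_def s12_def with_equilibria_def collision_defect_def prod.case
          fst_conv f f'
      using n by (simp add: field_simps)
  qed
  have "integrable coll_measure (\<lambda>p. X p + X (s03 p) + X (s01 p) + X (s01 (s12 p)))"
    using iX X03 X01 X02 by auto
  then show ?I
    by (rule integrable_cong_AE_imp) (use ae in \<open>auto simp: collision_defect_def elim: eventually_mono\<close>)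
  have "(LINT p|coll_measure. equil \<mu> (fst p) * with_equilibria \<mu> F p * collision_defect \<mu> h p)
      = (LINT p|coll_measure. X p + X (s03 p) + X (s01 p) + X (s01 (s12 p)))"
    by (rule integral_cong_AE[OF _ _ ae]) (simp_all add: collision_defect_def)
  also have "\<dots> = 4 * (LINT p|coll_measure. X p)"
    using iX X03 X01 X02 by simp
  finally show ?E by (simp add: X_def)
qed

lemma antisymmetric_linear_bracket: "antisymmetric_bracket (linear_bracket \<mu> g)"
  by (simp add: antisymmetric_bracket_def linear_bracket_def)

text \<open>This is where energy conservation is needed, in the form \<open>1/n\<^sub>0 + 1/n\<^sub>3 = 1/n\<^sub>1 + 1/n\<^sub>2\<close>.\<close>

lemma antisymmetric_quadratic_bracket: "antisymmetric_bracket (quadratic_bracket \<mu> g)"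
  unfolding antisymmetric_bracket_def
proof (intro allI impI)
  fix a b c d :: real assume e: "a + d = b + c"
  define ma mb mc md where "ma = inverse (equil \<mu> a)" "mb = inverse (equil \<mu> b)"
    "mc = inverse (equil \<mu> c)" "md = inverse (equil \<mu> d)"
  note m = ma_mb_mc_md_def
  have md: "md = mb + mc - ma" using e by (simp add: m equil_def)
  show "quadratic_bracket \<mu> g (d, b, c, a) = quadratic_bracket \<mu> g (a, b, c, d) \<and>
    quadratic_bracket \<mu> g (a, c, b, d) = quadratic_bracket \<mu> g (a, b, c, d) \<and>
    quadratic_bracket \<mu> g (b, a, d, c) = - quadratic_bracket \<mu> g (a, b, c, d)"
    unfolding quadratic_bracket_def prod.case Let_def m[symmetric] md
    by (intro conjI) (simp_all add: algebra_simps)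
qed

lemma antisymmetric_cubic_bracket: "antisymmetric_bracket (cubic_bracket \<mu> g)"
  by (simp add: antisymmetric_bracket_def cubic_bracket_def Let_def)

lemma L_op_eq:
  assumes "\<mu> > 0"
  shows "L_op \<mu> = collision_form.op (linear_form \<mu>)"
  unfolding L_op_def
  by (rule collision_form.dense_extension_eq_op[OF collision_form_linear[OF assms] refl
        measurable_brackets(1) L_test_eq])

lemma Gamma_op_eq:
  assumes "\<mu> > 0"
  shows "Gamma_op \<mu> = collision_form.op (quadratic_form \<mu>)"
  unfolding Gamma_op_def
  by (rule collision_form.dense_extension_eq_op[OF collision_form_quadratic[OF assms] refl
        measurable_brackets(2) Gamma_test_eq])

lemma Q_op_eq:
  assumes "\<mu> > 0"
  shows "Q_op \<mu> = collision_form.op (cubic_form \<mu>)"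
  unfolding Q_op_def
  by (rule collision_form.dense_extension_eq_op[OF collision_form_cubic[OF assms] refl
        measurable_brackets(3) Q_test_eq])

text \<open>The linearised H-theorem: \<open>- 4 \<langle>L \<phi>, \<phi>\<rangle>\<close> is the integral of the squared defect against a positive
  density.\<close>

lemma collision_defect_kernel:
  assumes \<mu>: "\<mu> > 0" and \<phi>: "square_integrable \<phi>" and ker: "L_op \<mu> (abs_L2 \<phi>) = 0"
  shows "AE p in coll_measure. collision_defect \<mu> \<phi> p = 0"
proof -
  interpret collision_form "linear_form \<mu>" "\<lambda>_. linear_const \<mu>"
    by (rule collision_form_linear[OF \<mu>])
  have [measurable]: "\<phi> \<in> borel_measurable borel"
    using \<phi> by (simp add: square_integrable_iff_l2_square)
  define Y where "Y p = equil \<mu> (fst p) * linear_form \<mu> \<phi> p * collision_defect \<mu> \<phi> p" for p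
  have form: "integrable coll_measure Y" "4 * (LINT p|coll_measure. linear_form \<mu> \<phi> p * \<phi> (fst p))
      = (LINT p|coll_measure. Y p)"
    using symmetrised_form[OF \<mu> _ _ antisymmetric_linear_bracket integrable_form[OF \<phi> \<phi>]]
    by (simp_all add: Y_def[abs_def])
  have "(LINT p|coll_measure. linear_form \<mu> \<phi> p * \<phi> (fst p)) = 0"
    using inner_op[OF \<phi> \<phi>] ker by (simp add: L_op_eq[OF \<mu>])
  then have zero: "(LINT p|coll_measure. - Y p) = 0"
    using form by simp
  have Y: "AE p in coll_measure. - Y p \<ge> 0 \<and> (- Y p = 0 \<longrightarrow> collision_defect \<mu> \<phi> p = 0)"
    using AE_coll_measure
  proof (elim eventually_mono)
    fix p :: "real \<times> real \<times> real \<times> real"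
    assume p: "case p of (a, b, c, d) \<Rightarrow> 0 < a \<and> 0 < b \<and> 0 < c \<and> 0 < d \<and> a + d = b + c"
    obtain a b c d where q: "p = (a, b, c, d)" by (cases p)
    define N where "N = equil \<mu> a * (equil \<mu> b * equil \<mu> c * equil \<mu> d)"
    have "equil \<mu> a > 0" "equil \<mu> b > 0" "equil \<mu> c > 0" "equil \<mu> d > 0"
      using p by (auto simp: q intro!: equil_pos[OF \<mu>])
    then have N: "N > 0" by (simp add: N_def)
    have "linear_bracket \<mu> \<phi> p = - collision_defect \<mu> \<phi> p"
      by (simp add: q linear_bracket_def collision_defect_def)
    then have "- Y p = N * (collision_defect \<mu> \<phi> p)\<^sup>2"
      by (simp add: Y_def with_equilibria_def q N_def power2_eq_square)
    then show "- Y p \<ge> 0 \<and> (- Y p = 0 \<longrightarrow> collision_defect \<mu> \<phi> p = 0)"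
      using N by simp
  qed
  have "AE p in coll_measure. - Y p = 0"
    using integral_nonneg_eq_0_iff_AE[of coll_measure "\<lambda>p. - Y p"] form(1) zero Y
    by (auto elim: eventually_mono)
  with Y show ?thesis by eventually_elim simp
qed

text \<open>By the weak formulation, pairing with an element of the kernel integrates a function that vanishes
  almost everywhere.\<close>

lemma (in collision_form) orthogonal_kernel:
  assumes \<mu>: "\<mu> > 0" and \<Phi>: "\<And>g. \<Phi> g = with_equilibria \<mu> (F g)"
    and F: "\<And>g. g \<in> borel_measurable borel \<Longrightarrow> F g \<in> borel_measurable M4" "\<And>g. antisymmetric_bracket (F g)"
  shows "op x \<in> (Ker_L \<mu>)\<^sup>\<bottom>"
  unfolding orthogonal_comp_def orthogonal_def mem_Collect_eq
proof
  fix y assume y: "y \<in> Ker_L \<mu>"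
  obtain g where g: "square_integrable g" "x = abs_L2 g" by (rule L2_cases)
  obtain h where h: "square_integrable h" "y = abs_L2 h" by (rule L2_cases)
  have m: "g \<in> borel_measurable borel" "h \<in> borel_measurable borel"
    using g h by (simp_all add: square_integrable_iff_l2_square)
  have "L_op \<mu> (abs_L2 h) = 0" using y h by (simp add: Ker_L_def)
  then have "AE p in coll_measure. collision_defect \<mu> h p = 0"
    by (rule collision_defect_kernel[OF \<mu> h(1)])
  then have "AE p in coll_measure. equil \<mu> (fst p) * \<Phi> g p * collision_defect \<mu> h p = 0"
    by (rule eventually_mono) simp
  then have "(LINT p|coll_measure. equil \<mu> (fst p) * \<Phi> g p * collision_defect \<mu> h p) = 0"
    by (rule integral_eq_zero_AE)
  moreover have "4 * (LINT p|coll_measure. \<Phi> g p * h (fst p))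
      = (LINT p|coll_measure. equil \<mu> (fst p) * \<Phi> g p * collision_defect \<mu> h p)"
    using symmetrised_form(2)[OF \<mu> F(1)[OF m(1)] m(2) F(2)] integrable_form[OF g(1) h(1)]
    unfolding \<Phi> .
  ultimately have "op x \<bullet> y = 0"
    using inner_op[OF g(1) h(1)] by (simp only: g h)
  then show "y \<bullet> op x = 0" by (simp only: inner_commute)
qed

section \<open>Dissipative differential equations in a Hilbert space\<close>

definition radial_retraction :: "real \<Rightarrow> 'a::real_normed_vector \<Rightarrow> 'a" where
  "radial_retraction \<rho> x = (\<rho> / max \<rho> (norm x)) *\<^sub>R x"

lemma norm_radial_retraction_le: "\<rho> > 0 \<Longrightarrow> norm (radial_retraction \<rho> x) \<le> \<rho>"
  by (auto simp: radial_retraction_def max_def field_simps)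

lemma radial_retraction_eq: "\<rho> > 0 \<Longrightarrow> norm x \<le> \<rho> \<Longrightarrow> radial_retraction \<rho> x = x"
  by (simp add: radial_retraction_def max_def)

lemma radial_retraction_lipschitz:
  assumes "\<rho> > 0"
  shows "norm (radial_retraction \<rho> x - radial_retraction \<rho> y) \<le> 2 * norm (x - y)"
proof -
  define a b where "a = max \<rho> (norm x)" and "b = max \<rho> (norm y)"
  have ab: "a \<ge> \<rho>" "b \<ge> \<rho>" "b \<ge> norm y" "\<bar>b - a\<bar> \<le> norm (x - y)"
    using norm_triangle_ineq3[of x y] unfolding a_def b_def by (auto simp: max_def)
  have "radial_retraction \<rho> x - radial_retraction \<rho> y
      = (\<rho> / a) *\<^sub>R (x - y) + (\<rho> / a - \<rho> / b) *\<^sub>R y"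
    by (simp add: radial_retraction_def a_def b_def algebra_simps)
  also have "norm \<dots> \<le> (\<rho> / a) * norm (x - y) + \<bar>\<rho> / a - \<rho> / b\<bar> * norm y"
    using norm_triangle_ineq[of "(\<rho> / a) *\<^sub>R (x - y)" "(\<rho> / a - \<rho> / b) *\<^sub>R y"] assms ab by simp
  also have "\<bar>\<rho> / a - \<rho> / b\<bar> * norm y = (\<rho> / a) * \<bar>b - a\<bar> * (norm y / b)"
  proof -
    have "\<rho> / a - \<rho> / b = (\<rho> / a) * (b - a) / b"
      using ab assms by (simp add: field_simps)
    then show ?thesis
      using ab assms by (simp add: abs_mult)
  qed
  also have "(\<rho> / a) * norm (x - y) + (\<rho> / a) * \<bar>b - a\<bar> * (norm y / b)
      \<le> 1 * norm (x - y) + 1 * norm (x - y) * 1"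
    using ab assms by (intro add_mono mult_mono) auto
  finally show ?thesis by simp
qed

text \<open>Picard's fixed point argument on the whole half-line at once. The unknown is \<open>u(t) = e\<^sup>-\<^sup>l\<^sup>t g(t)\<close>,
  a bounded continuous function; for \<open>l > 2 K\<close> the integral operator halves distances. Times are
  clamped to \<open>max t 0\<close> because bounded continuous functions live on the whole line.\<close>

lemma global_lipschitz_ode:
  fixes F :: "'a::banach \<Rightarrow> 'a"
  assumes K: "K \<ge> 0" and lip: "\<And>x y. norm (F x - F y) \<le> K * norm (x - y)"
    and B: "\<And>x. norm (F x) \<le> B"
  shows "\<exists>g. g 0 = x0 \<and> (\<forall>t\<ge>0. (g has_vector_derivative F (g t)) (at t within {0..}))"
proof -
  define l where "l = 2 * K + 1"
  have l: "l > 0" "K / l \<le> 1/2" using K by (auto simp: l_def field_simps)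
  have contF: "continuous_on S F" for S
    by (rule continuous_on_compose2[of UNIV F _ "\<lambda>x. x"])
       (auto intro!: lipschitz_on_continuous_on[of K] lipschitz_onI simp: dist_norm lip K)
  have B0: "B \<ge> 0" using B[of 0] norm_ge_zero order_trans by blast
  define J where "J u t = x0 + integral {0..t} (\<lambda>s. F (exp (l * s) *\<^sub>R apply_bcontfun u s))" for u t
  have cont: "continuous_on S (\<lambda>s. F (exp (l * s) *\<^sub>R apply_bcontfun u s))" for u S
    by (rule continuous_on_compose2[OF contF[of UNIV]])
       (auto intro!: continuous_intros continuous_on_apply_bcontfun)
  have intgr: "(\<lambda>s. F (exp (l * s) *\<^sub>R apply_bcontfun u s)) integrable_on {0..t}" for u t
    by (rule integrable_continuous_real[OF cont])
  have Jder: "((\<lambda>t. J u t) has_vector_derivative F (exp (l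
      * t) *\<^sub>R apply_bcontfun u t)) (at t within {0..T})"
    if "0 \<le> t" "t \<le> T" for u t T
    unfolding J_def using integral_has_vector_derivative[OF cont, of t 0 T] that
    by (auto intro!: derivative_eq_intros)
  have nhd: "at t within {0..t+1} = at t within {0..}" if "0 \<le> t" for t :: real
    by (rule at_within_nhd[of t "{..<t+1}"]) auto
  have Jder0: "((\<lambda>t. J u t) has_vector_derivative F (exp (l
      * t) *\<^sub>R apply_bcontfun u t)) (at t within {0..})"
    if "0 \<le> t" for u t
    using Jder[of t "t+1" u] that nhd[of t] by auto
  have Jcont: "continuous_on {0..} (J u)" for u
    by (auto simp: continuous_on_eq_continuous_within intro: has_vector_derivative_continuous[OF Jder0])
  define P where "P u t = exp (- l * max t 0) *\<^sub>R J u (max t 0)" for u t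
  have Pcont: "continuous_on UNIV (P u)" for u
    unfolding P_def
    by (intro continuous_intros continuous_on_compose2[OF Jcont[of u]]) auto
  have Pbound: "norm (P u t) \<le> norm x0 + B / l" for u t
  proof -
    define r where "r = max t 0"
    have r: "r \<ge> 0" by (simp add: r_def)
    have "norm (integral {0..r} (\<lambda>s. F (exp (l * s) *\<^sub>R apply_bcontfun u s))) \<le> B * r"
      using integral_norm_bound_integral[OF intgr[of u r], of "\<lambda>s. B"] B r
      by (auto simp: mult.commute)
    then have J: "norm (J u r) \<le> norm x0 + B * r"
      unfolding J_def using norm_triangle_ineq by (smt (verit, best))
    have e: "exp (- l * r) \<le> 1" "exp (- l * r) * r \<le> 1 / l"
    proof -
      show "exp (- l * r) \<le> 1" using l r by simp
      have "l * r \<le> exp (l * r)" using exp_ge_add_one_self[of "l * r"] by linarith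
      then show "exp (- l * r) * r \<le> 1 / l"
        using l by (simp add: exp_minus field_simps)
    qed
    have "norm (P u t) = exp (- l * r) * norm (J u r)"
      by (simp add: P_def r_def)
    also have "\<dots> \<le> exp (- l * r) * (norm x0 + B * r)"
      using J by (intro mult_left_mono) auto
    also have "\<dots> = exp (- l * r) * norm x0 + B * (exp (- l * r) * r)"
      by (simp add: algebra_simps)
    also have "\<dots> \<le> 1 * norm x0 + B * (1 / l)"
      using e B0 r by (intro add_mono mult_mono) auto
    finally show ?thesis by simp
  qed
  have Pbc: "P u \<in> bcontfun" for u
    using Pcont Pbound by (rule bcontfun_normI)
  define Q where "Q u = Bcontfun (P u)" for u
  have Q: "apply_bcontfun (Q u) = P u" for u
    using Pbc by (simp add: Q_def Bcontfun_inverse)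
  have "dist (Q u) (Q v) \<le> (1/2) * dist u v" for u v
  proof (rule dist_bound)
    fix t :: real
    define r where "r = max t 0"
    have r: "r \<ge> 0" by (simp add: r_def)
    define D where "D = dist u v"
    have D: "D \<ge> 0" "\<And>s. norm (apply_bcontfun u s - apply_bcontfun v s) \<le> D"
      using dist_bounded[of u _ v] by (auto simp: D_def dist_norm)
    have le: "norm (F (exp (l * s) *\<^sub>R apply_bcontfun u s) - F (exp (l * s) *\<^sub>R apply_bcontfun v s))
        \<le> K * D * exp (l * s)" for s
    proof -
      have "norm (F (exp (l * s) *\<^sub>R apply_bcontfun u s) - F (exp (l * s) *\<^sub>R apply_bcontfun v s))
        \<le> K * norm (exp (l * s) *\<^sub>R (apply_bcontfun u s - apply_bcontfun v s))"
        using lip by (simp add: scaleR_right_diff_distrib)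
      also have "\<dots> \<le> K * (exp (l * s) * D)"
        using D K by (intro mult_left_mono) auto
      finally show ?thesis by (simp add: ac_simps)
    qed
    have hi: "((\<lambda>s. K * D * exp (l * s)) has_integral (K * D * exp (l * r) / l - K * D * exp (l
        * 0) / l)) {0..r}"
      using r l
      by (intro fundamental_theorem_of_calculus)
         (auto intro!: derivative_eq_intros simp flip: has_real_derivative_iff_has_vector_derivative)
    have "J u r - J v r = integral {0..r} (\<lambda>s. F (exp (l * s) *\<^sub>R apply_bcontfun u s) - F (exp (l
        * s) *\<^sub>R apply_bcontfun v s))"
      unfolding J_def by (subst Henstock_Kurzweil_Integration.integral_diff[OF intgr intgr]) simp
    also have "norm \<dots> \<le> integral {0..r} (\<lambda>s. K * D * exp (l * s))"
      using hi le by (intro integral_norm_bound_integral integrable_diff intgr) auto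
    also have "\<dots> \<le> (K / l) * exp (l * r) * D"
      using integral_unique[OF hi] mult_nonneg_nonneg[OF K D(1)] l by (simp add: divide_simps mult.commute)
    finally have J: "norm (J u r - J v r) \<le> (K / l) * exp (l * r) * D" .
    have "dist (Q u t) (Q v t) = exp (- l * r) * norm (J u r - J v r)"
      unfolding Q P_def r_def[symmetric] by (simp add: dist_norm flip: scaleR_right_diff_distrib)
    also have "\<dots> \<le> exp (- l * r) * ((K / l) * exp (l * r) * D)"
      using J by (intro mult_left_mono) auto
    also have "\<dots> = (K / l) * D" by (simp add: exp_minus)
    also have "\<dots> \<le> 1/2 * D" using l D by (intro mult_right_mono) auto
    finally show "dist (Q u t) (Q v t) \<le> 1/2 * dist u v" by (simp add: D_def)
  qed
  then obtain u where u: "Q u = u"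
    using banach_fix_type[of "1/2" Q] by auto
  have "exp (l * t) *\<^sub>R apply_bcontfun u t = J u t" if "t \<ge> 0" for t
  proof -
    have "apply_bcontfun u t = P u t" using u Q by metis
    then show ?thesis using that by (simp add: P_def exp_minus)
  qed
  then have "\<forall>t\<ge>0. (J u has_vector_derivative F (J u t)) (at t within {0..})"
    using Jder0 by metis
  moreover have "J u 0 = x0" by (simp add: J_def)
  ultimately show ?thesis by blast
qed

lemma nonincreasing_on_halfline:
  fixes f :: "real \<Rightarrow> real"
  assumes der: "\<And>t. t \<ge> 0 \<Longrightarrow> (f has_real_derivative f' t) (at t within {0..})"
    and nonpos: "\<And>t. 0 \<le> t \<Longrightarrow> t \<le> T \<Longrightarrow> f' t \<le> 0" and "0 \<le> t" "t \<le> T"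
  shows "f t \<le> f 0"
proof (cases "t = 0")
  case False
  with assms have t: "t > 0" by simp
  have "continuous_on {0..t} f"
    using der by (intro DERIV_continuous_on[of _ f f'] DERIV_subset[OF der]) auto
  moreover have "(f has_real_derivative f' x) (at x)" if "0 < x" for x
    using der[of x] that at_within_interior[of x "{0..}"] by simp
  ultimately show ?thesis
    using DERIV_nonpos_imp_decreasing_open[of 0 t f] nonpos t assms(4) by (metis less_eq_real_def
        order_trans)
qed simp

lemma has_real_derivative_norm_square:
  fixes g :: "real \<Rightarrow> 'a::real_inner"
  assumes "(g has_vector_derivative v) (at t within S)"
  shows "((\<lambda>s. (norm (g s))\<^sup>2) has_real_derivative 2 * (v \<bullet> g t)) (at t within S)"
proof -
  have "((\<lambda>s. g s \<bullet> g s) has_derivative (\<lambda>h. g t \<bullet> (h *\<^sub>R v) + (h *\<^sub>R v) \<bullet> g t)) (at t within S)"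
    using assms unfolding has_vector_derivative_def by (intro derivative_intros)
  moreover have "(\<lambda>h. g t \<bullet> (h *\<^sub>R v) + (h *\<^sub>R v) \<bullet> g t) = (*) (2 * (v \<bullet> g t))"
    by (auto simp: inner_commute)
  ultimately show ?thesis
    by (simp add: has_field_derivative_def power2_norm_eq_inner)
qed

text \<open>Gronwall: \<open>e\<^sup>-\<^sup>2\<^sup>K\<^sup>t \<parallel>g - h\<parallel>\<^sup>2\<close> is nonincreasing, with \<open>K\<close> a Lipschitz constant on a ball that
  contains both curves up to time \<open>T\<close>.\<close>

lemma ode_unique:
  fixes F :: "'a::real_inner \<Rightarrow> 'a"
  assumes lip: "\<And>R. \<exists>K. \<forall>x y. norm x \<le> R \<longrightarrow> norm y \<le> R \<longrightarrow> norm (F x - F y) \<le> K * norm (x - y)"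
    and g: "\<And>t. t \<ge> 0 \<Longrightarrow> (g has_vector_derivative F (g t)) (at t within {0..})"
    and h: "\<And>t. t \<ge> 0 \<Longrightarrow> (h has_vector_derivative F (h t)) (at t within {0..})"
    and "g 0 = h 0" "T \<ge> 0"
  shows "g T = h T"
proof -
  have "continuous_on {0..} g" "continuous_on {0..} h"
    by (auto simp: continuous_on_eq_continuous_within
        intro: has_vector_derivative_continuous[OF g] has_vector_derivative_continuous[OF h])
  then have "compact (g ` {0..T} \<union> h ` {0..T})"
    by (intro compact_Un compact_continuous_image) (auto intro: continuous_on_subset)
  then obtain R where R: "\<And>x. x \<in> g ` {0..T} \<union> h ` {0..T} \<Longrightarrow> norm x \<le> R"
    using compact_imp_bounded bounded_iff by metis
  obtain K where K: "\<And>x y. norm x \<le> R \<Longrightarrow> norm y \<le> R \<Longrightarrow> norm (F x - F y) \<le> K * norm (x - y)"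
    using lip by metis
  define w where "w t = (norm (g t - h t))\<^sup>2" for t
  have dw: "((\<lambda>t. exp (- 2 * K * t) * w t) has_real_derivative
      exp (- 2 * K * t) * (2 * ((F (g t) - F (h t)) \<bullet> (g t - h t)) - 2 * K * w t)) (at t within {0..})"
    if "t \<ge> 0" for t
  proof -
    have "(w has_real_derivative 2 * ((F (g t) - F (h t)) \<bullet> (g t - h t))) (at t within {0..})"
      unfolding w_def using g h that
      by (intro has_real_derivative_norm_square has_vector_derivative_diff) auto
    then show ?thesis
      by (auto intro!: derivative_eq_intros simp: algebra_simps)
  qed
  have "exp (- 2 * K * T) * w T \<le> exp (- 2 * K * 0) * w 0"
  proof (rule nonincreasing_on_halfline[OF dw, of T])
    fix t assume t: "0 \<le> t" "t \<le> T"
    have "(F (g t) - F (h t)) \<bullet> (g t - h t) \<le> norm (F (g t) - F (h t)) * norm (g t - h t)"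
      by (rule norm_cauchy_schwarz)
    also have "\<dots> \<le> K * norm (g t - h t) * norm (g t - h t)"
      using K R t by (intro mult_right_mono) auto
    finally have "2 * ((F (g t) - F (h t)) \<bullet> (g t - h t)) - 2 * K * w t \<le> 0"
      by (simp add: w_def power2_eq_square)
    then show "exp (- 2 * K * t) * (2 * ((F (g t) - F (h t)) \<bullet> (g t - h t)) - 2 * K * w t) \<le> 0"
      by (simp add: mult_nonneg_nonpos)
  qed (use assms in auto)
  then have "w T \<le> 0"
    using assms by (simp add: w_def mult_le_0_iff)
  then show ?thesis by (simp add: w_def)
qed

text \<open>Composing \<open>F\<close> with the retraction \<open>r\<close> to the ball makes it globally Lipschitz. As \<open>r x\<close> is a
  positive multiple of \<open>x\<close>, dissipativity on the ball gives \<open>\<langle>F (r x), x\<rangle> \<le> 0\<close> everywhere in the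
  complement of \<open>S\<close>; so the norm of the solution never increases, the solution stays in the ball and
  \<open>r\<close> disappears again.\<close>

lemma dissipative_ode:
  fixes F :: "'a::{banach, real_inner} \<Rightarrow> 'a" and S :: "'a set"
  assumes lip: "\<And>R. \<exists>K. \<forall>x y. norm x \<le> R \<longrightarrow> norm y \<le> R \<longrightarrow> norm (F x - F y) \<le> K * norm (x - y)"
    and range: "\<And>x. F x \<in> S\<^sup>\<bottom>"
    and diss: "\<And>x. x \<in> S\<^sup>\<bottom> \<Longrightarrow> norm x \<le> \<rho> \<Longrightarrow> F x \<bullet> x \<le> - \<delta> * (norm x)\<^sup>2"
    and "\<rho> > 0" "\<delta> > 0" and x0: "x0 \<in> S\<^sup>\<bottom>" "norm x0 \<le> \<rho>"
  shows "\<exists>g. g 0 = x0 \<and> (\<forall>t\<ge>0. (g has_vector_derivative F (g t)) (at t within {0..}))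
    \<and> (\<forall>t\<ge>0. g t \<in> S\<^sup>\<bottom>) \<and> (\<forall>t\<ge>0. norm (g t) \<le> exp (- \<delta> * t) * norm x0)"
proof -
  note \<rho> = \<open>\<rho> > 0\<close>
  define r where "r = (radial_retraction \<rho> :: 'a \<Rightarrow> 'a)"
  obtain K where K: "\<And>x y. norm x \<le> \<rho> \<Longrightarrow> norm y \<le> \<rho> \<Longrightarrow> norm (F x - F y) \<le> K * norm (x - y)"
    using lip by metis
  have "norm (F (r x) - F (r y)) \<le> (2 * \<bar>K\<bar>) * norm (x - y)" for x y
  proof -
    have "norm (F (r x) - F (r y)) \<le> K * norm (r x - r y)"
      using K \<rho> by (simp add: r_def norm_radial_retraction_le)
    also have "\<dots> \<le> \<bar>K\<bar> * (2 * norm (x - y))"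
      using radial_retraction_lipschitz[OF \<rho>, of x y]
      by (intro mult_mono) (auto simp: r_def)
    finally show ?thesis by simp
  qed
  moreover have "norm (F (r x)) \<le> norm (F 0) + \<bar>K\<bar> * \<rho>" for x
  proof -
    have "norm (F (r x) - F 0) \<le> K * norm (r x - 0)"
      using K[of "r x" 0] \<rho> by (simp add: r_def norm_radial_retraction_le)
    also have "\<dots> \<le> \<bar>K\<bar> * \<rho>"
      using \<rho> norm_radial_retraction_le[OF \<rho>, of x] by (intro mult_mono) (auto simp: r_def)
    finally show ?thesis
      using norm_triangle_sub[of "F (r x)" "F 0"] by linarith
  qed
  ultimately obtain g where g0: "g 0 = x0"
    and g: "\<And>t. t \<ge> 0 \<Longrightarrow> (g has_vector_derivative F (r (g t))) (at t within {0..})"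
    using global_lipschitz_ode[of "2 * \<bar>K\<bar>" "\<lambda>x. F (r x)" "norm (F 0) + \<bar>K\<bar> * \<rho>" x0] by auto
  have gS: "g t \<in> S\<^sup>\<bottom>" if "t \<ge> 0" for t
    unfolding orthogonal_comp_def orthogonal_def
  proof safe
    fix y assume y: "y \<in> S"
    have Fy: "F x \<bullet> y = 0" for x
      using range[of x] y by (simp add: orthogonal_comp_def orthogonal_def inner_commute)
    have d: "((\<lambda>s. g s \<bullet> y) has_real_derivative 0) (at s within {0..})" if "s \<ge> 0" for s
    proof -
      have "((\<lambda>s. g s \<bullet> y) has_derivative (\<lambda>h. (h *\<^sub>R F (r (g s))) \<bullet> y)) (at s within {0..})"
        using g[OF that] unfolding has_vector_derivative_def
        by (auto intro!: derivative_eq_intros)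
      moreover have "(\<lambda>h. 0) = (*) (0::real)" by auto
      ultimately show ?thesis by (simp add: Fy has_field_derivative_def)
    qed
    have "g t \<bullet> y \<le> g 0 \<bullet> y"
      using nonincreasing_on_halfline[OF d, of t t] that by simp
    moreover have "- (g t \<bullet> y) \<le> - (g 0 \<bullet> y)"
      using nonincreasing_on_halfline[of "\<lambda>s. - (g s \<bullet> y)" "\<lambda>_. -0" t t]
        that DERIV_minus[OF d] by simp
    moreover have "g 0 \<bullet> y = 0"
      using x0 y g0 by (auto simp: orthogonal_comp_def orthogonal_def inner_commute)
    ultimately show "y \<bullet> g t = 0" by (simp add: inner_commute)
  qed
  (* Here r x = c x with c > 0, so the sign can be read off at the point r x of the ball. *)
  have rg: "F (r x) \<bullet> x \<le> 0" if x: "x \<in> S\<^sup>\<bottom>" for x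
  proof -
    define c where "c = \<rho> / max \<rho> (norm x)"
    have c: "c > 0" "r x = c *\<^sub>R x" using \<rho> by (auto simp: c_def r_def radial_retraction_def)
    have "c *\<^sub>R x \<in> S\<^sup>\<bottom>" using x by (simp add: subspace_orthogonal_comp subspace_scale)
    then have "F (r x) \<bullet> r x \<le> - \<delta> * (norm (r x))\<^sup>2"
      using diss[of "r x"] c norm_radial_retraction_le[OF \<rho>, of x] by (simp add: r_def)
    also have "\<dots> \<le> 0" using \<open>\<delta> > 0\<close> by simp
    finally show ?thesis using c by (simp add: mult_le_0_iff)
  qed
  have le: "norm (g t) \<le> \<rho>" if "t \<ge> 0" for t
  proof -
    have "(norm (g t))\<^sup>2 \<le> (norm (g 0))\<^sup>2"
      by (rule nonincreasing_on_halfline[OF has_real_derivative_norm_square[OF g], where T=t])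
         (use that gS rg in \<open>auto simp: mult_le_0_iff\<close>)
    then show ?thesis using x0 g0 by (simp add: order_trans)
  qed
  then have req: "r (g t) = g t" if "t \<ge> 0" for t
    using that \<rho> by (simp add: r_def radial_retraction_eq)
  have dg: "(g has_vector_derivative F (g t)) (at t within {0..})" if "t \<ge> 0" for t
    using g[OF that] req[OF that] by simp
  have decay: "norm (g t) \<le> exp (- \<delta> * t) * norm x0" if "t \<ge> 0" for t
  proof -
    have d: "((\<lambda>t. exp (2 * \<delta> * t) * (norm (g t))\<^sup>2) has_real_derivative
      exp (2 * \<delta> * t) * (2 * (F (g t) \<bullet> g t) + 2 * \<delta> * (norm (g t))\<^sup>2)) (at t within {0..})"
      if "t \<ge> 0" for t
      by (rule derivative_eq_intros has_real_derivative_norm_square[OF dg[OF that]] refl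
          | simp add: algebra_simps)+
    have "exp (2 * \<delta> * t) * (norm (g t))\<^sup>2 \<le> exp (2 * \<delta> * 0) * (norm (g 0))\<^sup>2"
    proof (rule nonincreasing_on_halfline[OF d, where T=t])
      fix s assume s: "0 \<le> s" "s \<le> t"
      have "F (g s) \<bullet> g s \<le> - \<delta> * (norm (g s))\<^sup>2" using diss gS le s by simp
      then show "exp (2 * \<delta> * s) * (2 * (F (g s) \<bullet> g s) + 2 * \<delta> * (norm (g s))\<^sup>2) \<le> 0"
        by (simp add: mult_nonneg_nonpos)
    qed (use that in auto)
    then have "(exp (\<delta> * t) * norm (g t))\<^sup>2 \<le> (norm x0)\<^sup>2"
      by (simp add: g0 power_mult_distrib exp_double[symmetric] mult.assoc)
    then have "exp (\<delta> * t) * norm (g t) \<le> norm x0"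
      by (rule power2_le_imp_le) simp
    then have "exp (- \<delta> * t) * (exp (\<delta> * t) * norm (g t)) \<le> exp (- \<delta> * t) * norm x0"
      by (rule mult_left_mono) simp
    then show ?thesis by (simp add: mult.assoc[symmetric] flip: exp_add)
  qed
  show ?thesis using g0 dg gS decay by (intro exI[of _ g]) simp
qed

section \<open>Global solutions and exponential decay\<close>

theorem theorem2:
  fixes \<mu> lam :: real
  assumes "\<mu> > 0" and "spectral_gap \<mu> lam"
  shows "\<forall>\<delta>. 0 < \<delta> \<and> \<delta> < lam \<longrightarrow>
    (\<exists>\<rho>>0. \<forall>g0. g0 \<in> (Ker_L \<mu>)\<^sup>\<bottom> \<and> norm g0 \<le> \<rho> \<longrightarrow>
      (\<exists>g. global_solution \<mu> g0 g \<and>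
           (\<forall>h. global_solution \<mu> g0 h \<longrightarrow> (\<forall>t\<ge>0. h t = g t)) \<and>
           (\<forall>t\<ge>0. g t \<in> (Ker_L \<mu>)\<^sup>\<bottom> \<and> norm (g t) \<le> exp (- \<delta> * t) * norm g0)))"
proof (intro allI impI)
  fix \<delta> assume \<delta>: "0 < \<delta> \<and> \<delta> < lam"
  note \<mu> = \<open>\<mu> > 0\<close>
  interpret L: collision_form "linear_form \<mu>" "\<lambda>_. linear_const \<mu>"
    by (rule collision_form_linear[OF \<mu>])
  interpret G: collision_form "quadratic_form \<mu>" "\<lambda>S. 2 * quadratic_const \<mu> * S"
    by (rule collision_form_quadratic[OF \<mu>])
  interpret Q: collision_form "cubic_form \<mu>" "\<lambda>S. 3 * cubic_const \<mu> * S\<^sup>2"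
    by (rule collision_form_cubic[OF \<mu>])
  note ops = L_op_eq[OF \<mu>] Gamma_op_eq[OF \<mu>] Q_op_eq[OF \<mu>]
  define S where "S = (Ker_L \<mu>)\<^sup>\<bottom>"
  define F where "F x = L_op \<mu> x + Gamma_op \<mu> x + Q_op \<mu> x" for x
  have rangeF: "F x \<in> S" for x
  proof -
    have "L.op x \<in> S" "G.op x \<in> S" "Q.op x \<in> S"
      unfolding S_def
      by (rule L.orthogonal_kernel[OF \<mu> refl measurable_brackets(1) antisymmetric_linear_bracket]
          G.orthogonal_kernel[OF \<mu> refl measurable_brackets(2) antisymmetric_quadratic_bracket]
          Q.orthogonal_kernel[OF \<mu> refl measurable_brackets(3) antisymmetric_cubic_bracket]; assumption)+
    then show ?thesis
      unfolding F_def ops S_def by (intro subspace_add subspace_orthogonal_comp)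
  qed
  have lipF: "\<exists>K. \<forall>x y. norm x \<le> R \<longrightarrow> norm y \<le> R \<longrightarrow> norm (F x - F y) \<le> K * norm (x - y)" for R
  proof -
    obtain K1 K2 K3 where K: "\<And>x y. norm x \<le> R \<Longrightarrow> norm y \<le> R \<Longrightarrow> norm (L.op x - L.op y) \<le> K1 * norm (x - y)"
      "\<And>x y. norm x \<le> R \<Longrightarrow> norm y \<le> R \<Longrightarrow> norm (G.op x - G.op y) \<le> K2 * norm (x - y)"
      "\<And>x y. norm x \<le> R \<Longrightarrow> norm y \<le> R \<Longrightarrow> norm (Q.op x - Q.op y) \<le> K3 * norm (x - y)"
      using L.op_lipschitz_on_balls[of R] G.op_lipschitz_on_balls[of R] Q.op_lipschitz_on_balls[of
          R] by metis
    show ?thesis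
    proof (intro exI[of _ "K1 + K2 + K3"] allI impI)
      fix x y :: L2 assume xy: "norm x \<le> R" "norm y \<le> R"
      have "F x - F y = (L.op x - L.op y) + (G.op x - G.op y) + (Q.op x - Q.op y)"
        unfolding F_def ops by simp
      also have "norm \<dots> \<le> K1 * norm (x - y) + K2 * norm (x - y) + K3 * norm (x - y)"
        by (intro norm_triangle_le add_mono K xy)
      finally show "norm (F x - F y) \<le> (K1 + K2 + K3) * norm (x - y)"
        by (simp only: distrib_right)
    qed
  qed
  define C where "C = 2 * quadratic_const \<mu> + 3 * cubic_const \<mu>"
  have C: "C \<ge> 0" using quadratic_const_nonneg[OF \<mu>] cubic_const_nonneg[OF \<mu>] by (simp add: C_def)
  (* On this ball the quadratic and cubic parts contribute at most (lam - \<delta>) times the squared norm;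
     the bound by 1 lets the cubic part be absorbed into the quadratic one. *)
  define \<rho> where "\<rho> = min 1 ((lam - \<delta>) / (C + 1))"
  have \<rho>: "\<rho> > 0" "\<rho> \<le> 1" using \<delta> C by (simp_all add: \<rho>_def)
  have "C * \<rho> \<le> (C + 1) * ((lam - \<delta>) / (C + 1))"
    using C \<rho>(1) by (intro mult_mono) (auto simp: \<rho>_def)
  then have C\<rho>: "C * \<rho> \<le> lam - \<delta>" using C by simp
  (* An element of the complement has zero projection to the kernel, so the spectral gap is coercivity. *)
  have gap: "L_op \<mu> x \<bullet> x \<le> - lam * (norm x)\<^sup>2" if x: "x \<in> S" for x
  proof -
    have "orth_proj (Ker_L \<mu>) x = 0"
      unfolding orth_proj_def
    proof (rule the_equality)
      show "0 \<in> Ker_L \<mu> \<and> x - 0 \<in> (Ker_L \<mu>)\<^sup>\<bottom>"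
        using x L.op_zero by (simp add: S_def Ker_L_def ops)
      fix y assume y: "y \<in> Ker_L \<mu> \<and> x - y \<in> (Ker_L \<mu>)\<^sup>\<bottom>"
      then have "y \<bullet> x = 0" "y \<bullet> (x - y) = 0"
        using x unfolding S_def orthogonal_comp_def orthogonal_def by auto
      then show "y = 0" by (simp add: inner_diff_right)
    qed
    moreover have "- (L_op \<mu> x \<bullet> x) \<ge> lam * (norm (x - orth_proj (Ker_L \<mu>) x))\<^sup>2"
      using assms(2) unfolding spectral_gap_def by blast
    ultimately show ?thesis by simp
  qed
  have diss: "F x \<bullet> x \<le> - \<delta> * (norm x)\<^sup>2" if x: "x \<in> S" "norm x \<le> \<rho>" for x
  proof -
    define r where "r = norm x"
    have r: "0 \<le> r" "r \<le> \<rho>" "r \<le> 1" using x \<rho> by (simp_all add: r_def)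
    have "G.op x \<bullet> x \<le> norm (G.op x) * r" "Q.op x \<bullet> x \<le> norm (Q.op x) * r"
      unfolding r_def by (rule norm_cauchy_schwarz)+
    moreover have "norm (G.op x) * r \<le> (2 * quadratic_const \<mu> * r * r) * r"
      using G.norm_op_le[of x] r by (intro mult_right_mono) (simp_all add: r_def)
    moreover have "norm (Q.op x) * r \<le> (3 * cubic_const \<mu> * r * r) * r"
    proof (intro mult_right_mono)
      have "norm (Q.op x) \<le> 3 * cubic_const \<mu> * (r * r) * r"
        using Q.norm_op_le[of x] by (simp add: r_def power2_eq_square)
      also have "\<dots> \<le> 3 * cubic_const \<mu> * (r * 1) * r"
        using r cubic_const_nonneg[OF \<mu>] by (intro mult_right_mono mult_left_mono) auto
      finally show "norm (Q.op x) \<le> 3 * cubic_const \<mu> * r * r" by simp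
    qed (use r in simp)
    ultimately have "F x \<bullet> x \<le> - lam * r\<^sup>2 + C * r * r\<^sup>2"
      using gap[OF x(1)] unfolding F_def inner_add_left ops
      by (simp add: r_def[symmetric] C_def power2_eq_square algebra_simps)
    also have "\<dots> \<le> - lam * r\<^sup>2 + (lam - \<delta>) * r\<^sup>2"
      using r C C\<rho> by (intro add_left_mono mult_right_mono) (auto intro: order_trans[OF mult_left_mono])
    also have "\<dots> = - \<delta> * r\<^sup>2" by (simp add: algebra_simps)
    finally show ?thesis by (simp add: r_def)
  qed
  have contF: "continuous_on UNIV F"
    unfolding F_def[abs_def] ops by (intro continuous_on_add L.continuous_on_op G.continuous_on_op
        Q.continuous_on_op)
  have sol_iff: "global_solution \<mu> x0 g \<longleftrightarrow>
      g 0 = x0 \<and> (\<forall>t\<ge>0. (g has_vector_derivative F (g t)) (at t within {0..}))" for x0 g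
  proof
    assume "global_solution \<mu> x0 g"
    then show "g 0 = x0 \<and> (\<forall>t\<ge>0. (g has_vector_derivative F (g t)) (at t within {0..}))"
      unfolding global_solution_def F_def by metis
  next
    assume g: "g 0 = x0 \<and> (\<forall>t\<ge>0. (g has_vector_derivative F (g t)) (at t within {0..}))"
    then have "continuous_on {0..} g"
      by (auto simp: continuous_on_eq_continuous_within intro: has_vector_derivative_continuous)
    then have "continuous_on {0..} (\<lambda>t. F (g t))"
      by (rule continuous_on_compose2[OF contF]) auto
    then show "global_solution \<mu> x0 g"
      unfolding global_solution_def using g by (intro conjI exI[of _ "\<lambda>t. F (g t)"]) (auto simp: F_def)
  qed
  show "\<exists>\<rho>>0. \<forall>g0. g0 \<in> (Ker_L \<mu>)\<^sup>\<bottom> \<and> norm g0 \<le> \<rho> \<longrightarrow>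
      (\<exists>g. global_solution \<mu> g0 g \<and>
           (\<forall>h. global_solution \<mu> g0 h \<longrightarrow> (\<forall>t\<ge>0. h t = g t)) \<and>
           (\<forall>t\<ge>0. g t \<in> (Ker_L \<mu>)\<^sup>\<bottom> \<and> norm (g t) \<le> exp (- \<delta> * t) * norm g0))"
  proof (intro exI[of _ \<rho>] conjI allI impI)
    fix g0 assume g0: "g0 \<in> (Ker_L \<mu>)\<^sup>\<bottom> \<and> norm g0 \<le> \<rho>"
    have "\<exists>g. g 0 = g0 \<and> (\<forall>t\<ge>0. (g has_vector_derivative F (g t)) (at t within {0..}))
        \<and> (\<forall>t\<ge>0. g t \<in> (Ker_L \<mu>)\<^sup>\<bottom>) \<and> (\<forall>t\<ge>0. norm (g t) \<le> exp (- \<delta> * t) * norm g0)"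
      by (rule dissipative_ode[OF lipF rangeF[unfolded S_def] diss[unfolded S_def] \<rho>(1)])
         (use \<delta> g0 in simp_all)
    then obtain g where g: "g 0 = g0" "\<forall>t\<ge>0. (g has_vector_derivative F (g t)) (at t within {0..})"
      and invariant: "\<forall>t\<ge>0. g t \<in> (Ker_L \<mu>)\<^sup>\<bottom>"
      and decay: "\<forall>t\<ge>0. norm (g t) \<le> exp (- \<delta> * t) * norm g0"
      by (elim exE conjE) (rule that)
    have unique: "h t = g t" if h: "global_solution \<mu> g0 h" and t: "t \<ge> 0" for h t
    proof (rule ode_unique[OF lipF])
      show "h 0 = g 0" using h g(1) by (simp add: sol_iff)
    qed (use h g(2) t in \<open>simp_all add: sol_iff\<close>)
    have "global_solution \<mu> g0 g"
      unfolding sol_iff by (intro conjI g)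
    then show "\<exists>g. global_solution \<mu> g0 g \<and>
           (\<forall>h. global_solution \<mu> g0 h \<longrightarrow> (\<forall>t\<ge>0. h t = g t)) \<and>
           (\<forall>t\<ge>0. g t \<in> (Ker_L \<mu>)\<^sup>\<bottom> \<and> norm (g t) \<le> exp (- \<delta> * t) * norm g0)"
    proof (intro exI[of _ g] conjI allI impI)
      fix t :: real assume t: "t \<ge> 0"
      show "h t = g t" if "global_solution \<mu> g0 h" for h by (rule unique[OF that t])
      show "g t \<in> (Ker_L \<mu>)\<^sup>\<bottom>" by (rule invariant[rule_format, OF t])
      show "norm (g t) \<le> exp (- \<delta> * t) * norm g0" by (rule decay[rule_format, OF t])
    qed
  qed (rule \<rho>(1))
qed

end
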